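(* Let $\mathbb{K}$ be a field, $l\ge 1$ an integer, $I=\{1,\dots,l\}$, and let $\mathfrak{A}=\bigoplus_{i\in I}\mathbb{Z}\alpha_i$ be a free abelian group with $\mathbb{Z}$-basis $\alpha_1,\dots,\alpha_l$. Put $\mathfrak{A}^+=\bigoplus_{i\in I}\mathbb{Z}_{\ge0}\alpha_i$. Let $\chi:\mathfrak{A}\times\mathfrak{A}\to\mathbb{K}^\times$ be a bicharacter, let $\omega:\mathfrak{A}\to\mathbb{K}^\times$ be a group homomorphism, and let $U=U(\chi,\pi)$ be the associated generalized quantum group. Let $\lambda,\mu\in\mathfrak{A}$ and let $\Lambda=\Lambda^\chi_{\lambda,\mu;\omega}:U^0\to\mathbb{K}$ be the $\mathbb{K}$-algebra homomorphism with $$\Lambda(K_{\lambda'}L_{\mu'})=\chi(\lambda,\mu')\,\chi(\lambda',\mu)\,\omega(\lambda')\qquad(\lambda',\mu'\in\mathfrak{A}).$$ Assume that the simple highest weight module $\mathcal{L}(\Lambda)$ is finite dimensional over $\mathbb{K}$, and for $\nu\in\mathfrak{A}^+$ put $\breve m_\nu:=\dim_{\mathbb{K}}U^-_{-\nu}v_\Lambda$. Then there exists an element $Z^\chi_{\lambda,\mu;\omega}$ of the skew center $$\mathfrak{Z}_\omega(\chi,\pi)=\{Z\in U_0\mid ZX=\omega(\kappa)XZ\ \text{ for all }\kappa\in\mathfrak{A},\ X\in U_\kappa\}$$ such that $$\mathfrak{HC}^{\chi,\pi}_\omega(Z^\chi_{\lambda,\mu;\omega})=\sum_{\nu\in\mathfrak{A}^+}\hat\rho^{\chi,\pi}(\nu)\,\breve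 m_\nu\,K_{\lambda+\nu}L_{\mu-\nu},$$ where $\mathfrak{HC}^{\chi,\pi}_\omega$ is the restriction to $\mathfrak{Z}_\omega(\chi,\pi)$ of the projection $\mathfrak{Sh}^{\chi,\pi}:U\to U^0$.
   Context: A bicharacter is a map $\chi:\mathfrak{A}\times\mathfrak{A}\to\mathbb{K}^\times$ with $\chi(\lambda+\mu,\nu)=\chi(\lambda,\nu)\chi(\mu,\nu)$ and $\chi(\lambda,\mu+\nu)=\chi(\lambda,\mu)\chi(\lambda,\nu)$. The map $\pi:I\to\mathfrak{A}$ is $\pi(i)=\alpha_i$. Generalized quantum group: $U=U(\chi,\pi)$ is the (unique, and known to exist) unital associative $\mathbb{K}$-algebra satisfying: (U1) $U$ is generated by elements $K_\lambda,L_\lambda$ ($\lambda\in\mathfrak{A}$), $E_i,F_i$ ($i\in I$). (U2) $K_0=L_0=1$, $K_\lambda K_\mu=K_{\lambda+\mu}$, $L_\lambda L_\mu=L_{\lambda+\mu}$, $K_\lambda L_\mu=L_\mu K_\lambda$, $K_\lambda E_i=\chi(\lambda,\alpha_i)E_iK_\lambda$, $L_\lambda E_i=\chi(-\alpha_i,\lambda)E_iL_\lambda$, $K_\lambda F_i=\chi(\lambda,-\alpha_i)F_iK_\lambda$, $L_\lambda F_i=\chi(\alpha_i,\lambda)F_iL_\lambda$, $E_iF_j-F_jE_i=\delta_{ij}(-K_{\alpha_i}+L_{\alpha_i})$. (U3) The elements $K_\lambda L_\mu$ ($\lambda,\mu\in\mathfrak{A}$) are pairwise distinct and linearly independent; $U^0$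 denotes their span (a subalgebra). (U4) There is a grading $U=\bigoplus_{\lambda\in\mathfrak{A}}U_\lambda$ with $U_\lambda U_\mu\subset U_{\lambda+\mu}$, $U^0\subset U_0$, $E_i\in U_{\alpha_i}$, $F_i\in U_{-\alpha_i}$. (U5) With $U^+$ (resp. $U^-$) the unital subalgebra generated by the $E_i$ (resp. the $F_i$), the multiplication map $U^-\otimes U^0\otimes U^+\to U$, $Y\otimes Z\otimes X\mapsto YZX$, is a linear isomorphism. (U6) Put $U^\pm_\lambda=U^\pm\cap U_\lambda$. For $\lambda\in\mathfrak{A}^+\setminus\{0\}$: $\{X\in U^+_\lambda\mid XF_i=F_iX\ \forall i\in I\}=\{0\}$ and $\{Y\in U^-_{-\lambda}\mid E_iY=YE_i\ \forall i\in I\}=\{0\}$. Projection: let $\varepsilon:U^\pm\to\mathbb{K}$ be the algebra homomorphisms with $\varepsilon(E_i)=0$, $\varepsilon(F_i)=0$. $\mathfrak{Sh}^{\chi,\pi}:U\to U^0$ is the linear map with $\mathfrak{Sh}^{\chi,\pi}(YK_\lambda L_\mu X)=\varepsilon(Y)\varepsilon(X)K_\lambda L_\mu$ for $X\in U^+$, $Y\in U^-$, $\lambda,\mu\in\mathfrak{A}$. $\hat\rho^{\chi,\pi}:\mathfrak{A}\to\mathbb{K}^\times$ is the group homomorphism with $\hat\rho^{\chi,\pi}(\alpha_j)=\chi(\alpha_j,\alpha_j)$ for $j\in I$. For a $\mathbb{K}$-algebra homomorphism $\Lambda:U^0\to\mathbb{K}$, $\mathcal{L}(\Lambda)$ denotes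 the simple $U$-module with a vector $v_\Lambda\neq0$ such that $\mathcal{L}(\Lambda)=\bigoplus_{\nu\in\mathfrak{A}^+}U^-_{-\nu}v_\Lambda$, $Zv_\Lambda=\Lambda(Z)v_\Lambda$ for $Z\in U^0$, and $E_iv_\Lambda=0$ for $i\in I$. The integers $\breve m_\nu$ are regarded as elements of $\mathbb{K}$ in the formula. *)

theory Defs
  imports
    "HOL-Analysis.Finite_Cartesian_Product"
    "HOL-Library.Poly_Mapping"
    "HOL-Library.FuncSet"
begin

section \<open>The lattice, bicharacters and characters\<close>

text \<open>The index set \<open>I\<close> is a nonempty finite type \<open>'i\<close> and \<open>\<AA>\<close> is the free abelian group
  \<open>int ^ 'i\<close>, with basis the unit vectors.  Maps into \<open>\<KK>\<^sup>\<times>\<close> are maps into the field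
  that never vanish.\<close>

definition simple_root :: "'i::finite \<Rightarrow> int ^ 'i" where
  "simple_root i = axis i 1"

definition pos_lattice :: "(int ^ 'i::finite) set" where
  "pos_lattice = {\<nu>. \<forall>i. 0 \<le> \<nu> $ i}"

definition bicharacter :: "('a::ab_group_add \<Rightarrow> 'a \<Rightarrow> 'k::field) \<Rightarrow> bool" where
  "bicharacter chi \<longleftrightarrow>
     (\<forall>x y. chi x y \<noteq> 0) \<and>
     (\<forall>x y z. chi (x + y) z = chi x z * chi y z) \<and>
     (\<forall>x y z. chi x (y + z) = chi x y * chi x z)"

definition mult_character :: "('a::ab_group_add \<Rightarrow> 'k::field) \<Rightarrow> bool" where
  "mult_character \<omega> \<longleftrightarrow> (\<forall>x. \<omega> x \<noteq> 0) \<and> (\<forall>x y. \<omega> (x + y) = \<omega> x * \<omega> y)"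

definition rho_hat :: "(int ^ 'i::finite \<Rightarrow> int ^ 'i \<Rightarrow> 'k::field) \<Rightarrow> int ^ 'i \<Rightarrow> 'k" where
  "rho_hat chi = (THE r. mult_character r \<and>
     (\<forall>j. r (simple_root j) = chi (simple_root j) (simple_root j)))"

section \<open>Linear algebra\<close>

definition internal_direct_sum ::
  "('k::field \<Rightarrow> 'v::ab_group_add \<Rightarrow> 'v) \<Rightarrow> 'j set \<Rightarrow> ('j \<Rightarrow> 'v set) \<Rightarrow> bool" where
  "internal_direct_sum smul J W \<longleftrightarrow>
     (\<forall>j\<in>J. module.subspace smul (W j)) \<and>
     (\<forall>x. \<exists>!c. finite {j. c j \<noteq> 0} \<and> (\<forall>j\<in>J. c j \<in> W j) \<and> (\<forall>j. j \<notin> J \<longrightarrow> c j = 0) \<and>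
               x = (\<Sum>j | c j \<noteq> 0. c j))"

definition finite_dimensional ::
  "('k::field \<Rightarrow> 'v::ab_group_add \<Rightarrow> 'v) \<Rightarrow> bool" where
  "finite_dimensional smul \<longleftrightarrow> (\<exists>B. finite_dimensional_vector_space smul B)"

text \<open>The tensor product \<open>A \<otimes> B \<otimes> C\<close> of three subspaces of an algebra, constructed as the
  free vector space on \<open>A \<times> B \<times> C\<close> modulo the trilinearity relations, and the linear map
  \<open>A \<otimes> B \<otimes> C \<rightarrow> U\<close> induced by multiplication.\<close>

definition free_scale :: "'k::field \<Rightarrow> ('b \<Rightarrow>\<^sub>0 'k) \<Rightarrow> ('b \<Rightarrow>\<^sub>0 'k)" where
  "free_scale c = Poly_Mapping.map ((*) c)"

abbreviation free_gen :: "'b \<Rightarrow> ('b \<Rightarrow>\<^sub>0 'k::field)" where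
  "free_gen b \<equiv> Poly_Mapping.single b 1"

definition tensor_relations ::
  "('k::field \<Rightarrow> 'u::ab_group_add \<Rightarrow> 'u) \<Rightarrow> 'u set \<Rightarrow> 'u set \<Rightarrow> 'u set \<Rightarrow> ('u \<times> 'u \<times> 'u \<Rightarrow>\<^sub>0 'k) set" where
  "tensor_relations smul A B C = module.span free_scale
     ({free_gen (a + a', b, c) - free_gen (a, b, c) - free_gen (a', b, c)
         | a a' b c. a \<in> A \<and> a' \<in> A \<and> b \<in> B \<and> c \<in> C} \<union>
      {free_gen (a, b + b', c) - free_gen (a, b, c) - free_gen (a, b', c)
         | a b b' c. a \<in> A \<and> b \<in> B \<and> b' \<in> B \<and> c \<in> C} \<union>
      {free_gen (a, b, c + c') - free_gen (a, b, c) - free_gen (a, b, c')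
         | a b c c'. a \<in> A \<and> b \<in> B \<and> c \<in> C \<and> c' \<in> C} \<union>
      {free_gen (smul k a, b, c) - free_scale k (free_gen (a, b, c))
         | k a b c. a \<in> A \<and> b \<in> B \<and> c \<in> C} \<union>
      {free_gen (a, smul k b, c) - free_scale k (free_gen (a, b, c))
         | k a b c. a \<in> A \<and> b \<in> B \<and> c \<in> C} \<union>
      {free_gen (a, b, smul k c) - free_scale k (free_gen (a, b, c))
         | k a b c. a \<in> A \<and> b \<in> B \<and> c \<in> C})"

definition tensor3 ::
  "('k::field \<Rightarrow> 'u::ab_group_add \<Rightarrow> 'u) \<Rightarrow> 'u set \<Rightarrow> 'u set \<Rightarrow> 'u set \<Rightarrow> ('u \<times> 'u \<times> 'u \<Rightarrow>\<^sub>0 'k) set set" where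
  "tensor3 smul A B C =
     {p. Poly_Mapping.keys p \<subseteq> A \<times> B \<times> C} // {(p, q). p - q \<in> tensor_relations smul A B C}"

definition free_mult ::
  "('k::field \<Rightarrow> 'u::ring_1 \<Rightarrow> 'u) \<Rightarrow> ('u \<times> 'u \<times> 'u \<Rightarrow>\<^sub>0 'k) \<Rightarrow> 'u" where
  "free_mult smul p =
     (\<Sum>t\<in>Poly_Mapping.keys p.
        smul (Poly_Mapping.lookup p t) (case t of (y, z, x) \<Rightarrow> y * z * x))"

text \<open>\<open>free_mult\<close> is constant on cosets of the relations, so its image on a coset is a singleton.\<close>

definition tensor_mult ::
  "('k::field \<Rightarrow> 'u::ring_1 \<Rightarrow> 'u) \<Rightarrow> ('u \<times> 'u \<times> 'u \<Rightarrow>\<^sub>0 'k) set \<Rightarrow> 'u" where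
  "tensor_mult smul T = the_elem (free_mult smul ` T)"

section \<open>Algebras\<close>

locale k_algebra = vector_space smul
  for smul :: "'k::field \<Rightarrow> 'u::ring_1 \<Rightarrow> 'u" +
  assumes smul_mult_left: "smul c x * y = smul c (x * y)"
    and smul_mult_right: "x * smul c y = smul c (x * y)"

definition subalgebra :: "('k::field \<Rightarrow> 'u::ring_1 \<Rightarrow> 'u) \<Rightarrow> 'u set \<Rightarrow> bool" where
  "subalgebra smul A \<longleftrightarrow>
     module.subspace smul A \<and> 1 \<in> A \<and> (\<forall>x\<in>A. \<forall>y\<in>A. x * y \<in> A)"

definition subalgebra_gen :: "('k::field \<Rightarrow> 'u::ring_1 \<Rightarrow> 'u) \<Rightarrow> 'u set \<Rightarrow> 'u set" where
  "subalgebra_gen smul S = subalgebra smul hull S"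

definition alg_hom_on ::
  "('k::field \<Rightarrow> 'u::ring_1 \<Rightarrow> 'u) \<Rightarrow> 'u set \<Rightarrow> ('u \<Rightarrow> 'k) \<Rightarrow> bool" where
  "alg_hom_on smul A f \<longleftrightarrow>
     f 1 = 1 \<and>
     (\<forall>x\<in>A. \<forall>y\<in>A. f (x + y) = f x + f y \<and> f (x * y) = f x * f y) \<and>
     (\<forall>c. \<forall>x\<in>A. f (smul c x) = c * f x)"

section \<open>Generalized quantum groups\<close>

definition cartan_part ::
  "('k::field \<Rightarrow> 'u::ring_1 \<Rightarrow> 'u) \<Rightarrow> ('a \<Rightarrow> 'u) \<Rightarrow> ('a \<Rightarrow> 'u) \<Rightarrow> 'u set" where
  "cartan_part smul K L = module.span smul (range (\<lambda>(lam, mu). K lam * L mu))"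

text \<open>The subalgebras \<open>U\<^sup>+\<close> and \<open>U\<^sup>-\<close> are \<open>half_part smul E\<close> and \<open>half_part smul F\<close>.\<close>

definition half_part :: "('k::field \<Rightarrow> 'u::ring_1 \<Rightarrow> 'u) \<Rightarrow> ('i \<Rightarrow> 'u) \<Rightarrow> 'u set" where
  "half_part smul G = subalgebra_gen smul (range G)"

text \<open>\<open>Ugr lam\<close> is the homogeneous component \<open>U\<^sub>\<lambda>\<close>; in particular \<open>Ugr 0\<close> is \<open>U\<^sub>0\<close>, whereas
  \<open>cartan_part smul K L\<close> is \<open>U\<^sup>0\<close>.  As \<open>U\<close> is generated by homogeneous elements of prescribed
  degree, the grading is determined by the other data.\<close>

locale generalized_quantum_group = k_algebra smul
  for smul :: "'k::field \<Rightarrow> 'u::ring_1 \<Rightarrow> 'u"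
    and chi :: "int ^ 'i::finite \<Rightarrow> int ^ 'i \<Rightarrow> 'k"
    and K L :: "int ^ 'i \<Rightarrow> 'u"
    and E F :: "'i \<Rightarrow> 'u"
    and Ugr :: "int ^ 'i \<Rightarrow> 'u set" +
  assumes U1_generated:
      "subalgebra_gen smul (range K \<union> range L \<union> range E \<union> range F) = UNIV"
    and U2_K_zero: "K 0 = 1" and U2_L_zero: "L 0 = 1"
    and U2_KK: "K lam * K mu = K (lam + mu)"
    and U2_LL: "L lam * L mu = L (lam + mu)"
    and U2_KL: "K lam * L mu = L mu * K lam"
    and U2_KE: "K lam * E i = smul (chi lam (simple_root i)) (E i * K lam)"
    and U2_LE: "L lam * E i = smul (chi (- simple_root i) lam) (E i * L lam)"
    and U2_KF: "K lam * F i = smul (chi lam (- simple_root i)) (F i * K lam)"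
    and U2_LF: "L lam * F i = smul (chi (simple_root i) lam) (F i * L lam)"
    and U2_EF: "E i * F j - F j * E i =
                  (if i = j then - K (simple_root i) + L (simple_root i) else 0)"
    and U3_distinct: "inj (\<lambda>(lam, mu). K lam * L mu)"
    and U3_independent: "\<not> module.dependent smul (range (\<lambda>(lam, mu). K lam * L mu))"
    and U4_grading: "internal_direct_sum smul UNIV Ugr"
    and U4_mult: "x \<in> Ugr lam \<Longrightarrow> y \<in> Ugr mu \<Longrightarrow> x * y \<in> Ugr (lam + mu)"
    and U4_cartan: "cartan_part smul K L \<subseteq> Ugr 0"
    and U4_E: "E i \<in> Ugr (simple_root i)"
    and U4_F: "F i \<in> Ugr (- simple_root i)"
    and U5_triangular:
      "bij_betw (tensor_mult smul)
         (tensor3 smul (half_part smul F) (cartan_part smul K L) (half_part smul E)) UNIV"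
    and U6_plus: "lam \<in> pos_lattice - {0} \<Longrightarrow>
      {X \<in> half_part smul E \<inter> Ugr lam. \<forall>i. X * F i = F i * X} = {0}"
    and U6_minus: "lam \<in> pos_lattice - {0} \<Longrightarrow>
      {Y \<in> half_part smul F \<inter> Ugr (- lam). \<forall>i. E i * Y = Y * E i} = {0}"

section \<open>The Harish-Chandra map on the skew center\<close>

text \<open>Partial functions are made unique by the value \<open>undefined\<close> outside their domain.\<close>

definition counit_on :: "('k::field \<Rightarrow> 'u::ring_1 \<Rightarrow> 'u) \<Rightarrow> ('i \<Rightarrow> 'u) \<Rightarrow> 'u \<Rightarrow> 'k" where
  "counit_on smul G = (THE e. e \<in> extensional (half_part smul G) \<and>
     alg_hom_on smul (half_part smul G) e \<and> (\<forall>i. e (G i) = 0))"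

definition Sh ::
  "('k::field \<Rightarrow> 'u::ring_1 \<Rightarrow> 'u) \<Rightarrow> ('a \<Rightarrow> 'u) \<Rightarrow> ('a \<Rightarrow> 'u) \<Rightarrow> ('i \<Rightarrow> 'u) \<Rightarrow> ('i \<Rightarrow> 'u) \<Rightarrow> 'u \<Rightarrow> 'u" where
  "Sh smul K L E F = (THE f. Vector_Spaces.linear smul smul f \<and>
     (\<forall>X\<in>half_part smul E. \<forall>Y\<in>half_part smul F. \<forall>lam mu.
        f (Y * K lam * L mu * X) =
          smul (counit_on smul F Y * counit_on smul E X) (K lam * L mu)))"

definition skew_center ::
  "('k::field \<Rightarrow> 'u::ring_1 \<Rightarrow> 'u) \<Rightarrow> ('a::zero \<Rightarrow> 'u set) \<Rightarrow> ('a \<Rightarrow> 'k) \<Rightarrow> 'u set" where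
  "skew_center smul Ugr \<omega> =
     {Z \<in> Ugr 0. \<forall>\<kappa>. \<forall>X\<in>Ugr \<kappa>. Z * X = smul (\<omega> \<kappa>) (X * Z)}"

definition HC ::
  "('k::field \<Rightarrow> 'u::ring_1 \<Rightarrow> 'u) \<Rightarrow> ('a::zero \<Rightarrow> 'u) \<Rightarrow> ('a \<Rightarrow> 'u) \<Rightarrow> ('i \<Rightarrow> 'u) \<Rightarrow> ('i \<Rightarrow> 'u)
     \<Rightarrow> ('a \<Rightarrow> 'u set) \<Rightarrow> ('a \<Rightarrow> 'k) \<Rightarrow> 'u \<Rightarrow> 'u" where
  "HC smul K L E F Ugr \<omega> = restrict (Sh smul K L E F) (skew_center smul Ugr \<omega>)"

section \<open>Highest weight modules\<close>

locale algebra_module = k_algebra smul + V: vector_space smulV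
  for smul :: "'k::field \<Rightarrow> 'u::ring_1 \<Rightarrow> 'u"
    and smulV :: "'k \<Rightarrow> 'v::ab_group_add \<Rightarrow> 'v"
    and act :: "'u \<Rightarrow> 'v \<Rightarrow> 'v" +
  assumes act_add_left: "act (x + y) w = act x w + act y w"
    and act_add_right: "act x (w + w') = act x w + act x w'"
    and act_smul_left: "act (smul c x) w = smulV c (act x w)"
    and act_smul_right: "act x (smulV c w) = smulV c (act x w)"
    and act_one: "act 1 w = w"
    and act_mult: "act (x * y) w = act x (act y w)"

locale simple_algebra_module = algebra_module smul smulV act
  for smul :: "'k::field \<Rightarrow> 'u::ring_1 \<Rightarrow> 'u"
    and smulV :: "'k \<Rightarrow> 'v::ab_group_add \<Rightarrow> 'v"
    and act :: "'u \<Rightarrow> 'v \<Rightarrow> 'v" +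
  assumes nontrivial: "\<exists>w::'v. w \<noteq> 0"
    and simple: "module.subspace smulV W \<Longrightarrow> (\<forall>x. \<forall>w\<in>W. act x w \<in> W) \<Longrightarrow> W = {0} \<or> W = UNIV"

text \<open>The subspace \<open>U\<^sup>-\<^sub>-\<^sub>\<nu> v\<close>.\<close>

definition weight_part ::
  "('k::field \<Rightarrow> 'u::ring_1 \<Rightarrow> 'u) \<Rightarrow> ('i \<Rightarrow> 'u) \<Rightarrow> ('a::ab_group_add \<Rightarrow> 'u set)
     \<Rightarrow> ('u \<Rightarrow> 'v \<Rightarrow> 'v) \<Rightarrow> 'v \<Rightarrow> 'a \<Rightarrow> 'v set" where
  "weight_part smul F Ugr act v \<nu> = (\<lambda>Y. act Y v) ` (half_part smul F \<inter> Ugr (- \<nu>))"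

text \<open>The module \<open>\<L>(\<Lambda>)\<close> on the type \<open>'v\<close>, with highest weight vector \<open>v\<close>; only the values of
  \<open>\<Lambda>\<close> on \<open>U\<^sup>0\<close> matter.\<close>

locale simple_highest_weight_module = simple_algebra_module smul smulV act
  for smul :: "'k::field \<Rightarrow> 'u::ring_1 \<Rightarrow> 'u"
    and K L :: "int ^ 'i::finite \<Rightarrow> 'u"
    and E F :: "'i \<Rightarrow> 'u"
    and Ugr :: "int ^ 'i \<Rightarrow> 'u set"
    and \<Lambda> :: "'u \<Rightarrow> 'k"
    and smulV :: "'k \<Rightarrow> 'v::ab_group_add \<Rightarrow> 'v"
    and act :: "'u \<Rightarrow> 'v \<Rightarrow> 'v"
    and v :: 'v +
  assumes v_nonzero: "v \<noteq> 0"
    and weight_decomposition: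
      "internal_direct_sum smulV pos_lattice (weight_part smul F Ugr act v)"
    and highest_weight: "Z \<in> cartan_part smul K L \<Longrightarrow> act Z v = smulV (\<Lambda> Z) v"
    and E_annihilates: "act (E i) v = 0"

text \<open>When \<open>\<L>(\<Lambda>)\<close> is finite dimensional, only finitely many of these are nonzero; sums over
  \<open>\<AA>\<^sup>+\<close> weighted by multiplicities are taken over this finite support, since \<open>sum\<close> over an
  infinite index set is \<open>0\<close> by convention.\<close>

definition weight_mult ::
  "('k::field \<Rightarrow> 'u::ring_1 \<Rightarrow> 'u) \<Rightarrow> ('i \<Rightarrow> 'u) \<Rightarrow> ('a::ab_group_add \<Rightarrow> 'u set)
     \<Rightarrow> ('k \<Rightarrow> 'v::ab_group_add \<Rightarrow> 'v) \<Rightarrow> ('u \<Rightarrow> 'v \<Rightarrow> 'v) \<Rightarrow> 'v \<Rightarrow> 'a \<Rightarrow> nat" where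
  "weight_mult smul F Ugr smulV act v \<nu> =
     vector_space.dim smulV (weight_part smul F Ugr act v \<nu>)"

end

theory Submission
  imports Defs
begin

text \<open>Write \<open>V\<close> for the module and \<open>V\<^sub>\<nu>\<close> for its weight space \<open>U\<^sup>-\<^sub>-\<^sub>\<nu> v\<close>.  The graded pieces \<open>U\<^sup>+\<^sub>\<beta>\<close> and
  \<open>U\<^sup>-\<^sub>-\<^sub>\<beta>\<close> are dual under a pairing for which left and right multiplication by \<open>E\<^sub>i\<close> are adjoint
  to the two skew derivations describing \<open>[E\<^sub>i, Y]\<close>; nondegeneracy is (U6).  With dual bases
  \<open>x\<^sub>s\<close>, \<open>y\<^sub>s\<close> the element is the quantum trace
  \<open>Z = \<Sum> \<rho>(\<nu>) / (\<omega>(\<beta>) \<chi>(\<lambda> + \<nu>, \<beta>)) tr(x\<^sub>s y\<^sub>t on V\<^sub>\<nu>) y\<^sub>s K\<^sub>\<lambda>\<^sub>+\<^sub>\<nu> L\<^sub>\<mu>\<^sub>-\<^sub>\<nu>\<^sub>-\<^sub>\<beta> x\<^sub>t\<close>,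
  the sum being over \<open>\<nu>\<close>, \<open>\<beta>\<close>, \<open>s\<close>, \<open>t\<close>.  Only its terms with \<open>\<beta> = 0\<close> survive \<open>Sh\<close>.  Moving \<open>E\<^sub>i\<close> through \<open>Z\<close> by
  adjointness, everything except \<open>\<omega>(\<alpha>\<^sub>i)\<^sup>-\<^sup>1 Z E\<^sub>i\<close> cancels because of the cyclicity of the trace.
  The defect \<open>Z F\<^sub>i - \<omega>(-\<alpha>\<^sub>i) F\<^sub>i Z\<close> then skew-commutes with all \<open>E\<^sub>j\<close> and has negative degree,
  which by (U6) forces it to vanish.\<close>

subsection \<open>Graded spaces and dual bases\<close>

text \<open>The data provide no comultiplication and no invariant form; the nondegeneracy at hand is
  (U6). It controls elements killed by both families of skew derivations, while the pairing needs
  that a single family has no common kernel. The two families commute, and this upgrades (U6) by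
  induction on the height. The canonical elements, the sums of y_s tensor x_s, act as a
  quasi-R-matrix: Z is the partial trace over V of one of them times the flip of another, with a
  Cartan factor in between. The constants are forced. Raising beta by alpha_i must divide the weight
  by omega(alpha_i) chi(lambda + nu, alpha_i), which gives the denominator. Raising nu by alpha_i
  must absorb chi(alpha_i, alpha_i - beta); the denominator accounts for the part with beta, and
  what is left is the normalization of \<open>rho_hat\<close>. The order y, Cartan, x in Z is
  adapted to moving E_i from left to right, so there is no mirrored computation for F_i. A negative
  degree instead of a positive one is what keeps the coefficients of the defect in U^- away from
  degree 0, where skew derivations detect nothing.\<close>

definition functional :: "('k::field \<Rightarrow> 'u::ab_group_add \<Rightarrow> 'u) \<Rightarrow> ('u \<Rightarrow> 'k) \<Rightarrow> bool" where
  "functional smul f \<longleftrightarrow> (\<forall>x y. f (x + y) = f x + f y) \<and> (\<forall>c x. f (smul c x) = c * f x)"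

lemma functionalI:
  assumes "\<And>x y. f (x + y) = f x + f y" "\<And>c x. f (smul c x) = c * f x"
  shows "functional smul f"
  using assms unfolding functional_def by blast

lemma functional_add: "functional smul f \<Longrightarrow> f (x + y) = f x + f y"
  and functional_scale: "functional smul f \<Longrightarrow> f (smul c x) = c * f x"
  unfolding functional_def by blast+

lemma functional_zero: "functional smul f \<Longrightarrow> f 0 = 0"
  using functional_add[of smul f 0 0] by (metis add.right_neutral add_cancel_right_right)

lemma functional_neg: "functional smul f \<Longrightarrow> f (- x) = - f x"
  using functional_add[of smul f x "- x"] functional_zero[of smul f]
  by (simp add: eq_neg_iff_add_eq_0 add.commute)

lemma functional_diff: "functional smul f \<Longrightarrow> f (x - y) = f x - f y"
  using functional_add[of smul f x "- y"] functional_neg[of smul f y] by simp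

lemma functional_sum: "functional smul f \<Longrightarrow> f (sum g A) = (\<Sum>i\<in>A. f (g i))"
  by (induction A rule: infinite_finite_induct)
     (simp_all add: functional_add[of smul f] functional_zero[of smul f])

context vector_space
begin

lemma linear_selfI:
  assumes "\<And>x y. f (x + y) = f x + f y" "\<And>c x. f (scale c x) = scale c (f x)"
  shows "Vector_Spaces.linear scale scale f"
  by unfold_locales (use assms in auto)

lemma linear_add: "Vector_Spaces.linear scale scale f \<Longrightarrow> f (x + y) = f x + f y"
  by (simp add: Vector_Spaces.linear_def module_hom_def module_hom_axioms_def)

lemma linear_scale: "Vector_Spaces.linear scale scale f \<Longrightarrow> f (scale c x) = scale c (f x)"
  by (simp add: Vector_Spaces.linear_def module_hom_def module_hom_axioms_def)

lemma linear_zero: "Vector_Spaces.linear scale scale f \<Longrightarrow> f 0 = 0"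
  using linear_add[of f 0 0] by simp

lemma linear_diff: "Vector_Spaces.linear scale scale f \<Longrightarrow> f (x - y) = f x - f y"
  using linear_add[of f "x - y" y] by (simp add: algebra_simps)

lemma linear_sum: "Vector_Spaces.linear scale scale f \<Longrightarrow> f (sum g A) = (\<Sum>i\<in>A. f (g i))"
  by (induction A rule: infinite_finite_induct)
     (simp_all add: linear_add[of f] linear_zero[of f])

lemma linear_subspace_vimage:
  assumes "Vector_Spaces.linear scale scale f" "subspace W"
  shows "subspace {x. f x \<in> W}"
  using assms(2) by (intro subspaceI)
    (simp_all add: linear_add[OF assms(1)] linear_scale[OF assms(1)] linear_zero[OF assms(1)]
      subspace_0 subspace_add subspace_scale)

lemma linear_span_mem:
  assumes "Vector_Spaces.linear scale scale f" "subspace W" "\<And>x. x \<in> S \<Longrightarrow> f x \<in> W" "x \<in> span S"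
  shows "f x \<in> W"
  using span_minimal[of S "{x. f x \<in> W}"] linear_subspace_vimage[OF assms(1,2)] assms(3,4) by blast

lemma functional_extend:
  assumes "independent B"
  obtains f where "functional scale f" "\<And>b. b \<in> B \<Longrightarrow> f b = h b"
proof -
  interpret k: vector_space "(*) :: 'a \<Rightarrow> 'a \<Rightarrow> 'a"
    by unfold_locales (simp_all add: algebra_simps)
  interpret vp: vector_space_pair scale "(*) :: 'a \<Rightarrow> 'a \<Rightarrow> 'a" ..
  obtain f where f: "Vector_Spaces.linear scale (*) f" "\<forall>x\<in>B. f x = h x"
    using vp.linear_independent_extend[OF assms] by blast
  have "functional scale f"
    using f(1) by (simp add: functional_def Vector_Spaces.linear_def module_hom_def module_hom_axioms_def)
  then show ?thesis using that f(2) by blast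
qed

text \<open>A biorthogonal system of maximal length is a pair of dual bases. Its x part is
  independent, so the finite set T bounds the length; the expansion on B then follows from that on A
  and nondegeneracy.\<close>

lemma dual_bases_exist:
  fixes p :: "'b \<Rightarrow> 'b \<Rightarrow> 'a"
  assumes A: "subspace A" and B: "subspace B"
    and fin: "finite T" "A \<subseteq> span T"
    and p1: "\<And>y. functional scale (\<lambda>x. p x y)" and p2: "\<And>x. functional scale (p x)"
    and nd1: "\<And>a. a \<in> A \<Longrightarrow> (\<And>b. b \<in> B \<Longrightarrow> p a b = 0) \<Longrightarrow> a = 0"
    and nd2: "\<And>b. b \<in> B \<Longrightarrow> (\<And>a. a \<in> A \<Longrightarrow> p a b = 0) \<Longrightarrow> b = 0"
  obtains n :: nat and x y where "\<And>s. s < n \<Longrightarrow> x s \<in> A" "\<And>s. s < n \<Longrightarrow> y s \<in> B"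
    "\<And>a. a \<in> A \<Longrightarrow> a = (\<Sum>s<n. scale (p a (y s)) (x s))"
    "\<And>b. b \<in> B \<Longrightarrow> b = (\<Sum>s<n. scale (p (x s) b) (y s))"
proof -
  define D where "D n x y \<longleftrightarrow> (\<forall>s<n. x s \<in> A \<and> y s \<in> B) \<and>
      (\<forall>s<n. \<forall>t<n. p (x s) (y t) = (if s = t then 1 else 0))" for n :: nat and x y
  have bound: "n \<le> card T" if d: "D n x y" for n x y
  proof -
    have inj: "inj_on x {..<n}"
      using d unfolding D_def inj_on_def by (metis lessThan_iff zero_neq_one)
    have "independent (x ` {..<n})"
      unfolding dependent_finite[OF finite_imageI[OF finite_lessThan]]
    proof clarsimp
      fix u s assume u: "(\<Sum>v\<in>x ` {..<n}. scale (u v) v) = 0" and s: "s < n" and ne: "u (x s) \<noteq> 0"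
      have "(\<Sum>r<n. scale (u (x r)) (x r)) = 0"
        using u by (simp add: sum.reindex[OF inj])
      then have "0 = p (\<Sum>r<n. scale (u (x r)) (x r)) (y s)"
        using functional_zero[OF p1[of "y s"]] by simp
      also have "\<dots> = (\<Sum>r<n. u (x r) * p (x r) (y s))"
        by (simp add: functional_sum[OF p1[of "y s"]] functional_scale[OF p1[of "y s"]])
      also have "\<dots> = (\<Sum>r<n. if r = s then u (x s) else 0)"
        by (rule sum.cong) (use d s in \<open>auto simp: D_def\<close>)
      finally show False using s ne by simp
    qed
    moreover have "x ` {..<n} \<subseteq> span T" using d fin(2) by (auto simp: D_def)
    ultimately have "card (x ` {..<n}) \<le> card T"
      using independent_span_bound[OF fin(1)] by blast
    then show ?thesis by (simp add: card_image[OF inj])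
  qed
  define n where "n = (GREATEST n. \<exists>x y. D n x y)"
  have "D 0 undefined undefined" by (simp add: D_def)
  then have "\<exists>x y. D n x y" unfolding n_def
    using GreatestI_ex_nat[of "\<lambda>n. \<exists>x y. D n x y" "card T"] bound by metis
  then obtain x y where d: "D n x y" by blast
  have mx: "\<not> D (Suc n) x' y'" for x' y'
    using Greatest_le_nat[of "\<lambda>n. \<exists>x y. D n x y" "Suc n" "card T"] bound n_def
    by (metis Suc_n_not_le_n)
  have dx: "x s \<in> A" "y s \<in> B" if "s < n" for s using d that by (auto simp: D_def)
  have dp: "p (x s) (y t) = (if s = t then 1 else 0)" if "s < n" "t < n" for s t
    using d that by (auto simp: D_def)
  have expA: "a = (\<Sum>s<n. scale (p a (y s)) (x s))" if a: "a \<in> A" for a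
  proof (rule ccontr)
    assume ne: "a \<noteq> (\<Sum>s<n. scale (p a (y s)) (x s))"
    define a' where "a' = a - (\<Sum>s<n. scale (p a (y s)) (x s))"
    have a'A: "a' \<in> A" unfolding a'_def
      by (intro subspace_diff[OF A] a subspace_sum[OF A] subspace_scale[OF A] dx) simp
    have a'y: "p a' (y t) = 0" if t: "t < n" for t
    proof -
      have "p a' (y t) = p a (y t) - (\<Sum>s<n. p a (y s) * p (x s) (y t))"
        unfolding a'_def by (simp add: functional_sum[OF p1[of "y t"]] functional_scale[OF p1[of "y t"]]
            functional_diff[OF p1[of "y t"]])
      also have "(\<Sum>s<n. p a (y s) * p (x s) (y t)) = (\<Sum>s<n. if s = t then p a (y t) else 0)"
        by (rule sum.cong) (use dp t in auto)
      finally show ?thesis using t by simp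
    qed
    have "a' \<noteq> 0" using ne by (simp add: a'_def)
    then obtain b where b: "b \<in> B" "p a' b \<noteq> 0" using nd1[OF a'A] by blast
    \<comment> \<open>Subtracting the expansion makes b' orthogonal to every x s, and its pairing
      with a' is unchanged because a' is orthogonal to every y s. After rescaling, a' and b' would
      extend the system.\<close>
    define b' where "b' = b - (\<Sum>s<n. scale (p (x s) b) (y s))"
    have b'B: "b' \<in> B" unfolding b'_def
      by (intro subspace_diff[OF B] b subspace_sum[OF B] subspace_scale[OF B] dx) simp
    have pb': "p z b' = p z b - (\<Sum>s<n. p (x s) b * p z (y s))" for z
      unfolding b'_def by (simp add: functional_sum[OF p2[of z]] functional_scale[OF p2[of z]]
            functional_diff[OF p2[of z]])
    have xb': "p (x t) b' = 0" if t: "t < n" for t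
    proof -
      have "(\<Sum>s<n. p (x s) b * p (x t) (y s)) = (\<Sum>s<n. if s = t then p (x t) b else 0)"
        by (rule sum.cong) (use dp t in auto)
      then show ?thesis using t by (simp add: pb')
    qed
    have ab': "p a' b' = p a' b" by (simp add: pb' a'y)
    have "D (Suc n) (x(n := a')) (y(n := scale (inverse (p a' b)) b'))"
      unfolding D_def
      using dx a'A subspace_scale[OF B b'B] dp xb' a'y b(2) ab'
      by (auto simp: less_Suc_eq functional_scale[OF p2] functional_zero[OF p2])
    then show False using mx by blast
  qed
  have expB: "b = (\<Sum>s<n. scale (p (x s) b) (y s))" if b: "b \<in> B" for b
  proof -
    define b' where "b' = b - (\<Sum>s<n. scale (p (x s) b) (y s))"
    have b'B: "b' \<in> B" unfolding b'_def
      by (intro subspace_diff[OF B] b subspace_sum[OF B] subspace_scale[OF B] dx) simp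
    have pb': "p z b' = p z b - (\<Sum>s<n. p (x s) b * p z (y s))" for z
      unfolding b'_def by (simp add: functional_sum[OF p2[of z]] functional_scale[OF p2[of z]]
            functional_diff[OF p2[of z]])
    have xb': "p (x t) b' = 0" if t: "t < n" for t
    proof -
      have "(\<Sum>s<n. p (x s) b * p (x t) (y s)) = (\<Sum>s<n. if s = t then p (x t) b else 0)"
        by (rule sum.cong) (use dp t in auto)
      then show ?thesis using t by (simp add: pb')
    qed
    have "p a b' = 0" if "a \<in> A" for a
    proof -
      have "p a b' = p (\<Sum>s<n. scale (p a (y s)) (x s)) b'" using expA[OF that] by simp
      also have "\<dots> = 0" by (simp add: functional_sum[OF p1] functional_scale[OF p1] xb')
      finally show ?thesis .
    qed
    then have "b' = 0" using nd2[OF b'B] by blast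
    then show ?thesis by (simp add: b'_def)
  qed
  show ?thesis by (rule that[of n x y]) (fact dx expA expB)+
qed

end

section \<open>Homogeneous components of a direct sum\<close>

locale graded_space = vector_space smul
  for smul :: "'k::field \<Rightarrow> 'u::ab_group_add \<Rightarrow> 'u"
    and J :: "'j set" and W :: "'j \<Rightarrow> 'u set" +
  assumes direct_sum: "internal_direct_sum smul J W"
begin

definition comps :: "'u \<Rightarrow> 'j \<Rightarrow> 'u" where
  "comps x = (THE c. finite {j. c j \<noteq> 0} \<and> (\<forall>j\<in>J. c j \<in> W j) \<and> (\<forall>j. j \<notin> J \<longrightarrow> c j = 0) \<and>
               x = (\<Sum>j | c j \<noteq> 0. c j))"

lemma grade_subspace: "j \<in> J \<Longrightarrow> subspace (W j)"
  using direct_sum unfolding internal_direct_sum_def by blast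

lemma comps_ex1: "\<exists>!c. finite {j. c j \<noteq> 0} \<and> (\<forall>j\<in>J. c j \<in> W j) \<and> (\<forall>j. j \<notin> J \<longrightarrow> c j = 0) \<and>
               x = (\<Sum>j | c j \<noteq> 0. c j)"
  using direct_sum unfolding internal_direct_sum_def by blast

lemma comps_finite: "finite {j. comps x j \<noteq> 0}"
  and comps_mem: "j \<in> J \<Longrightarrow> comps x j \<in> W j"
  and comps_outside: "j \<notin> J \<Longrightarrow> comps x j = 0"
  and comps_sum: "(\<Sum>j | comps x j \<noteq> 0. comps x j) = x"
  using theI'[OF comps_ex1[of x]] unfolding comps_def[symmetric] by auto

lemma comps_sum_superset:
  assumes "finite A" "\<And>j. comps x j \<noteq> 0 \<Longrightarrow> j \<in> A"
  shows "(\<Sum>j\<in>A. comps x j) = x"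
proof -
  have "(\<Sum>j\<in>A. comps x j) = (\<Sum>j | comps x j \<noteq> 0. comps x j)"
    by (rule sum.mono_neutral_right) (use assms in auto)
  then show ?thesis by (simp only: comps_sum)
qed

lemma comps_unique:
  assumes "finite A" "\<And>j. j \<in> J \<Longrightarrow> c j \<in> W j" "\<And>j. j \<notin> J \<Longrightarrow> c j = 0"
    "\<And>j. c j \<noteq> 0 \<Longrightarrow> j \<in> A" "x = (\<Sum>j\<in>A. c j)"
  shows "comps x = c"
proof -
  have f: "finite {j. c j \<noteq> 0}" by (rule finite_subset[OF _ assms(1)]) (use assms(4) in auto)
  have "(\<Sum>j\<in>A. c j) = (\<Sum>j | c j \<noteq> 0. c j)"
    by (rule sum.mono_neutral_right) (use assms in auto)
  then show ?thesis unfolding comps_def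
    using f assms by (intro the1_equality[OF comps_ex1]) simp
qed

lemma comps_homogeneous:
  assumes "i \<in> J" "x \<in> W i" shows "comps x j = (if j = i then x else 0)"
proof -
  have "comps x = (\<lambda>j. if j = i then x else 0)"
    by (rule comps_unique[of "{i}"])
       (use assms grade_subspace in \<open>auto simp: subspace_0 split: if_splits\<close>)
  then show ?thesis by simp
qed

lemma comps_add: "comps (x + y) j = comps x j + comps y j"
proof -
  let ?A = "{j. comps x j \<noteq> 0} \<union> {j. comps y j \<noteq> 0}"
  have "comps (x + y) = (\<lambda>j. comps x j + comps y j)"
  proof (rule comps_unique[of ?A])
    show "x + y = (\<Sum>j\<in>?A. comps x j + comps y j)"
      by (simp add: sum.distrib comps_sum_superset comps_finite)
  qed (use comps_finite comps_mem comps_outside grade_subspace in \<open>auto simp: subspace_add\<close>)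
  then show ?thesis by simp
qed

lemma comps_scale: "comps (smul c x) j = smul c (comps x j)"
proof -
  let ?A = "{j. comps x j \<noteq> 0}"
  have "comps (smul c x) = (\<lambda>j. smul c (comps x j))"
  proof (rule comps_unique[of ?A])
    show "smul c x = (\<Sum>j\<in>?A. smul c (comps x j))"
      by (simp add: scale_sum_right[symmetric] comps_sum)
  qed (use comps_finite comps_mem comps_outside grade_subspace in \<open>auto simp: subspace_scale\<close>)
  then show ?thesis by simp
qed

lemma comps_linear: "Vector_Spaces.linear smul smul (\<lambda>x. comps x j)"
  by (rule linear_selfI) (simp_all add: comps_add comps_scale)

end

text \<open>Taking the component in degree j sends each generator to itself or to 0. Applied to the
  halves and to all of U, this replaces the abstract grading by spanning words and
  monomials.\<close>

lemma (in graded_space) span_homogeneous_inter: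
  assumes "\<And>w. d w \<in> J" "\<And>w. g w \<in> W (d w)" "j \<in> J"
  shows "span (range g) \<inter> W j = span {g w | w. d w = j}"
proof
  show "span (range g) \<inter> W j \<subseteq> span {g w | w. d w = j}"
  proof
    fix x assume x: "x \<in> span (range g) \<inter> W j"
    have "comps x j \<in> span {g w | w. d w = j}"
    proof (rule linear_span_mem[OF comps_linear subspace_span])
      fix s assume "s \<in> range g"
      then obtain w where "s = g w" by blast
      then show "comps s j \<in> span {g w | w. d w = j}"
        using comps_homogeneous[OF assms(1) assms(2)[of w], of j]
        by (auto intro: span_base span_zero)
    qed (use x in blast)
    then show "x \<in> span {g w | w. d w = j}" using comps_homogeneous[of j x j] x assms(3) by simp
  qed
  show "span {g w | w. d w = j} \<subseteq> span (range g) \<inter> W j"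
    using span_mono[of "{g w | w. d w = j}" "range g"]
      span_minimal[of "{g w | w. d w = j}" "W j"] grade_subspace[OF assms(3)] assms(2) by auto
qed

subsection \<open>Words and weights\<close>

definition weight :: "'i::finite list \<Rightarrow> int ^ 'i" where
  "weight w = sum_list (map simple_root w)"

definition height :: "int ^ 'i::finite \<Rightarrow> nat" where
  "height \<beta> = nat (\<Sum>i\<in>UNIV. \<beta> $ i)"

lemma weight_Nil [simp]: "weight [] = 0"
  and weight_Cons [simp]: "weight (i # w) = simple_root i + weight w"
  and weight_append [simp]: "weight (w @ w') = weight w + weight w'"
  by (simp_all add: weight_def)

lemma pos_lattice_0 [simp]: "0 \<in> pos_lattice"
  and pos_lattice_add: "x \<in> pos_lattice \<Longrightarrow> y \<in> pos_lattice \<Longrightarrow> x + y \<in> pos_lattice"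
  and simple_root_pos [simp]: "simple_root i \<in> pos_lattice"
  by (auto simp: pos_lattice_def simple_root_def axis_def)

lemma weight_pos [simp]: "weight w \<in> pos_lattice"
  by (induction w) (simp_all add: pos_lattice_add)

lemma sum_simple_root: "(\<Sum>j\<in>UNIV. simple_root i $ j) = 1"
  by (simp add: simple_root_def axis_def)

lemma height_add: "x \<in> pos_lattice \<Longrightarrow> y \<in> pos_lattice \<Longrightarrow> height (x + y) = height x + height y"
  by (simp add: height_def pos_lattice_def sum.distrib nat_add_distrib sum_nonneg)

lemma height_simple_root [simp]: "height (simple_root i) = 1"
  by (simp add: height_def sum_simple_root)

lemma height_weight [simp]: "height (weight w) = length w"
  by (induction w) (simp_all add: height_add, simp add: height_def)

lemma height_diff_simple_root:
  assumes "\<beta> - simple_root i \<in> pos_lattice"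
  shows "height (\<beta> - simple_root i) < height \<beta>"
  using height_add[OF assms simple_root_pos[of i]] by simp

lemma weight_eq_0_iff [simp]: "weight w = 0 \<longleftrightarrow> w = []"
  using height_weight[of w] by (auto simp del: height_weight simp: height_def)

text \<open>The weight determines the length of a word. Hence the graded pieces of both halves are
  finite dimensional.\<close>

lemma finite_weight_fibre: "finite {w :: 'i::finite list. weight w = \<beta>}"
proof -
  have "{w :: 'i list. weight w = \<beta>} \<subseteq> {w. set w \<subseteq> UNIV \<and> length w = height \<beta>}"
    using height_weight by auto
  then show ?thesis by (rule finite_subset) (rule finite_lists_length_eq, simp)
qed

lemma pos_lattice_antisym: "x \<in> pos_lattice \<Longrightarrow> - x \<in> pos_lattice \<Longrightarrow> x = 0"
  unfolding pos_lattice_def by (auto simp: vec_eq_iff intro: antisym)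

lemma simple_root_ne_0 [simp]: "simple_root i \<noteq> 0"
  using weight_eq_0_iff[of "[i]"] by simp

abbreviation word :: "('i \<Rightarrow> 'u::ring_1) \<Rightarrow> 'i list \<Rightarrow> 'u" where
  "word G w \<equiv> prod_list (map G w)"

subsection \<open>The triangular decomposition as a universal property\<close>

lemma lookup_free_scale: "Poly_Mapping.lookup (free_scale c p) t = c * Poly_Mapping.lookup p t"
  by (simp add: free_scale_def map.rep_eq when_def)

lemma vector_space_free_scale: "vector_space (free_scale :: 'k::field \<Rightarrow> ('b \<Rightarrow>\<^sub>0 'k) \<Rightarrow> _)"
proof
  show "free_scale a (x + y) = free_scale a x + free_scale a y"
    "free_scale (a + b) x = free_scale a x + free_scale b x"
    "free_scale a (free_scale b x) = free_scale (a * b) x" "free_scale 1 x = x"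
    for a b :: 'k and x y :: "'b \<Rightarrow>\<^sub>0 'k"
    by (simp_all add: poly_mapping_eq_iff fun_eq_iff lookup_free_scale lookup_add algebra_simps)
qed

interpretation free: vector_space "free_scale :: 'k::field \<Rightarrow> ('b \<Rightarrow>\<^sub>0 'k) \<Rightarrow> _"
  by (rule vector_space_free_scale)

context k_algebra
begin

definition free_extension :: "('b \<Rightarrow> 'u) \<Rightarrow> ('b \<Rightarrow>\<^sub>0 'k) \<Rightarrow> 'u" where
  "free_extension T p = (\<Sum>t\<in>Poly_Mapping.keys p. smul (Poly_Mapping.lookup p t) (T t))"

lemma free_extension_superset:
  assumes "finite A" "Poly_Mapping.keys p \<subseteq> A"
  shows "free_extension T p = (\<Sum>t\<in>A. smul (Poly_Mapping.lookup p t) (T t))"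
  unfolding free_extension_def
  by (rule sum.mono_neutral_left) (use assms in \<open>auto simp: in_keys_iff\<close>)

lemma free_extension_add: "free_extension T (p + q) = free_extension T p + free_extension T q"
proof -
  let ?A = "Poly_Mapping.keys p \<union> Poly_Mapping.keys q"
  show ?thesis
    using free_extension_superset[of ?A "p + q" T] free_extension_superset[of ?A p T]
      free_extension_superset[of ?A q T] keys_add[of p q]
    by (simp add: lookup_add scale_left_distrib sum.distrib)
qed

lemma free_extension_scale: "free_extension T (free_scale c p) = smul c (free_extension T p)"
proof -
  have "Poly_Mapping.keys (free_scale c p) \<subseteq> Poly_Mapping.keys p"
    by (auto simp: in_keys_iff lookup_free_scale)
  then show ?thesis
    using free_extension_superset[of "Poly_Mapping.keys p" "free_scale c p" T]
      free_extension_superset[of "Poly_Mapping.keys p" p T]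
    by (simp add: lookup_free_scale scale_sum_right)
qed

lemma free_extension_diff: "free_extension T (p - q) = free_extension T p - free_extension T q"
  using free_extension_add[of T "p - q" q] by (simp add: algebra_simps)

lemma free_extension_gen: "free_extension T (free_gen t) = T t"
  by (simp add: free_extension_def)

lemma free_mult_eq: "free_mult smul = free_extension (\<lambda>(y, z, x). y * z * x)"
  by (rule ext) (simp add: free_mult_def free_extension_def)

lemma free_extension_relations:
  assumes "\<And>y y' z x. T (y + y', z, x) = T (y, z, x) + T (y', z, x)"
    "\<And>y z z' x. T (y, z + z', x) = T (y, z, x) + T (y, z', x)"
    "\<And>y z x x'. T (y, z, x + x') = T (y, z, x) + T (y, z, x')"
    "\<And>c y z x. T (smul c y, z, x) = smul c (T (y, z, x))"
    "\<And>c y z x. T (y, smul c z, x) = smul c (T (y, z, x))"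
    "\<And>c y z x. T (y, z, smul c x) = smul c (T (y, z, x))"
    and "p \<in> tensor_relations smul A B C"
  shows "free_extension T p = 0"
  using assms(7) unfolding tensor_relations_def
proof (induction rule: free.span_induct)
  case base
  show ?case
    by (rule free.subspaceI)
      (simp_all add: free_extension_add free_extension_scale, simp add: free_extension_def)
next
  case (step p)
  then show ?case
    by (auto simp: free_extension_diff free_extension_scale free_extension_gen assms(1-6))
qed

lemma free_mult_relations: "p \<in> tensor_relations smul A B C \<Longrightarrow> free_mult smul p = 0"
  unfolding free_mult_eq
  by (rule free_extension_relations)
     (auto simp: distrib_left distrib_right smul_mult_left smul_mult_right)

lemma free_mult_cong: "p - q \<in> tensor_relations smul A B C \<Longrightarrow> free_mult smul p = free_mult smul q"
  using free_mult_relations[of "p - q" A B C] by (simp add: free_mult_eq free_extension_diff)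

definition tensor_class :: "'u set \<Rightarrow> 'u set \<Rightarrow> 'u set \<Rightarrow> ('u \<times> 'u \<times> 'u \<Rightarrow>\<^sub>0 'k) \<Rightarrow> ('u \<times> 'u \<times> 'u \<Rightarrow>\<^sub>0 'k) set"
  where "tensor_class A B C p = {q. p - q \<in> tensor_relations smul A B C}"

lemma tensor3_eq: "tensor3 smul A B C = tensor_class A B C ` {p. Poly_Mapping.keys p \<subseteq> A \<times> B \<times> C}"
  unfolding tensor3_def quotient_def tensor_class_def by (auto simp: Image_def)

lemma tensor_class_self: "p \<in> tensor_class A B C p"
  by (simp add: tensor_class_def tensor_relations_def free.span_zero)

lemma tensor_mult_class: "tensor_mult smul (tensor_class A B C p) = free_mult smul p"
proof -
  have "free_mult smul ` tensor_class A B C p = {free_mult smul p}"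
    using tensor_class_self[of p A B C] free_mult_cong[of p _ A B C] by (auto simp: tensor_class_def)
  then show ?thesis by (simp add: tensor_mult_def)
qed

lemma free_extension_mem_span:
  assumes "Poly_Mapping.keys p \<subseteq> S" shows "free_extension T p \<in> span (T ` S)"
  unfolding free_extension_def by (intro span_sum span_scale span_base) (use assms in auto)

lemma tensor_mult_surj:
  assumes "bij_betw (tensor_mult smul) (tensor3 smul A B C) UNIV"
  obtains p where "Poly_Mapping.keys p \<subseteq> A \<times> B \<times> C" "free_mult smul p = u"
proof -
  have "u \<in> tensor_mult smul ` tensor3 smul A B C" using assms by (simp add: bij_betw_def)
  then show ?thesis using that unfolding tensor3_eq by (auto simp: tensor_mult_class)
qed

lemma triangular_span:
  assumes "bij_betw (tensor_mult smul) (tensor3 smul A B C) UNIV"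
  shows "u \<in> span {y * z * x | y z x. y \<in> A \<and> z \<in> B \<and> x \<in> C}"
proof -
  obtain p where p: "Poly_Mapping.keys p \<subseteq> A \<times> B \<times> C" "free_mult smul p = u"
    using tensor_mult_surj[OF assms] by blast
  have "(\<lambda>(y, z, x). y * z * x) ` (A \<times> B \<times> C) = {y * z * x | y z x. y \<in> A \<and> z \<in> B \<and> x \<in> C}"
    by force
  then show ?thesis
    using free_extension_mem_span[OF p(1), of "\<lambda>(y, z, x). y * z * x"] p(2) by (simp add: free_mult_eq)
qed

text \<open>(U5) asserts bijectivity of a map on cosets; this extracts the linear universal property
  from it. T is trilinear on the whole algebra because the functionals plugged in later are defined
  on all of U.\<close>

lemma tensor_lift:
  assumes bij: "bij_betw (tensor_mult smul) (tensor3 smul A B C) UNIV"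
    and "\<And>y y' z x. T (y + y') z x = T y z x + T y' z x"
    "\<And>y z z' x. T y (z + z') x = T y z x + T y z' x"
    "\<And>y z x x'. T y z (x + x') = T y z x + T y z x'"
    "\<And>c y z x. T (smul c y) z x = smul c (T y z x)"
    "\<And>c y z x. T y (smul c z) x = smul c (T y z x)"
    "\<And>c y z x. T y z (smul c x) = smul c (T y z x)"
  obtains f where "Vector_Spaces.linear smul smul f"
    "\<And>y z x. y \<in> A \<Longrightarrow> z \<in> B \<Longrightarrow> x \<in> C \<Longrightarrow> f (y * z * x) = T y z x"
proof -
  let ?T = "\<lambda>(y, z, x). T y z x"
  let ?D = "{p :: ('u \<times> 'u \<times> 'u \<Rightarrow>\<^sub>0 'k). Poly_Mapping.keys p \<subseteq> A \<times> B \<times> C}"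
  \<comment> \<open>By injectivity on cosets, combinations with equal products differ by tensor
    relations, and a trilinear T vanishes on these.\<close>
  have welldef: "free_extension ?T p = free_extension ?T q"
    if "p \<in> ?D" "q \<in> ?D" "free_mult smul p = free_mult smul q" for p q
  proof -
    have eq: "tensor_class A B C p = tensor_class A B C q"
    proof (rule inj_onD[OF bij_betw_imp_inj_on[OF bij]])
      show "tensor_class A B C p \<in> tensor3 smul A B C" "tensor_class A B C q \<in> tensor3 smul A B C"
        using that unfolding tensor3_eq by blast+
    qed (simp add: tensor_mult_class that(3))
    have "q \<in> tensor_class A B C p" unfolding eq by (rule tensor_class_self)
    then have "p - q \<in> tensor_relations smul A B C" by (simp add: tensor_class_def)
    then have "free_extension ?T (p - q) = 0"
      by (rule free_extension_relations[rotated -1]) (simp_all add: assms)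
    then show ?thesis by (simp add: free_extension_diff)
  qed
  \<comment> \<open>A representative is chosen for each u. By \<open>welldef\<close> the choice does
    not influence f, so linearity may be checked on sums and multiples of representatives.\<close>
  define r where "r u = (SOME p. p \<in> ?D \<and> free_mult smul p = u)" for u
  have r: "r u \<in> ?D" "free_mult smul (r u) = u" for u
  proof -
    have "\<exists>p. p \<in> ?D \<and> free_mult smul p = u" using tensor_mult_surj[OF bij] by blast
    then have "r u \<in> ?D \<and> free_mult smul (r u) = u" unfolding r_def by (rule someI_ex)
    then show "r u \<in> ?D" "free_mult smul (r u) = u" by blast+
  qed
  define f where "f u = free_extension ?T (r u)" for u
  have f: "f (free_mult smul p) = free_extension ?T p" if "p \<in> ?D" for p
    unfolding f_def by (rule welldef) (use r that in auto)
  show ?thesis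
  proof (rule that)
    show "Vector_Spaces.linear smul smul f"
    proof (rule linear_selfI)
      fix x y
      have D: "r x + r y \<in> ?D" using r(1)[of x] r(1)[of y] keys_add[of "r x" "r y"] by blast
      have "free_mult smul (r x + r y) = x + y"
        unfolding free_mult_eq free_extension_add by (simp add: r(2) flip: free_mult_eq)
      then show "f (x + y) = f x + f y"
        using f[OF D] by (simp add: free_extension_add f_def)
    next
      fix c x
      have "Poly_Mapping.keys (free_scale c (r x)) \<subseteq> Poly_Mapping.keys (r x)"
        by (auto simp: in_keys_iff lookup_free_scale)
      then have D: "free_scale c (r x) \<in> ?D" using r(1)[of x] by blast
      have "free_mult smul (free_scale c (r x)) = smul c x"
        unfolding free_mult_eq free_extension_scale by (simp add: r(2) flip: free_mult_eq)
      then show "f (smul c x) = smul c (f x)"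
        using f[OF D] by (simp add: free_extension_scale f_def)
    qed
    fix y z x assume "y \<in> A" "z \<in> B" "x \<in> C"
    then have "free_gen (y, z, x) \<in> ?D" by simp
    from f[OF this] show "f (y * z * x) = T y z x"
      by (simp add: free_mult_eq free_extension_gen)
  qed
qed

lemma subalgebra_span_words: "subalgebra smul (span (range (word G)))"
  unfolding subalgebra_def
proof (intro conjI ballI)
  show "1 \<in> span (range (word G))" by (rule span_base) (rule range_eqI[of _ _ "[]"], simp)
  fix x y assume x: "x \<in> span (range (word G))" and y: "y \<in> span (range (word G))"
  have 1: "word G w * y \<in> span (range (word G))" for w
  proof (rule linear_span_mem[OF _ subspace_span _ y])
    show "Vector_Spaces.linear smul smul ((*) (word G w))"
      by (rule linear_selfI) (simp_all add: distrib_left smul_mult_right)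
    fix s assume "s \<in> range (word G)"
    then obtain w' where "s = word G w'" by blast
    then show "word G w * s \<in> span (range (word G))"
      by (intro span_base range_eqI[of _ _ "w @ w'"]) simp
  qed
  show "x * y \<in> span (range (word G))"
  proof (rule linear_span_mem[OF _ subspace_span _ x, of "\<lambda>x. x * y"])
    show "Vector_Spaces.linear smul smul (\<lambda>x. x * y)"
      by (rule linear_selfI) (simp_all add: distrib_right smul_mult_left)
  qed (use 1 in auto)
qed simp

lemma subalgebra_half_part: "subalgebra smul (half_part smul G)"
  unfolding half_part_def subalgebra_gen_def
  by (rule hull_in) (auto simp: subalgebra_def intro: subspace_Inter)

lemma half_part_gen: "G i \<in> half_part smul G"
  unfolding half_part_def subalgebra_gen_def using hull_subset[of "range G" "subalgebra smul"] by blast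

lemma half_part_subspace: "subspace (half_part smul G)"
  and half_part_one: "1 \<in> half_part smul G"
  and half_part_mult: "x \<in> half_part smul G \<Longrightarrow> y \<in> half_part smul G \<Longrightarrow> x * y \<in> half_part smul G"
  using subalgebra_half_part[of G] unfolding subalgebra_def by blast+

lemma half_part_word: "word G w \<in> half_part smul G"
  by (induction w) (simp_all add: half_part_one half_part_mult half_part_gen)

text \<open>Words span a subalgebra containing the generators, so the hull is no larger. Linear
  statements about U^+ or U^- can then be checked on words.\<close>

lemma half_part_eq_span: "half_part smul G = span (range (word G))"
proof
  show "half_part smul G \<subseteq> span (range (word G))"
    unfolding half_part_def subalgebra_gen_def
  proof (rule hull_minimal)
    show "range G \<subseteq> span (range (word G))"
    proof clarify
      fix i show "G i \<in> span (range (word G))"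
        by (rule span_base) (rule range_eqI[of _ _ "[i]"], simp)
    qed
  qed (rule subalgebra_span_words)
  show "span (range (word G)) \<subseteq> half_part smul G"
    by (rule span_minimal[OF _ half_part_subspace]) (auto simp: half_part_word)
qed

end

subsection \<open>Skew derivations\<close>

lemma
  assumes "bicharacter chi"
  shows bichar_nonzero: "chi x y \<noteq> 0"
    and bichar_add_left: "chi (x + y) z = chi x z * chi y z"
    and bichar_add_right: "chi x (y + z) = chi x y * chi x z"
  using assms unfolding bicharacter_def by blast+

lemma bichar_zero_left: "bicharacter chi \<Longrightarrow> chi 0 y = 1"
  using bichar_add_left[of chi 0 0 y] bichar_nonzero[of chi 0 y] by simp

lemma bichar_zero_right: "bicharacter chi \<Longrightarrow> chi y 0 = 1"
  using bichar_add_right[of chi y 0 0] bichar_nonzero[of chi y 0] by simp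

lemma bichar_minus_left: "bicharacter chi \<Longrightarrow> chi (- x) y = inverse (chi x y)"
  using bichar_add_left[of chi x "- x" y] bichar_zero_left[of chi y]
  by (metis add.right_inverse inverse_unique)

lemma bichar_minus_right: "bicharacter chi \<Longrightarrow> chi y (- x) = inverse (chi y x)"
  using bichar_add_right[of chi y x "- x"] bichar_zero_right[of chi y]
  by (metis add.right_inverse inverse_unique)

lemma bichar_diff_left: "bicharacter chi \<Longrightarrow> chi (x - y) z = chi x z * inverse (chi y z)"
  using bichar_add_left[of chi x "- y" z] bichar_minus_left[of chi y z] by simp

lemma bichar_diff_right: "bicharacter chi \<Longrightarrow> chi z (x - y) = chi z x * inverse (chi z y)"
  using bichar_add_right[of chi z x "- y"] bichar_minus_right[of chi z y] by simp

lemmas bichar_simps = bichar_nonzero bichar_add_left bichar_add_right bichar_zero_left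
  bichar_zero_right bichar_minus_left bichar_minus_right bichar_diff_left bichar_diff_right

text \<open>Half of a generalized quantum group, with only what survives exchanging \<open>E\<close> with \<open>F\<close>,
  \<open>K\<close> with \<open>L\<close>, transposing \<open>chi\<close> and reversing the grading, so that everything proved here
  applies to both \<open>U\<^sup>-\<close> and \<open>U\<^sup>+\<close>.\<close>

locale borel_half = k_algebra smul + graded_space smul UNIV Ugr
  for smul :: "'k::field \<Rightarrow> 'u::ring_1 \<Rightarrow> 'u"
    and Ugr :: "int ^ 'i::finite \<Rightarrow> 'u set"
    and chi :: "int ^ 'i \<Rightarrow> int ^ 'i \<Rightarrow> 'k"
    and K L :: "int ^ 'i \<Rightarrow> 'u"
    and E F :: "'i \<Rightarrow> 'u" +
  assumes bichar: "bicharacter chi"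
    and grade_one: "1 \<in> Ugr 0"
    and grade_mult: "x \<in> Ugr lam \<Longrightarrow> y \<in> Ugr mu \<Longrightarrow> x * y \<in> Ugr (lam + mu)"
    and grade_F: "F i \<in> Ugr (- simple_root i)"
    and KF: "K lam * F i = smul (chi lam (- simple_root i)) (F i * K lam)"
    and LF: "L lam * F i = smul (chi (simple_root i) lam) (F i * L lam)"
    and EF: "E i * F j - F j * E i = (if i = j then - K (simple_root i) + L (simple_root i) else 0)"
    and KL_independent: "A \<in> half_part smul F \<Longrightarrow> B \<in> half_part smul F \<Longrightarrow>
      K (simple_root i) * A = B * L (simple_root i) \<Longrightarrow> A = 0 \<and> B = 0"
    and centralizer_trivial: "\<beta> \<in> pos_lattice - {0} \<Longrightarrow> Y \<in> half_part smul F \<Longrightarrow> Y \<in> Ugr (- \<beta>) \<Longrightarrow>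
      (\<And>i. E i * Y = Y * E i) \<Longrightarrow> Y = 0"
begin

lemmas chi_simps = bichar_simps[OF bichar]

abbreviation half :: "'u set" where "half \<equiv> half_part smul F"

definition part :: "int ^ 'i \<Rightarrow> 'u set" where
  "part \<beta> = half \<inter> Ugr (- \<beta>)"

lemma grade_word: "word F w \<in> Ugr (- weight w)"
proof (induction w)
  case Nil
  then show ?case using grade_one by simp
next
  case (Cons i w)
  then show ?case using grade_mult[OF grade_F[of i] Cons] by simp
qed

lemma part_eq_span: "part \<beta> = span {word F w | w. weight w = \<beta>}"
proof -
  have "part \<beta> = span {word F w | w. - weight w = - \<beta>}"
    unfolding part_def half_part_eq_span
    by (rule span_homogeneous_inter) (simp_all add: grade_word)
  then show ?thesis by simp
qed

lemma part_subspace: "subspace (part \<beta>)"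
  unfolding part_eq_span by simp

lemma part_half: "Y \<in> part \<beta> \<Longrightarrow> Y \<in> half"
  and part_grade: "Y \<in> part \<beta> \<Longrightarrow> Y \<in> Ugr (- \<beta>)"
  by (simp_all add: part_def)

lemma part_word: "word F w \<in> part (weight w)"
  by (simp add: part_def grade_word half_part_word)

lemma part_induct [consumes 1, case_names subspace word]:
  assumes "Y \<in> part \<beta>" "subspace {y. P y}" "\<And>w. weight w = \<beta> \<Longrightarrow> P (word F w)"
  shows "P Y"
  using assms span_minimal[of "{word F w | w. weight w = \<beta>}" "{y. P y}"] unfolding part_eq_span by blast

lemma half_induct [consumes 1, case_names subspace word]:
  assumes "Y \<in> half" "subspace {y. P y}" "\<And>w. P (word F w)"
  shows "P Y"
  using assms span_minimal[of "range (word F)" "{y. P y}"] unfolding half_part_eq_span by blast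

lemma part_eq_0: "\<beta> \<notin> pos_lattice \<Longrightarrow> Y \<in> part \<beta> \<Longrightarrow> Y = 0"
proof -
  assume "\<beta> \<notin> pos_lattice" "Y \<in> part \<beta>"
  moreover have "{word F w | w. weight w = \<beta>} = {}" using \<open>\<beta> \<notin> pos_lattice\<close> by auto
  ultimately show ?thesis unfolding part_eq_span by simp
qed

lemma part_0: "Y \<in> part 0 \<Longrightarrow> \<exists>c. Y = smul c 1"
proof -
  assume "Y \<in> part 0"
  moreover have "{word F w | w. weight w = 0} = {1}" by auto
  ultimately show ?thesis unfolding part_eq_span by (simp add: span_singleton) blast
qed

lemma part_finite_span: "\<exists>T. finite T \<and> part \<beta> = span T"
proof (intro exI conjI)
  have "{word F w | w. weight w = \<beta>} = word F ` {w. weight w = \<beta>}" by blast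
  then show "finite {word F w | w. weight w = \<beta>}" by (simp add: finite_weight_fibre)
qed (rule part_eq_span)

lemma part_mult: "x \<in> part \<beta> \<Longrightarrow> y \<in> part \<gamma> \<Longrightarrow> x * y \<in> part (\<beta> + \<gamma>)"
  using grade_mult[of x "- \<beta>" y "- \<gamma>"] by (simp add: part_def half_part_mult add.commute)

lemma part_F: "F i \<in> part (simple_root i)"
  using part_word[of "[i]"] by simp

lemma K_part: "Y \<in> part \<beta> \<Longrightarrow> K lam * Y = smul (chi lam (- \<beta>)) (Y * K lam)"
proof (induction rule: part_induct)
  case subspace
  show ?case by (rule subspaceI)
    (simp_all add: distrib_left distrib_right scale_right_distrib smul_mult_left smul_mult_right scale_left_commute)
next
  case (word w)
  have "K lam * word F w = smul (chi lam (- weight w)) (word F w * K lam)" for w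
  proof (induction w)
    case Nil
    then show ?case by (simp add: chi_simps)
  next
    case (Cons i w)
    have "K lam * word F (i # w) = smul (chi lam (- simple_root i)) (F i * (K lam * word F w))"
      by (simp add: KF smul_mult_left flip: mult.assoc)
    also have "\<dots> = smul (chi lam (- weight (i # w))) (word F (i # w) * K lam)"
      by (simp add: Cons smul_mult_right chi_simps mult.assoc)
    finally show ?case .
  qed
  with word show ?case by blast
qed

lemma L_part: "Y \<in> part \<beta> \<Longrightarrow> L lam * Y = smul (chi \<beta> lam) (Y * L lam)"
proof (induction rule: part_induct)
  case subspace
  show ?case by (rule subspaceI)
    (simp_all add: distrib_left distrib_right scale_right_distrib smul_mult_left smul_mult_right scale_left_commute)
next
  case (word w)
  have "L lam * word F w = smul (chi (weight w) lam) (word F w * L lam)" for w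
  proof (induction w)
    case Nil
    then show ?case by (simp add: chi_simps)
  next
    case (Cons i w)
    have "L lam * word F (i # w) = smul (chi (simple_root i) lam) (F i * (L lam * word F w))"
      by (simp add: LF smul_mult_left flip: mult.assoc)
    also have "\<dots> = smul (chi (weight (i # w)) lam) (word F (i # w) * L lam)"
      by (simp add: Cons smul_mult_right chi_simps mult.assoc)
    finally show ?case .
  qed
  with word show ?case by blast
qed

lemma part_K: "Y \<in> part \<beta> \<Longrightarrow> Y * K lam = smul (chi lam \<beta>) (K lam * Y)"
  by (simp add: K_part chi_simps)

text \<open>A and B are skew derivatives of Y in the style of Kashiwara and Lusztig. On a word, A
  deletes one F_i at a time with coefficient chi(alpha_i, weight of the letters to its left), and B
  with chi(weight of the letters to its right, alpha_i). Placing K on the left and L on the right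
  gives coefficient 1 at the left, respectively right, end of the word.\<close>

definition derives :: "'i \<Rightarrow> 'u \<Rightarrow> 'u \<Rightarrow> 'u \<Rightarrow> bool" where
  "derives i Y A B \<longleftrightarrow> E i * Y - Y * E i = B * L (simple_root i) - K (simple_root i) * A"

lemma derives_add: "derives i Y A B \<Longrightarrow> derives i Y' A' B' \<Longrightarrow> derives i (Y + Y') (A + A') (B + B')"
  unfolding derives_def by (simp add: algebra_simps)

lemma derives_scale: "derives i Y A B \<Longrightarrow> derives i (smul c Y) (smul c A) (smul c B)"
  unfolding derives_def by (simp add: smul_mult_left smul_mult_right flip: scale_right_diff_distrib)

lemma derives_zero: "derives i 0 0 0" and derives_one: "derives i 1 0 0"
  unfolding derives_def by simp_all

text \<open>The Leibniz rule for the commutator. The scalars arise from moving L to the right past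
  F_j and K to the left past Y.\<close>

lemma derives_mult_F:
  assumes Y: "Y \<in> part \<beta>" and d: "derives i Y A B"
  shows "derives i (Y * F j)
    (A * F j + (if i = j then smul (chi (simple_root i) \<beta>) Y else 0))
    (smul (chi (simple_root j) (simple_root i)) (B * F j) + (if i = j then Y else 0))"
proof -
  have "E i * (Y * F j) - Y * F j * E i = (E i * Y - Y * E i) * F j + Y * (E i * F j - F j * E i)"
    by (simp add: algebra_simps)
  also have "\<dots> = B * (L (simple_root i) * F j) - K (simple_root i) * (A * F j)
      + (if i = j then Y * L (simple_root i) - Y * K (simple_root i) else 0)"
    unfolding d[unfolded derives_def] EF by (simp add: algebra_simps)
  finally show ?thesis
    unfolding derives_def
    by (cases "i = j") (simp_all add: LF part_K[OF Y] smul_mult_left smul_mult_right algebra_simps)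
qed

lemma derives_word: "\<exists>A B. A \<in> part (weight w - simple_root i) \<and> B \<in> part (weight w - simple_root i) \<and>
    derives i (word F w) A B"
proof (induction w rule: rev_induct)
  case Nil
  then show ?case using derives_one[of i] subspace_0[OF part_subspace] by (intro exI[of _ 0]) simp
next
  case (snoc j w)
  then obtain A B where AB: "A \<in> part (weight w - simple_root i)" "B \<in> part (weight w - simple_root i)"
    "derives i (word F w) A B" by blast
  have AF: "A * F j \<in> part (weight (w @ [j]) - simple_root i)" "B * F j \<in> part (weight (w @ [j]) - simple_root i)"
    using part_mult[OF AB(1) part_F[of j]] part_mult[OF AB(2) part_F[of j]] by (simp_all add: algebra_simps)
  have W: "(if i = j then smul c (word F w) else 0) \<in> part (weight (w @ [j]) - simple_root i)" for c
    using part_word[of w] by (simp add: subspace_scale[OF part_subspace] subspace_0[OF part_subspace])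
  have W1: "(if i = j then word F w else 0) \<in> part (weight (w @ [j]) - simple_root i)"
    using W[of 1] by (simp only: scale_one)
  show ?case
    using derives_mult_F[OF part_word AB(3), of j] AF W W1
    by (intro exI conjI)
      (auto intro!: subspace_add[OF part_subspace] subspace_scale[OF part_subspace] simp del: weight_append)
qed

lemma derives_unique:
  assumes "derives i Y A B" "derives i Y A' B'" "A \<in> half" "B \<in> half" "A' \<in> half" "B' \<in> half"
  shows "A' = A" "B' = B"
proof -
  have "K (simple_root i) * (A - A') = (B - B') * L (simple_root i)"
    using assms(1,2) unfolding derives_def by (simp add: algebra_simps)
  then have "A - A' = 0 \<and> B - B' = 0"
    by (intro KL_independent subspace_diff[OF half_part_subspace] assms)
  then show "A' = A" "B' = B" by simp_all
qed

definition derL :: "'i \<Rightarrow> 'u \<Rightarrow> 'u" where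
  "derL i Y = (THE A. A \<in> half \<and> (\<exists>B\<in>half. derives i Y A B))"

definition derR :: "'i \<Rightarrow> 'u \<Rightarrow> 'u" where
  "derR i Y = (THE B. B \<in> half \<and> (\<exists>A\<in>half. derives i Y A B))"

lemma derL_eqI: "derives i Y A B \<Longrightarrow> A \<in> half \<Longrightarrow> B \<in> half \<Longrightarrow> derL i Y = A"
  unfolding derL_def by (rule the_equality) (blast intro: derives_unique(1))+

lemma derR_eqI: "derives i Y A B \<Longrightarrow> A \<in> half \<Longrightarrow> B \<in> half \<Longrightarrow> derR i Y = B"
  unfolding derR_def by (rule the_equality) (blast intro: derives_unique(2))+

lemma derives_exists: "Y \<in> half \<Longrightarrow> \<exists>A\<in>half. \<exists>B\<in>half. derives i Y A B"
proof (induction rule: half_induct)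
  case subspace
  show ?case
  proof (rule subspaceI; clarsimp)
    show "\<exists>A\<in>half. \<exists>B\<in>half. derives i 0 A B"
      using derives_zero subspace_0[OF half_part_subspace] by blast
  next
    fix Y Y' A A' B B' assume "A \<in> half" "B \<in> half" "derives i Y A B" "A' \<in> half" "B' \<in> half" "derives i Y' A' B'"
    then show "\<exists>A\<in>half. \<exists>B\<in>half. derives i (Y + Y') A B"
      using derives_add subspace_add[OF half_part_subspace] by blast
  next
    fix c Y A B assume "A \<in> half" "B \<in> half" "derives i Y A B"
    then show "\<exists>A\<in>half. \<exists>B\<in>half. derives i (smul c Y) A B"
      using derives_scale subspace_scale[OF half_part_subspace] by blast
  qed
next
  case (word w)
  show ?case using derives_word[of w i] part_half by blast
qed

lemma derives_der:
  assumes "Y \<in> half"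
  shows "derL i Y \<in> half" "derR i Y \<in> half" "derives i Y (derL i Y) (derR i Y)"
proof -
  obtain A B where AB: "A \<in> half" "B \<in> half" "derives i Y A B" using derives_exists[OF assms] by blast
  moreover have "derL i Y = A" "derR i Y = B" using derL_eqI derR_eqI AB by blast+
  ultimately show "derL i Y \<in> half" "derR i Y \<in> half" "derives i Y (derL i Y) (derR i Y)" by simp_all
qed

lemma E_mult_half:
  "Y \<in> half \<Longrightarrow> E i * Y = Y * E i - K (simple_root i) * derL i Y + derR i Y * L (simple_root i)"
  using derives_der(3)[of Y i] unfolding derives_def by (simp add: algebra_simps)

lemma
  assumes "Y \<in> half" "Y' \<in> half"
  shows derL_add: "derL i (Y + Y') = derL i Y + derL i Y'"
    and derR_add: "derR i (Y + Y') = derR i Y + derR i Y'"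
  using derives_add[OF derives_der(3)[OF assms(1)] derives_der(3)[OF assms(2)], of i]
    derives_der(1,2)[OF assms(1), of i] derives_der(1,2)[OF assms(2), of i]
  by (auto intro!: derL_eqI derR_eqI subspace_add[OF half_part_subspace])

lemma
  assumes "Y \<in> half"
  shows derL_scale: "derL i (smul c Y) = smul c (derL i Y)"
    and derR_scale: "derR i (smul c Y) = smul c (derR i Y)"
  using derives_scale[OF derives_der(3)[OF assms(1)], of i c] derives_der(1,2)[OF assms(1), of i]
  by (auto intro!: derL_eqI derR_eqI subspace_scale[OF half_part_subspace])

lemma derL_zero: "derL i 0 = 0" and derR_zero: "derR i 0 = 0"
  and derL_one: "derL i 1 = 0" and derR_one: "derR i 1 = 0"
  using derives_zero[of i] derives_one[of i] subspace_0[OF half_part_subspace[of F]]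
  by (auto intro!: derL_eqI derR_eqI)

lemma
  assumes "Y \<in> part \<beta>"
  shows derL_mult_F: "derL i (Y * F j) = derL i Y * F j + (if i = j then smul (chi (simple_root i) \<beta>) Y else 0)"
    and derR_mult_F: "derR i (Y * F j) =
      smul (chi (simple_root j) (simple_root i)) (derR i Y * F j) + (if i = j then Y else 0)"
proof -
  have Y: "Y \<in> half" using assms by (rule part_half)
  have m: "derL i Y * F j + (if i = j then smul (chi (simple_root i) \<beta>) Y else 0) \<in> half"
    "smul (chi (simple_root j) (simple_root i)) (derR i Y * F j) + (if i = j then Y else 0) \<in> half"
    using derives_der(1,2)[OF Y, of i] Y
    by (auto intro!: subspace_add[OF half_part_subspace] subspace_scale[OF half_part_subspace]
      half_part_mult half_part_gen subspace_0[OF half_part_subspace])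
  note d = derives_mult_F[OF assms derives_der(3)[OF Y], of i j]
  show "derL i (Y * F j) = derL i Y * F j + (if i = j then smul (chi (simple_root i) \<beta>) Y else 0)"
    by (rule derL_eqI[OF d m])
  show "derR i (Y * F j) =
      smul (chi (simple_root j) (simple_root i)) (derR i Y * F j) + (if i = j then Y else 0)"
    by (rule derR_eqI[OF d m])
qed

lemma der_part:
  assumes "Y \<in> part \<beta>"
  shows "derL i Y \<in> part (\<beta> - simple_root i)" "derR i Y \<in> part (\<beta> - simple_root i)"
proof -
  have "Y \<in> half \<and> derL i Y \<in> part (\<beta> - simple_root i) \<and> derR i Y \<in> part (\<beta> - simple_root i)"
    using assms
  proof (induction rule: part_induct)
    case subspace
    show ?case
      by (rule subspaceI)
        (auto simp: derL_zero derR_zero derL_add derR_add derL_scale derR_scale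
          subspace_0[OF half_part_subspace] subspace_0[OF part_subspace]
          subspace_add[OF half_part_subspace] subspace_add[OF part_subspace]
          subspace_scale[OF half_part_subspace] subspace_scale[OF part_subspace])
  next
    case (word w)
    then obtain A B where AB: "A \<in> part (\<beta> - simple_root i)" "B \<in> part (\<beta> - simple_root i)"
      "derives i (word F w) A B" using derives_word by blast
    then have "derL i (word F w) = A" "derR i (word F w) = B" using derL_eqI derR_eqI part_half by blast+
    then show ?case using AB half_part_word by simp
  qed
  then show "derL i Y \<in> part (\<beta> - simple_root i)" "derR i Y \<in> part (\<beta> - simple_root i)" by blast+
qed

text \<open>Both sides delete one F_i and one F_k. If the F_i lies to the left of the F_k, neither
  deletion sees the other letter. Otherwise the second deletion sees one letter fewer, and both
  orders lose the same factor chi(alpha_i, alpha_k).\<close>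

lemma derL_derR_commute:
  assumes "Y \<in> half"
  shows "derL i (derR k Y) = derR k (derL i Y)"
proof -
  have "Y \<in> half \<and> derL i (derR k Y) = derR k (derL i Y)"
    using assms
  proof (induction rule: half_induct)
    case subspace
    show ?case
      by (rule subspaceI)
        (auto simp: derL_zero derR_zero derL_add derR_add derL_scale derR_scale derives_der
          subspace_0[OF half_part_subspace] subspace_add[OF half_part_subspace]
          subspace_scale[OF half_part_subspace])
  next
    case (word w)
    have "derL i (derR k (word F w)) = derR k (derL i (word F w))"
    proof (induction w rule: rev_induct)
      case Nil
      then show ?case by (simp add: derL_zero derR_zero derL_one derR_one)
    next
      case (snoc j w)
      let ?Y = "word F w"
      let ?\<beta> = "weight w"
      let ?c = "chi (simple_root j) (simple_root k)"
      have Y: "?Y \<in> part ?\<beta>" and Yh: "?Y \<in> half" by (rule part_word half_part_word)+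
      note h = derives_der(1,2)[OF Yh] half_part_mult[OF _ half_part_gen]
        subspace_scale[OF half_part_subspace] subspace_0[OF half_part_subspace] Yh
      have "derL i (derR k (?Y * F j)) =
          derL i (smul ?c (derR k ?Y * F j) + (if k = j then ?Y else 0))"
        by (simp add: derR_mult_F[OF Y])
      also have "\<dots> = smul ?c (derL i (derR k ?Y * F j)) + (if k = j then derL i ?Y else 0)"
        by (simp add: h derL_add derL_scale derL_zero)
      also have "derL i (derR k ?Y * F j) = derL i (derR k ?Y) * F j
          + (if i = j then smul (chi (simple_root i) (?\<beta> - simple_root k)) (derR k ?Y) else 0)"
        by (rule derL_mult_F[OF der_part(2)[OF Y]])
      finally have 1: "derL i (derR k (?Y * F j)) = smul ?c (derL i (derR k ?Y) * F j
          + (if i = j then smul (chi (simple_root i) (?\<beta> - simple_root k)) (derR k ?Y) else 0))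
          + (if k = j then derL i ?Y else 0)" .
      have "derR k (derL i (?Y * F j)) =
          derR k (derL i ?Y * F j + (if i = j then smul (chi (simple_root i) ?\<beta>) ?Y else 0))"
        by (simp add: derL_mult_F[OF Y])
      also have "\<dots> = derR k (derL i ?Y * F j) + (if i = j then smul (chi (simple_root i) ?\<beta>) (derR k ?Y) else 0)"
        by (simp add: h derR_add derR_scale derR_zero)
      also have "derR k (derL i ?Y * F j) = smul ?c (derR k (derL i ?Y) * F j) + (if k = j then derL i ?Y else 0)"
        by (rule derR_mult_F[OF der_part(1)[OF Y]])
      finally show ?case
        using 1 snoc by (auto simp: scale_right_distrib chi_simps)
    qed
    then show ?case using half_part_word by blast
  qed
  then show ?thesis by blast
qed

text \<open>In degree alpha_i both derivations delete the only letter, with coefficient 1. This is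
  the boundary case of the kernel inductions and of \<open>psi_E_mult\<close>.\<close>

lemma der_simple_root: "Y \<in> part (simple_root i) \<Longrightarrow> derL i Y = derR i Y"
proof -
  assume "Y \<in> part (simple_root i)"
  then have "Y \<in> half \<and> derL i Y = derR i Y"
  proof (induction rule: part_induct)
    case subspace
    show ?case
      by (rule subspaceI)
        (auto simp: derL_zero derR_zero derL_add derR_add derL_scale derR_scale derives_der
          subspace_0[OF half_part_subspace] subspace_add[OF half_part_subspace]
          subspace_scale[OF half_part_subspace])
  next
    case (word w)
    then have "length w = 1" using height_weight[of w] by simp
    then obtain j where w: "w = [j]" by (auto simp: length_Suc_conv)
    have "derL i (1 * F j) = derR i (1 * F j)"
      using derL_mult_F[OF part_word[of "[]"], of i j] derR_mult_F[OF part_word[of "[]"], of i j]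
      by (simp add: derL_one derR_one chi_simps)
    then show ?case using half_part_word[of F w] w by simp
  qed
  then show ?thesis by blast
qed

section \<open>Common kernels of the skew derivations\<close>

lemma commuting_eq_0:
  assumes "Y \<in> part \<beta>" "\<beta> \<noteq> 0" "\<And>i. derL i Y = 0" "\<And>i. derR i Y = 0"
  shows "Y = 0"
proof (cases "\<beta> \<in> pos_lattice")
  case True
  show ?thesis
    by (rule centralizer_trivial[of \<beta>])
      (use assms True part_half[OF assms(1)] part_grade[OF assms(1)] in \<open>simp_all add: E_mult_half\<close>)
qed (use assms part_eq_0 in blast)

text \<open>By commutation, \<open>derL i Y\<close> is again killed by every \<open>derR k\<close>
  and has smaller height, so it vanishes by induction. Then both families kill Y and (U6)
  applies.\<close>

lemma derR_kernel:
  assumes "Y \<in> part \<beta>" "\<beta> \<noteq> 0" "\<And>i. derR i Y = 0"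
  shows "Y = 0"
  using assms
proof (induction "height \<beta>" arbitrary: \<beta> Y rule: less_induct)
  case less
  have "derL i Y = 0" for i
  \<comment> \<open>The induction hypothesis excludes degree 0, so the case that beta is alpha_i is
    left to \<open>der_simple_root\<close>.\<close>
  proof (cases "\<beta> - simple_root i \<in> pos_lattice \<and> \<beta> \<noteq> simple_root i")
    case True
    show ?thesis
    proof (rule less.hyps)
      show "derL i Y \<in> part (\<beta> - simple_root i)" by (rule der_part(1)[OF less.prems(1)])
      show "derR k (derL i Y) = 0" for k
        using derL_derR_commute[OF part_half[OF less.prems(1)], of i k] less.prems(3)
        by (simp add: derL_zero)
    qed (use True height_diff_simple_root in auto)
  next
    case False
    then show ?thesis
      using der_simple_root[of Y i] less.prems(1,3) part_eq_0 der_part(1)[OF less.prems(1), of i] by auto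
  qed
  then show ?case using commuting_eq_0 less.prems by blast
qed

lemma derL_kernel:
  assumes "Y \<in> part \<beta>" "\<beta> \<noteq> 0" "\<And>i. derL i Y = 0"
  shows "Y = 0"
  using assms
proof (induction "height \<beta>" arbitrary: \<beta> Y rule: less_induct)
  case less
  have "derR i Y = 0" for i
  proof (cases "\<beta> - simple_root i \<in> pos_lattice \<and> \<beta> \<noteq> simple_root i")
    case True
    show ?thesis
    proof (rule less.hyps)
      show "derR i Y \<in> part (\<beta> - simple_root i)" by (rule der_part(2)[OF less.prems(1)])
      show "derL k (derR i Y) = 0" for k
        using derL_derR_commute[OF part_half[OF less.prems(1)], of k i] less.prems(3)
        by (simp add: derR_zero)
    qed (use True height_diff_simple_root in auto)
  next
    case False
    then show ?thesis
      using der_simple_root[of Y i] less.prems(1,3) part_eq_0 der_part(2)[OF less.prems(1), of i] by auto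
  qed
  then show ?case using commuting_eq_0 less.prems by blast
qed

end

subsection \<open>Triangular decomposition of the quantum group\<close>

lemma (in k_algebra) conj_half_part:
  assumes "k' * k = 1" "k * k' = 1" "\<And>i. k * G i * k' \<in> half_part smul G" "Y \<in> half_part smul G"
  shows "k * Y * k' \<in> half_part smul G"
proof (rule linear_span_mem[of "\<lambda>Y. k * Y * k'" _ "range (word G)"])
  show "Vector_Spaces.linear smul smul (\<lambda>Y. k * Y * k')"
    by (rule linear_selfI) (simp_all add: distrib_left distrib_right smul_mult_left smul_mult_right)
  have w: "k * word G w * k' \<in> half_part smul G" for w
  proof (induction w)
    case Nil
    then show ?case by (simp add: assms(2) half_part_one)
  next
    case (Cons i w)
    have "k * (G i * word G w) * k' = k * G i * (k' * k) * word G w * k'"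
      by (simp add: assms(1) mult.assoc)
    also have "\<dots> = (k * G i * k') * (k * word G w * k')" by (simp only: mult.assoc)
    finally show ?case using half_part_mult[OF assms(3)[of i] Cons] by simp
  qed
  show "k * y * k' \<in> half_part smul G" if "y \<in> range (word G)" for y
    using that w by blast
qed (use assms(4) half_part_eq_span half_part_subspace in auto)

text \<open>Reversing the grading lets U^+ satisfy the assumptions of
  \<open>borel_half\<close>.\<close>

lemma internal_direct_sum_uminus:
  fixes W :: "'j::ab_group_add \<Rightarrow> 'v::ab_group_add set"
  assumes "vector_space smul" "internal_direct_sum smul UNIV W"
  shows "internal_direct_sum smul UNIV (\<lambda>j. W (- j))"
proof -
  interpret graded_space smul UNIV W using assms by (simp add: graded_space_def graded_space_axioms_def)
  have bij: "bij_betw uminus (A :: 'j set) (uminus ` A)" for A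
    by (simp add: bij_betw_def)
  have fin: "finite {j. c (- j) \<noteq> 0} \<longleftrightarrow> finite {j. c j \<noteq> 0}" for c :: "'j \<Rightarrow> 'v"
  proof -
    have "{j. c (- j) \<noteq> 0} = uminus ` {j. c j \<noteq> 0}" by (force simp: image_iff intro: exI[of _ "- _"])
    then show ?thesis by (simp add: finite_image_iff)
  qed
  have sum: "(\<Sum>j | c (- j) \<noteq> 0. c (- j)) = (\<Sum>j | c j \<noteq> 0. c j)" for c :: "'j \<Rightarrow> 'v"
    by (rule sum.reindex_bij_witness[of _ uminus uminus]) auto
  show ?thesis
    unfolding internal_direct_sum_def
  proof (intro conjI ballI allI)
    show "subspace (W (- j))" for j using grade_subspace by simp
    fix x
    show "\<exists>!c. finite {j. c j \<noteq> 0} \<and> (\<forall>j\<in>UNIV. c j \<in> W (- j)) \<and> (\<forall>j. j \<notin> UNIV \<longrightarrow> c j = 0) \<and>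
        x = (\<Sum>j | c j \<noteq> 0. c j)"
    proof (rule ex1I[of _ "\<lambda>j. comps x (- j)"])
      show "finite {j. comps x (- j) \<noteq> 0} \<and> (\<forall>j\<in>UNIV. comps x (- j) \<in> W (- j)) \<and>
          (\<forall>j. j \<notin> UNIV \<longrightarrow> comps x (- j) = 0) \<and> x = (\<Sum>j | comps x (- j) \<noteq> 0. comps x (- j))"
        using comps_finite comps_mem fin[of "comps x"] sum[of "comps x"] comps_sum by simp
      fix c assume c: "finite {j. c j \<noteq> 0} \<and> (\<forall>j\<in>UNIV. c j \<in> W (- j)) \<and> (\<forall>j. j \<notin> UNIV \<longrightarrow> c j = 0) \<and>
        x = (\<Sum>j | c j \<noteq> 0. c j)"
      have "comps x = (\<lambda>j. c (- j))"
      proof (rule comps_unique[of "{j. c (- j) \<noteq> 0}"])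
        show "finite {j. c (- j) \<noteq> 0}" using c fin[of c] by blast
        show "x = (\<Sum>j | c (- j) \<noteq> 0. c (- j))" using c sum[of c] by simp
        show "c (- j) \<in> W j" for j using c by (metis UNIV_I minus_minus)
      qed auto
      then show "c = (\<lambda>j. comps x (- j))" by simp
    qed
  qed
qed

locale quantum_group = generalized_quantum_group smul chi K L E F Ugr
  for smul :: "'k::field \<Rightarrow> 'u::ring_1 \<Rightarrow> 'u"
    and chi :: "int ^ 'i::finite \<Rightarrow> int ^ 'i \<Rightarrow> 'k"
    and K L :: "int ^ 'i \<Rightarrow> 'u"
    and E F :: "'i \<Rightarrow> 'u"
    and Ugr :: "int ^ 'i \<Rightarrow> 'u set" +
  assumes bicharacter: "bicharacter chi"
begin

sublocale graded_space smul UNIV Ugr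
  by unfold_locales (rule U4_grading)

lemmas chi_simps = bichar_simps[OF bicharacter]

section \<open>The Cartan part and coefficient functionals\<close>

definition cartan :: "int ^ 'i \<Rightarrow> int ^ 'i \<Rightarrow> 'u" where
  "cartan a b = K a * L b"

lemma cartan_zero [simp]: "cartan 0 0 = 1"
  by (simp add: cartan_def U2_K_zero U2_L_zero)

lemma cartan_mult: "cartan a b * cartan a' b' = cartan (a + a') (b + b')"
  unfolding cartan_def by (metis U2_KK U2_LL U2_KL mult.assoc)

lemma K_eq_cartan: "K a = cartan a 0" and L_eq_cartan: "L a = cartan 0 a"
  by (simp_all add: cartan_def U2_K_zero U2_L_zero)

lemma range_cartan: "range (\<lambda>(a, b). K a * L b) = range (\<lambda>(a, b). cartan a b)"
  by (simp add: cartan_def)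

lemma cartan_part_eq: "cartan_part smul K L = span (range (\<lambda>(a, b). cartan a b))"
  by (simp add: cartan_part_def range_cartan)

lemma cartan_mem: "cartan a b \<in> cartan_part smul K L"
  unfolding cartan_part_eq by (intro span_base) auto

lemma one_grade: "1 \<in> Ugr 0"
  using U4_cartan cartan_mem[of 0 0] by auto

lemma cartan_grade: "cartan a b \<in> Ugr 0"
  using U4_cartan cartan_mem by blast

text \<open>By (U3) the K_a L_b are distinct and independent, so values on them can be prescribed
  freely.\<close>

lemma cartan_functional_exists:
  "\<exists>h. functional smul h \<and> (\<forall>a b. h (cartan a b) = g a b)"
proof -
  have inj: "inj (\<lambda>(a, b). cartan a b)" using U3_distinct by (simp add: cartan_def)
  obtain h where h: "functional smul h"
    "\<And>b. b \<in> range (\<lambda>(a, b). cartan a b) \<Longrightarrow> h b = (case inv (\<lambda>(a, b). cartan a b) b of (a, b) \<Rightarrow> g a b)"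
    by (rule functional_extend[OF U3_independent[unfolded range_cartan],
      of "\<lambda>b. case inv (\<lambda>(a, b). cartan a b) b of (a, b) \<Rightarrow> g a b"]) (rule that; assumption)
  have "h (cartan a b) = g a b" for a b
    using h(2)[OF range_eqI[of _ _ "(a, b)"]] inv_f_f[OF inj, of "(a, b)"] by simp
  then show ?thesis using h(1) by blast
qed

definition cartan_functional :: "(int ^ 'i \<Rightarrow> int ^ 'i \<Rightarrow> 'k) \<Rightarrow> 'u \<Rightarrow> 'k" where
  "cartan_functional g = (SOME h. functional smul h \<and> (\<forall>a b. h (cartan a b) = g a b))"

lemma cartan_functional: "functional smul (cartan_functional g)"
  and cartan_functional_cartan: "cartan_functional g (cartan a b) = g a b"
  using someI_ex[OF cartan_functional_exists[of g]] unfolding cartan_functional_def by blast+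

text \<open>A functional on all of U, as \<open>tensor_lift\<close> requires, that restricts to the
  counit on both halves: their degree 0 parts are the scalars, and every other degree is killed. On
  U_0 outside the Cartan part its values depend on the chosen extension.\<close>

definition eps :: "'u \<Rightarrow> 'k" where
  "eps u = cartan_functional (\<lambda>a b. if a = 0 \<and> b = 0 then 1 else 0) (comps u 0)"

lemma eps_functional: "functional smul eps"
proof (rule functionalI)
  note c = cartan_functional[of "\<lambda>a b. if a = 0 \<and> b = 0 then 1 else 0"]
  show "eps (x + y) = eps x + eps y" for x y
    unfolding eps_def comps_add by (rule functional_add[OF c])
  show "eps (smul c x) = c * eps x" for c x
    unfolding eps_def comps_scale by (rule functional_scale[OF c])
qed

lemmas eps_linear = functional_add[OF eps_functional] functional_scale[OF eps_functional]
  functional_zero[OF eps_functional]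

lemma eps_one [simp]: "eps 1 = 1"
  using comps_homogeneous[OF _ one_grade, of 0]
    cartan_functional_cartan[of "\<lambda>a b. if a = 0 \<and> b = 0 then 1 else 0" 0 0]
  by (simp add: eps_def)

lemma eps_grade: "u \<in> Ugr \<kappa> \<Longrightarrow> \<kappa> \<noteq> 0 \<Longrightarrow> eps u = 0"
  using comps_homogeneous[of \<kappa> u 0]
    functional_zero[OF cartan_functional[of "\<lambda>a b. if a = 0 \<and> b = 0 then 1 else 0"]]
  by (simp add: eps_def)

text \<open>With a \<open>cartan_functional\<close> for h this reads off the U^- coefficient of
  prescribed Cartan elements. Both \<open>psi\<close> and \<open>coef\<close> are instances.\<close>

lemma proj_minus_exists:
  assumes "functional smul h" "functional smul f"
  shows "\<exists>g. Vector_Spaces.linear smul smul g \<and> (\<forall>y z x. y \<in> half_part smul F \<longrightarrow>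
    z \<in> cartan_part smul K L \<longrightarrow> x \<in> half_part smul E \<longrightarrow> g (y * z * x) = smul (h z * f x) y)"
proof -
  obtain g where "Vector_Spaces.linear smul smul g" "\<And>y z x. y \<in> half_part smul F \<Longrightarrow>
    z \<in> cartan_part smul K L \<Longrightarrow> x \<in> half_part smul E \<Longrightarrow> g (y * z * x) = smul (h z * f x) y"
    by (rule tensor_lift[OF U5_triangular, of "\<lambda>y z x. smul (h z * f x) y"])
      (auto simp: functional_add[OF assms(1)] functional_add[OF assms(2)] functional_scale[OF assms(1)]
       functional_scale[OF assms(2)] scale_right_distrib scale_left_distrib algebra_simps)
  then show ?thesis by blast
qed

definition proj_minus :: "('u \<Rightarrow> 'k) \<Rightarrow> ('u \<Rightarrow> 'k) \<Rightarrow> 'u \<Rightarrow> 'u" where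
  "proj_minus h f = (SOME g. Vector_Spaces.linear smul smul g \<and> (\<forall>y z x. y \<in> half_part smul F \<longrightarrow>
    z \<in> cartan_part smul K L \<longrightarrow> x \<in> half_part smul E \<longrightarrow> g (y * z * x) = smul (h z * f x) y))"

lemma
  assumes "functional smul h" "functional smul f"
  shows proj_minus_linear: "Vector_Spaces.linear smul smul (proj_minus h f)"
    and proj_minus_apply: "y \<in> half_part smul F \<Longrightarrow> x \<in> half_part smul E \<Longrightarrow>
      proj_minus h f (y * cartan a b * x) = smul (h (cartan a b) * f x) y"
  using someI_ex[OF proj_minus_exists[OF assms]] cartan_mem[of a b]
  unfolding proj_minus_def[symmetric] by blast+

lemma proj_plus_exists:
  assumes "functional smul h" "functional smul f"
  shows "\<exists>g. Vector_Spaces.linear smul smul g \<and> (\<forall>y z x. y \<in> half_part smul F \<longrightarrow>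
    z \<in> cartan_part smul K L \<longrightarrow> x \<in> half_part smul E \<longrightarrow> g (y * z * x) = smul (h z * f y) x)"
proof -
  obtain g where "Vector_Spaces.linear smul smul g" "\<And>y z x. y \<in> half_part smul F \<Longrightarrow>
    z \<in> cartan_part smul K L \<Longrightarrow> x \<in> half_part smul E \<Longrightarrow> g (y * z * x) = smul (h z * f y) x"
    by (rule tensor_lift[OF U5_triangular, of "\<lambda>y z x. smul (h z * f y) x"])
      (auto simp: functional_add[OF assms(1)] functional_add[OF assms(2)] functional_scale[OF assms(1)]
       functional_scale[OF assms(2)] scale_right_distrib scale_left_distrib algebra_simps)
  then show ?thesis by blast
qed

lemma K_inverse: "K a * K (- a) = 1" "K (- a) * K a = 1"
  by (simp_all add: U2_KK U2_K_zero)

lemma L_inverse: "L a * L (- a) = 1" "L (- a) * L a = 1"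
  by (simp_all add: U2_LL U2_L_zero)

lemma eq_0_cancel:
  assumes "k * k' = (1 :: 'u)" shows "B * k = 0 \<Longrightarrow> B = 0" "k' * B = 0 \<Longrightarrow> B = 0"
proof -
  assume "B * k = 0" then have "B * (k * k') = 0" by (simp flip: mult.assoc)
  then show "B = 0" using assms by simp
next
  assume "k' * B = 0" then have "(k * k') * B = 0" by (simp add: mult.assoc)
  then show "B = 0" using assms by simp
qed

lemma conj_K_minus: "Y \<in> half_part smul F \<Longrightarrow> K a * Y * K (- a) \<in> half_part smul F"
proof (rule conj_half_part)
  fix i
  have "K a * F i * K (- a) = smul (chi a (- simple_root i)) (F i)"
    by (simp add: U2_KF smul_mult_left mult.assoc K_inverse)
  then show "K a * F i * K (- a) \<in> half_part smul F"
    by (simp add: subspace_scale[OF half_part_subspace] half_part_gen)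
qed (simp_all add: K_inverse)

lemma conj_K_plus: "Y \<in> half_part smul E \<Longrightarrow> K a * Y * K (- a) \<in> half_part smul E"
proof (rule conj_half_part)
  fix i
  have "K a * E i * K (- a) = smul (chi a (simple_root i)) (E i)"
    by (simp add: U2_KE smul_mult_left mult.assoc K_inverse)
  then show "K a * E i * K (- a) \<in> half_part smul E"
    by (simp add: subspace_scale[OF half_part_subspace] half_part_gen)
qed (simp_all add: K_inverse)

text \<open>Once K is moved to the right of A, both sides are in triangular form with the different
  middle factors K(alpha_i) and L(alpha_i). Reading off the coefficient of the former shows that the
  conjugate A' vanishes.\<close>

lemma independent_minus:
  assumes A: "A \<in> half_part smul F" and B: "B \<in> half_part smul F"
    and eq: "K (simple_root i) * A = B * L (simple_root i)"
  shows "A = 0 \<and> B = 0"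
proof -
  let ?r = "simple_root i"
  let ?h = "cartan_functional (\<lambda>a b. if a = ?r \<and> b = 0 then 1 else 0)"
  define A' where "A' = K ?r * A * K (- ?r)"
  have A': "A' \<in> half_part smul F" unfolding A'_def by (rule conj_K_minus[OF A])
  have "A' * K ?r = K ?r * A * (K (- ?r) * K ?r)" unfolding A'_def by (simp only: mult.assoc)
  then have "A' * K ?r = K ?r * A" by (simp add: K_inverse)
  then have e: "A' * cartan ?r 0 * 1 = B * cartan 0 ?r * 1"
    using eq by (simp add: K_eq_cartan L_eq_cartan)
  have "A' = proj_minus ?h eps (A' * cartan ?r 0 * 1)"
    unfolding proj_minus_apply[OF cartan_functional eps_functional A' half_part_one]
    by (simp add: cartan_functional_cartan)
  also have "\<dots> = 0"
    unfolding e proj_minus_apply[OF cartan_functional eps_functional B half_part_one]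
    using simple_root_ne_0[of i] by (auto simp: cartan_functional_cartan)
  finally have "K ?r * A = 0" using e by (simp add: A'_def eq L_eq_cartan[symmetric])
  moreover from this have "B * L ?r = 0" using eq by simp
  ultimately show ?thesis using eq_0_cancel K_inverse L_inverse by blast
qed

lemma independent_plus:
  assumes A: "A \<in> half_part smul E" and B: "B \<in> half_part smul E"
    and eq: "L (simple_root i) * A = B * K (simple_root i)"
  shows "A = 0 \<and> B = 0"
proof -
  let ?r = "simple_root i"
  let ?h = "cartan_functional (\<lambda>a b. if a = 0 \<and> b = ?r then 1 else 0)"
  obtain g where g: "Vector_Spaces.linear smul smul g" "\<And>y z x. y \<in> half_part smul F \<Longrightarrow>
    z \<in> cartan_part smul K L \<Longrightarrow> x \<in> half_part smul E \<Longrightarrow> g (y * z * x) = smul (?h z * eps y) x"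
    using proj_plus_exists[OF cartan_functional[of "\<lambda>a b. if a = 0 \<and> b = ?r then 1 else 0"] eps_functional]
    by (elim exE conjE) (rule that, assumption, simp)
  define B' where "B' = K (- ?r) * B * K ?r"
  have B': "B' \<in> half_part smul E" unfolding B'_def using conj_K_plus[OF B, of "- ?r"] by simp
  have "K ?r * B' = (K ?r * K (- ?r)) * B * K ?r" unfolding B'_def by (simp only: mult.assoc)
  then have "K ?r * B' = B * K ?r" by (simp add: K_inverse)
  then have e: "1 * cartan 0 ?r * A = 1 * cartan ?r 0 * B'"
    using eq by (simp add: K_eq_cartan L_eq_cartan)
  have "A = g (1 * cartan 0 ?r * A)"
    unfolding g(2)[OF half_part_one cartan_mem A] by (simp add: cartan_functional_cartan)
  also have "\<dots> = 0"
    unfolding e g(2)[OF half_part_one cartan_mem B']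
    using simple_root_ne_0[of i] by (auto simp: cartan_functional_cartan)
  finally have "A = 0" .
  moreover from this have "B * K ?r = 0" using eq by simp
  ultimately show ?thesis using eq_0_cancel K_inverse by blast
qed

sublocale M: borel_half smul Ugr chi K L E F
proof
  fix \<beta> Y
  assume *: "\<beta> \<in> pos_lattice - {0}" "Y \<in> half_part smul F" "Y \<in> Ugr (- \<beta>)" "\<And>i. E i * Y = Y * E i"
  show "Y = 0" using U6_minus[OF *(1)] *(2-) by blast
qed (fact bicharacter one_grade U4_mult U4_F U2_KF U2_LF U2_EF | rule independent_minus)+

text \<open>Because K and L are exchanged, \<open>P.K_part\<close> speaks of L and
  \<open>P.L_part\<close> of K. \<open>P.part \<beta>\<close> is U^+ in degree beta, and
  \<open>P.derives i X A B\<close> says that F_i X - X F_i is B K(alpha_i) - L(alpha_i) A.\<close>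

sublocale P: borel_half smul "\<lambda>x. Ugr (- x)" "\<lambda>x y. chi y x" L K F E
proof
  show "internal_direct_sum smul UNIV (\<lambda>x. Ugr (- x))"
    by (rule internal_direct_sum_uminus) (unfold_locales, rule U4_grading)
  show "bicharacter (\<lambda>x y. chi y x)"
    unfolding bicharacter_def by (simp add: chi_simps mult.commute)
  show "1 \<in> Ugr (- 0)" using one_grade by simp
  show "x * y \<in> Ugr (- (lam + mu))" if "x \<in> Ugr (- lam)" "y \<in> Ugr (- mu)" for x y lam mu
    using U4_mult[OF that] by (simp add: add.commute)
  show "E i \<in> Ugr (- (- simple_root i))" for i using U4_E by simp
  show "L lam * E i = smul (chi (- simple_root i) lam) (E i * L lam)"
    "K lam * E i = smul (chi lam (simple_root i)) (E i * K lam)" for lam i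
    by (fact U2_LE U2_KE)+
  show "F i * E j - E j * F i = (if i = j then - L (simple_root i) + K (simple_root i) else 0)" for i j
    using U2_EF[of j i] by (auto simp: algebra_simps split: if_splits)
  show "A = 0 \<and> B = 0" if "A \<in> half_part smul E" "B \<in> half_part smul E"
    "L (simple_root i) * A = B * K (simple_root i)" for A B i
    using independent_plus that by blast
  fix \<beta> Y
  assume *: "\<beta> \<in> pos_lattice - {0}" "Y \<in> half_part smul E" "Y \<in> Ugr (- (- \<beta>))" "\<And>i. F i * Y = Y * F i"
  show "Y = 0" using U6_plus[OF *(1)] *(2-) by auto
qed

lemma P_part_grade: "X \<in> P.part \<beta> \<Longrightarrow> X \<in> Ugr \<beta>"
  using P.part_grade by simp

lemma E_word_grade: "word E w \<in> Ugr (weight w)"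
  using P.grade_word by simp

section \<open>Monomials spanning U and its homogeneous components\<close>

definition monomial :: "'i list \<times> (int ^ 'i) \<times> (int ^ 'i) \<times> 'i list \<Rightarrow> 'u" where
  "monomial m = (case m of (w, a, b, w') \<Rightarrow> word F w * cartan a b * word E w')"

definition mono_degree :: "'i list \<times> (int ^ 'i) \<times> (int ^ 'i) \<times> 'i list \<Rightarrow> int ^ 'i" where
  "mono_degree m = (case m of (w, a, b, w') \<Rightarrow> weight w' - weight w)"

lemma linear_mult_left: "Vector_Spaces.linear smul smul (\<lambda>x. u * x * u')"
  by (rule linear_selfI) (simp_all add: distrib_left distrib_right smul_mult_left smul_mult_right)

lemma monomial_span: "u \<in> span (range monomial)"
proof -
  have 1: "word F w * cartan a b * x \<in> span (range monomial)" if "x \<in> half_part smul E" for w a b x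
  proof (rule linear_span_mem[OF _ subspace_span _ that[unfolded half_part_eq_span]])
    show "Vector_Spaces.linear smul smul ((*) (word F w * cartan a b))"
      using linear_mult_left[of "word F w * cartan a b" 1] by simp
    show "word F w * cartan a b * s \<in> span (range monomial)" if s: "s \<in> range (word E)" for s
    proof -
      obtain w' where "s = word E w'" using s by blast
      then show ?thesis
        by (intro span_base range_eqI[of _ _ "(w, a, b, w')"]) (simp add: monomial_def)
    qed
  qed
  have 2: "word F w * z * x \<in> span (range monomial)"
    if "x \<in> half_part smul E" "z \<in> cartan_part smul K L" for w z x
    by (rule linear_span_mem[OF linear_mult_left[of "word F w" x] subspace_span _
        that(2)[unfolded cartan_part_eq]]) (use 1[OF that(1)] in auto)
  have 3: "y * z * x \<in> span (range monomial)"
    if "x \<in> half_part smul E" "z \<in> cartan_part smul K L" "y \<in> half_part smul F" for y z x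
  proof -
    have "1 * y * (z * x) \<in> span (range monomial)"
    proof (rule linear_span_mem[OF linear_mult_left[of 1 "z * x"] subspace_span _ that(3)[unfolded half_part_eq_span]])
      fix s assume "s \<in> range (word F)"
      then show "1 * s * (z * x) \<in> span (range monomial)"
        using 2[OF that(1,2)] by (auto simp: mult.assoc)
    qed
    then show ?thesis by (simp add: mult.assoc)
  qed
  have "span {y * z * x | y z x. y \<in> half_part smul F \<and> z \<in> cartan_part smul K L \<and> x \<in> half_part smul E}
      \<subseteq> span (range monomial)"
    by (rule span_minimal) (use 3 in auto)
  then show ?thesis using triangular_span[OF U5_triangular, of u] by blast
qed

lemma monomial_grade: "monomial m \<in> Ugr (mono_degree m)"
proof -
  obtain w a b w' where m: "m = (w, a, b, w')" by (cases m) auto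
  show ?thesis
    using U4_mult[OF U4_mult[OF M.grade_word[of w] cartan_grade[of a b]] E_word_grade[of w']]
    by (simp add: m monomial_def mono_degree_def)
qed

lemma grade_eq_span: "Ugr \<kappa> = span {monomial m | m. mono_degree m = \<kappa>}"
proof -
  have "span (range monomial) = UNIV" using monomial_span by auto
  then show ?thesis
    using span_homogeneous_inter[of mono_degree monomial \<kappa>] monomial_grade by auto
qed

lemma grade_induct [consumes 1, case_names subspace monomial]:
  assumes "u \<in> Ugr \<kappa>" "subspace {u. Q u}"
    "\<And>w a b w'. weight w' - weight w = \<kappa> \<Longrightarrow> Q (word F w * cartan a b * word E w')"
  shows "Q u"
proof -
  have "{monomial m | m. mono_degree m = \<kappa>} \<subseteq> {u. Q u}"
    using assms(3) by (auto simp: monomial_def mono_degree_def)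
  then show ?thesis using span_minimal[OF _ assms(2)] assms(1) unfolding grade_eq_span by blast
qed

lemma all_induct [case_names subspace monomial]:
  assumes "subspace {u. Q u}" "\<And>w a b w'. Q (word F w * cartan a b * word E w')"
  shows "Q u"
proof -
  have "range monomial \<subseteq> {u. Q u}" using assms(2) by (auto simp: monomial_def)
  then show ?thesis using span_minimal[OF _ assms(1)] monomial_span by blast
qed

lemma K_cartan: "K c * cartan a b = cartan a b * K c" and L_cartan: "L c * cartan a b = cartan a b * L c"
  by (simp_all add: K_eq_cartan L_eq_cartan cartan_mult add.commute)

lemma K_grade: "u \<in> Ugr \<kappa> \<Longrightarrow> K c * u = smul (chi c \<kappa>) (u * K c)"
proof (induction rule: grade_induct)
  case subspace
  show ?case by (rule subspaceI)
    (simp_all add: distrib_left distrib_right scale_right_distrib smul_mult_left smul_mult_right scale_left_commute)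
next
  case (monomial w a b w')
  have "K c * (word F w * cartan a b * word E w') = (K c * word F w) * cartan a b * word E w'"
    by (simp only: mult.assoc)
  also have "\<dots> = smul (chi c (- weight w)) (word F w * (K c * cartan a b) * word E w')"
    by (simp add: M.K_part[OF M.part_word] smul_mult_left mult.assoc)
  also have "\<dots> = smul (chi c (- weight w)) (word F w * cartan a b * (K c * word E w'))"
    by (simp add: K_cartan mult.assoc)
  also have "\<dots> = smul (chi c \<kappa>) (word F w * cartan a b * word E w' * K c)"
    using monomial by (simp add: P.L_part[OF P.part_word] smul_mult_right mult.assoc chi_simps mult.commute flip: monomial)
  finally show ?case .
qed

lemma L_grade: "u \<in> Ugr \<kappa> \<Longrightarrow> L c * u = smul (inverse (chi \<kappa> c)) (u * L c)"
proof (induction rule: grade_induct)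
  case subspace
  show ?case by (rule subspaceI)
    (simp_all add: distrib_left distrib_right scale_right_distrib smul_mult_left smul_mult_right scale_left_commute)
next
  case (monomial w a b w')
  have "L c * (word F w * cartan a b * word E w') = (L c * word F w) * cartan a b * word E w'"
    by (simp only: mult.assoc)
  also have "\<dots> = smul (chi (weight w) c) (word F w * (L c * cartan a b) * word E w')"
    by (simp add: M.L_part[OF M.part_word] smul_mult_left mult.assoc)
  also have "\<dots> = smul (chi (weight w) c) (word F w * cartan a b * (L c * word E w'))"
    by (simp add: L_cartan mult.assoc)
  also have "\<dots> = smul (inverse (chi \<kappa> c)) (word F w * cartan a b * word E w' * L c)"
    using monomial by (simp add: P.K_part[OF P.part_word] smul_mult_right mult.assoc chi_simps mult.commute flip: monomial)
  finally show ?case .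
qed

lemma cartan_grade_commute:
  assumes "u \<in> Ugr \<kappa>"
  shows "cartan a b * u = smul (chi a \<kappa> * inverse (chi \<kappa> b)) (u * cartan a b)"
  unfolding cartan_def
  by (simp add: mult.assoc L_grade[OF assms] smul_mult_right)
     (simp add: K_grade[OF assms] smul_mult_left mult.commute flip: mult.assoc)

subsection \<open>Counits and the projection to the Cartan part\<close>

lemma eps_F_word: "eps (word F w) = (if w = [] then 1 else 0)"
  using eps_grade[OF M.grade_word[of w]] by auto

lemma eps_E_word: "eps (word E w) = (if w = [] then 1 else 0)"
  using eps_grade[OF E_word_grade[of w]] by auto

text \<open>A concatenation of words is empty only if both words are; bilinearity does the
  rest.\<close>

lemma eps_mult_half:
  assumes w: "\<And>w. eps (word G w) = (if w = [] then 1 else 0)"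
    and x: "x \<in> half_part smul G" and y: "y \<in> half_part smul G"
  shows "eps (x * y) = eps x * eps y"
proof -
  have 1: "eps (word G v * y) = eps (word G v) * eps y" for v
  proof -
    have "range (word G) \<subseteq> {y. eps (word G v * y) = eps (word G v) * eps y}"
      using w[of "v @ _"] w by auto
    moreover have "subspace {y. eps (word G v * y) = eps (word G v) * eps y}"
      by (rule subspaceI) (simp_all add: distrib_left smul_mult_right eps_linear)
    ultimately show ?thesis using span_minimal y unfolding half_part_eq_span by blast
  qed
  have "subspace {x. eps (x * y) = eps x * eps y}"
    by (rule subspaceI) (simp_all add: distrib_right smul_mult_left eps_linear)
  then show ?thesis
    using span_minimal[of "range (word G)" "{x. eps (x * y) = eps x * eps y}"] 1 x
    unfolding half_part_eq_span by blast
qed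

lemma counit_on_eq:
  assumes w: "\<And>w. eps (word G w) = (if w = [] then 1 else 0)"
  shows "counit_on smul G = restrict eps (half_part smul G)"
  unfolding counit_on_def
proof (rule the_equality)
  note h = half_part_mult half_part_one half_part_gen subspace_add[OF half_part_subspace] subspace_scale[OF half_part_subspace]
  have "eps (G i) = 0" for i using w[of "[i]"] by simp
  then show "restrict eps (half_part smul G) \<in> extensional (half_part smul G) \<and>
    alg_hom_on smul (half_part smul G) (restrict eps (half_part smul G)) \<and>
    (\<forall>i. restrict eps (half_part smul G) (G i) = 0)"
    by (simp add: alg_hom_on_def h eps_linear eps_mult_half[OF w])
next
  fix e assume e: "e \<in> extensional (half_part smul G) \<and> alg_hom_on smul (half_part smul G) e \<and> (\<forall>i. e (G i) = 0)"
  note h = half_part_mult half_part_one half_part_gen subspace_add[OF half_part_subspace]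
    subspace_scale[OF half_part_subspace] half_part_word subspace_0[OF half_part_subspace]
  have hom: "e 1 = 1" "\<And>x y. x \<in> half_part smul G \<Longrightarrow> y \<in> half_part smul G \<Longrightarrow> e (x + y) = e x + e y"
    "\<And>x y. x \<in> half_part smul G \<Longrightarrow> y \<in> half_part smul G \<Longrightarrow> e (x * y) = e x * e y"
    "\<And>c x. x \<in> half_part smul G \<Longrightarrow> e (smul c x) = c * e x" "\<And>i. e (G i) = 0"
    using e unfolding alg_hom_on_def by blast+
  have "range (word G) \<subseteq> {x \<in> half_part smul G. e x = eps x}"
  proof clarify
    fix v
    have "e (word G v) = (if v = [] then 1 else 0)"
      by (cases v) (simp_all add: hom h)
    then show "word G v \<in> half_part smul G \<and> e (word G v) = eps (word G v)"
      by (simp add: w half_part_word)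
  qed
  moreover have "subspace {x \<in> half_part smul G. e x = eps x}"
    using hom(4)[of 0 0]
    by (intro subspaceI) (simp_all add: h hom eps_linear)
  ultimately have "x \<in> half_part smul G \<Longrightarrow> e x = eps x" for x
    using span_minimal unfolding half_part_eq_span by blast
  then show "e = restrict eps (half_part smul G)" using e by (intro extensionalityI) auto
qed

text \<open>Resolves the definite description in \<open>Sh\<close>: \<open>tensor_lift\<close> gives
  existence, the spanning monomials give uniqueness.\<close>

lemma Sh_properties:
  "Vector_Spaces.linear smul smul (Sh smul K L E F) \<and> (\<forall>X\<in>half_part smul E. \<forall>Y\<in>half_part smul F.
    \<forall>lam mu. Sh smul K L E F (Y * K lam * L mu * X) = smul (eps Y * eps X) (K lam * L mu))"
proof -
  let ?Q = "\<lambda>f. Vector_Spaces.linear smul smul f \<and> (\<forall>X\<in>half_part smul E. \<forall>Y\<in>half_part smul F. \<forall>lam mu.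
        f (Y * K lam * L mu * X) = smul (eps Y * eps X) (K lam * L mu))"
  obtain f where f: "Vector_Spaces.linear smul smul f" "\<And>y z x. y \<in> half_part smul F \<Longrightarrow>
    z \<in> cartan_part smul K L \<Longrightarrow> x \<in> half_part smul E \<Longrightarrow> f (y * z * x) = smul (eps y * eps x) z"
    by (rule tensor_lift[OF U5_triangular, of "\<lambda>y z x. smul (eps y * eps x) z"])
      (auto simp: eps_linear scale_right_distrib scale_left_distrib algebra_simps)
  have ex: "?Q f"
    using f(1) f(2)[OF _ cartan_mem] by (simp add: cartan_def mult.assoc)
  have uniq: "g = f" if g: "?Q g" for g
  proof
    fix u show "g u = f u"
    proof (induction u rule: all_induct)
      case subspace
      show ?case using g f(1) by (intro subspaceI) (simp_all add: linear_add linear_scale linear_zero)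
    next
      case (monomial w a b w')
      show ?case using g ex half_part_word[of E w'] half_part_word[of F w]
        by (simp add: cartan_def mult.assoc)
    qed
  qed
  have "Sh smul K L E F = (THE f. ?Q f)"
    unfolding Sh_def by (simp add: counit_on_eq[OF eps_F_word] counit_on_eq[OF eps_E_word])
  also have "\<dots> = f" by (rule the_equality) (fact ex, fact uniq)
  finally show ?thesis using ex by simp
qed

lemma Sh_linear: "Vector_Spaces.linear smul smul (Sh smul K L E F)"
  and Sh_apply: "Y \<in> half_part smul F \<Longrightarrow> X \<in> half_part smul E \<Longrightarrow>
    Sh smul K L E F (Y * cartan a b * X) = smul (eps Y * eps X) (cartan a b)"
  using Sh_properties by (simp_all add: cartan_def mult.assoc)

text \<open>Skew commutation with the generators E_i and F_i propagates along words, and the Cartan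
  factor commutes with Z because the scalars of \<open>cartan_grade_commute\<close> are 1 in degree
  0.\<close>

lemma skew_centerI:
  assumes \<omega>: "mult_character \<omega>" and Z: "Z \<in> Ugr 0"
    and E: "\<And>i. Z * E i = smul (\<omega> (simple_root i)) (E i * Z)"
    and F: "\<And>i. Z * F i = smul (\<omega> (- simple_root i)) (F i * Z)"
  shows "Z \<in> skew_center smul Ugr \<omega>"
proof -
  have om: "\<omega> (x + y) = \<omega> x * \<omega> y" "\<omega> 0 = 1" for x y
    using \<omega> unfolding mult_character_def by (metis, metis add_0 mult_cancel_right1)
  have Ew: "Z * word E w = smul (\<omega> (weight w)) (word E w * Z)" for w
  proof (induction w)
    case (Cons i w)
    have "Z * word E (i # w) = smul (\<omega> (simple_root i)) (E i * (Z * word E w))"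
      by (simp add: E smul_mult_left mult.assoc[symmetric])
    then show ?case by (simp add: Cons smul_mult_right om mult.assoc)
  qed (simp add: om)
  have Fw: "Z * word F w = smul (\<omega> (- weight w)) (word F w * Z)" for w
  proof (induction w)
    case (Cons i w)
    have "Z * word F (i # w) = smul (\<omega> (- simple_root i)) (F i * (Z * word F w))"
      by (simp add: F smul_mult_left mult.assoc[symmetric])
    then show ?case using om(1)[of "- simple_root i" "- weight w"]
      by (simp add: Cons smul_mult_right mult.assoc)
  qed (simp add: om)
  have C: "Z * cartan a b = cartan a b * Z" for a b
    using cartan_grade_commute[OF Z, of a b] by (simp add: chi_simps)
  have "Z * X = smul (\<omega> \<kappa>) (X * Z)" if "X \<in> Ugr \<kappa>" for \<kappa> X
    using that
  proof (induction rule: grade_induct)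
    case subspace
    show ?case by (rule subspaceI)
      (simp_all add: distrib_left distrib_right scale_right_distrib smul_mult_left smul_mult_right scale_left_commute)
  next
    case (monomial w a b w')
    have "Z * (word F w * cartan a b * word E w') = (Z * word F w) * cartan a b * word E w'"
      by (simp only: mult.assoc)
    also have "\<dots> = smul (\<omega> (- weight w)) (word F w * (Z * cartan a b) * word E w')"
      by (simp add: Fw smul_mult_left mult.assoc)
    also have "\<dots> = smul (\<omega> (- weight w)) (word F w * cartan a b * (Z * word E w'))"
      by (simp add: C mult.assoc)
    also have "\<dots> = smul (\<omega> \<kappa>) (word F w * cartan a b * word E w' * Z)"
      using om(1)[of "- weight w" "weight w'"] monomial
      by (simp add: Ew smul_mult_right mult.assoc)
    finally show ?case .
  qed
  then show ?thesis using Z unfolding skew_center_def by blast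
qed

end

subsection \<open>The pairing between the two halves\<close>

context quantum_group
begin

text \<open>The pairing of \<open>X\<close> and \<open>Y\<close> is \<open>psi (X * Y)\<close>: the straightened product \<open>X * Y\<close> involves only
  \<open>K a\<close> with \<open>a \<ge> 0\<close>, and \<open>psi\<close> extracts the terms with \<open>a = 0\<close>, sending every \<open>L b\<close> to \<open>1\<close>.\<close>

definition psi :: "'u \<Rightarrow> 'k" where
  "psi u = eps (proj_minus (cartan_functional (\<lambda>a b. if a = 0 then 1 else 0)) eps u)"

lemma psi_functional: "functional smul psi"
  using proj_minus_linear[OF cartan_functional eps_functional]
  by (intro functionalI) (simp_all add: psi_def linear_add linear_scale eps_linear)

lemmas psi_linear = functional_add[OF psi_functional] functional_scale[OF psi_functional]
  functional_zero[OF psi_functional] functional_diff[OF psi_functional]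

lemma psi_apply:
  assumes "y \<in> half_part smul F" "x \<in> half_part smul E"
  shows "psi (y * cartan a b * x) = (if a = 0 then eps y * eps x else 0)"
  unfolding psi_def proj_minus_apply[OF cartan_functional eps_functional assms]
  by (simp add: cartan_functional_cartan eps_linear)

lemma psi_word: "psi (word F w * cartan a b * word E w') = (if a = 0 \<and> w = [] \<and> w' = [] then 1 else 0)"
  by (simp add: psi_apply half_part_word eps_F_word eps_E_word)

lemma psi_half: "y \<in> half_part smul F \<Longrightarrow> psi y = eps y"
  using psi_apply[OF _ half_part_one, of y 0 0] by simp

lemma subspace_psi_0:
  assumes "\<And>u u'. g (u + u') = g u + g u'" "\<And>c u. g (smul c u) = smul c (g u)"
  shows "subspace {u. psi (g u) = 0}"
proof -
  have "g 0 = 0" using assms(1)[of 0 0] by simp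
  then show ?thesis by (intro subspaceI) (simp_all add: assms psi_linear)
qed

lemma psi_F_left: "psi (F i * u) = 0"
proof (induction u rule: all_induct)
  case subspace
  show ?case by (rule subspace_psi_0) (simp_all add: distrib_left smul_mult_right)
next
  case (monomial w a b w')
  show ?case using psi_word[of "i # w" a b w'] by (simp add: mult.assoc)
qed

lemma psi_E_right: "psi (u * E i) = 0"
proof (induction u rule: all_induct)
  case subspace
  show ?case by (rule subspace_psi_0) (simp_all add: distrib_right smul_mult_left)
next
  case (monomial w a b w')
  show ?case using psi_word[of w a b "w' @ [i]"] by (simp add: mult.assoc)
qed

text \<open>Moving L past an F word costs a scalar, but \<open>psi\<close> sees only the empty word,
  where the scalar is 1, and it ignores the exponent of L.\<close>

lemma psi_L_left: "psi (L c * u) = psi u"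
proof (induction u rule: all_induct)
  case subspace
  show ?case by (rule subspaceI) (simp_all add: distrib_left smul_mult_right psi_linear)
next
  case (monomial w a b w')
  have "L c * (word F w * cartan a b * word E w') = (L c * word F w) * cartan a b * word E w'"
    by (simp only: mult.assoc)
  also have "\<dots> = smul (chi (weight w) c) (word F w * (L c * cartan a b) * word E w')"
    by (simp add: M.L_part[OF M.part_word] smul_mult_left mult.assoc)
  also have "L c * cartan a b = cartan a (c + b)" by (simp add: L_eq_cartan cartan_mult)
  finally show ?case by (simp add: psi_linear psi_word chi_simps)
qed

lemma psi_L_right: "psi (u * L c) = psi u"
proof (induction u rule: all_induct)
  case subspace
  show ?case by (rule subspaceI) (simp_all add: distrib_right smul_mult_left psi_linear)
next
  case (monomial w a b w')
  have "word F w * cartan a b * word E w' * L c = word F w * cartan a b * (word E w' * L c)"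
    by (simp only: mult.assoc)
  also have "\<dots> = smul (chi (weight w') c) (word F w * (cartan a b * L c) * word E w')"
    by (simp add: P.part_K[OF P.part_word] smul_mult_left smul_mult_right mult.assoc)
  also have "cartan a b * L c = cartan a (b + c)" by (simp add: L_eq_cartan cartan_mult)
  finally show ?case by (simp add: psi_linear psi_word chi_simps)
qed

text \<open>Straightening X Y creates only factors K and L at simple roots, so products of U^+ with
  U^- stay in this span. There an additional K(alpha_i) makes the exponent of K nonzero and
  \<open>psi\<close> vanishes; on all of U it might be compensated by K(-alpha_i).\<close>

definition K_nonneg :: "'u set" where
  "K_nonneg = span {word F w * cartan a b * word E w' | w a b w'. a \<in> pos_lattice}"

lemma K_nonneg_induct [consumes 1, case_names subspace monomial]:
  assumes "u \<in> K_nonneg" "subspace {u. Q u}"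
    "\<And>w a b w'. a \<in> pos_lattice \<Longrightarrow> Q (word F w * cartan a b * word E w')"
  shows "Q u"
  using assms(1) span_minimal[OF _ assms(2), of "{word F w * cartan a b * word E w' | w a b w'. a \<in> pos_lattice}"]
    assms(3) unfolding K_nonneg_def by blast

lemma K_nonneg_half:
  assumes "y \<in> half_part smul F" "a \<in> pos_lattice"
  shows "y * cartan a b * word E w' \<in> K_nonneg"
  using assms(1)
proof (induction rule: M.half_induct)
  case subspace
  show ?case using linear_subspace_vimage[OF linear_mult_left[of 1 "cartan a b * word E w'"], of K_nonneg]
    by (simp add: K_nonneg_def mult.assoc)
next
  case (word w)
  show ?case unfolding K_nonneg_def by (rule span_base) (use assms(2) in blast)
qed

lemma E_cartan: "E i * cartan a b =
    smul (inverse (chi a (simple_root i)) * chi (simple_root i) b) (cartan a b * E i)"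
  by (simp add: cartan_grade_commute[OF U4_E] chi_simps field_simps)

lemma K_nonneg_E:
  assumes "u \<in> K_nonneg" shows "E i * u \<in> K_nonneg"
  using assms
proof (induction rule: K_nonneg_induct)
  case subspace
  show ?case using linear_subspace_vimage[OF linear_mult_left[of "E i" 1], of K_nonneg]
    by (simp add: K_nonneg_def)
next
  case (monomial w a b w')
  let ?r = "simple_root i"
  have "E i * (word F w * cartan a b * word E w') =
      word F w * (E i * cartan a b) * word E w' - K ?r * M.derL i (word F w) * cartan a b * word E w'
      + M.derR i (word F w) * (L ?r * cartan a b) * word E w'"
  proof -
    have "E i * (word F w * cartan a b * word E w') = (E i * word F w) * cartan a b * word E w'"
      by (simp only: mult.assoc)
    then show ?thesis
      unfolding M.E_mult_half[OF half_part_word] by (simp add: algebra_simps)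
  qed
  also have "\<dots> = smul (inverse (chi a ?r) * chi ?r b) (word F w * cartan a b * word E (i # w'))
     - smul (chi ?r (- (weight w - ?r))) (M.derL i (word F w) * cartan (?r + a) b * word E w')
     + M.derR i (word F w) * cartan a (?r + b) * word E w'"
  proof -
    let ?D = "M.derL i (word F w)"
    have "K ?r * ?D * cartan a b = smul (chi ?r (- (weight w - ?r))) (?D * K ?r) * cartan a b"
      by (simp only: M.K_part[OF M.der_part(1)[OF M.part_word]])
    also have "\<dots> = smul (chi ?r (- (weight w - ?r))) (?D * cartan (?r + a) b)"
      by (simp only: K_eq_cartan smul_mult_left mult.assoc cartan_mult add_0_left)
    finally have 1: "K ?r * ?D * cartan a b = smul (chi ?r (- (weight w - ?r))) (?D * cartan (?r + a) b)" .
    have 2: "L ?r * cartan a b = cartan a (?r + b)" by (simp add: L_eq_cartan cartan_mult)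
    show ?thesis
      unfolding 1 2 E_cartan by (simp only: smul_mult_left smul_mult_right mult.assoc list.map prod_list.Cons)
  qed
  also have "\<dots> \<in> K_nonneg"
  proof -
    have "subspace K_nonneg" unfolding K_nonneg_def by (rule subspace_span)
    then show ?thesis
      by (intro subspace_add subspace_diff subspace_scale K_nonneg_half half_part_word
          M.derives_der[OF half_part_word] pos_lattice_add simple_root_pos monomial)
  qed
  finally show ?case .
qed

lemma plus_minus_K_nonneg:
  assumes "X \<in> half_part smul E" "Y \<in> half_part smul F"
  shows "X * Y \<in> K_nonneg"
  using assms(1)
proof (induction rule: P.half_induct)
  case subspace
  show ?case using linear_subspace_vimage[OF linear_mult_left[of 1 Y], of K_nonneg]
    by (simp add: K_nonneg_def)
next
  case (word w)
  show ?case
  proof (induction w)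
    case Nil
    then show ?case using K_nonneg_half[OF assms(2) pos_lattice_0, of 0 "[]"] by simp
  next
    case (Cons i w)
    then show ?case using K_nonneg_E[of "word E w * Y" i] by (simp add: mult.assoc)
  qed
qed

lemma psi_K_left:
  assumes "u \<in> K_nonneg" shows "psi (K (simple_root i) * u) = 0"
  using assms
proof (induction rule: K_nonneg_induct)
  case subspace
  show ?case by (rule subspace_psi_0) (simp_all add: distrib_left smul_mult_right)
next
  case (monomial w a b w')
  let ?r = "simple_root i"
  have "K ?r * (word F w * cartan a b * word E w') = (K ?r * word F w) * cartan a b * word E w'"
    by (simp only: mult.assoc)
  also have "\<dots> = smul (chi ?r (- weight w)) (word F w * (K ?r * cartan a b) * word E w')"
    by (simp add: M.K_part[OF M.part_word] smul_mult_left mult.assoc)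
  also have "K ?r * cartan a b = cartan (?r + a) b" by (simp add: K_eq_cartan cartan_mult)
  finally have e: "K ?r * (word F w * cartan a b * word E w') =
    smul (chi ?r (- weight w)) (word F w * cartan (?r + a) b * word E w')" .
  have "?r + a \<noteq> 0"
  proof
    assume "?r + a = 0"
    then have "?r = - a" by (simp add: eq_neg_iff_add_eq_0)
    then have "- a \<in> pos_lattice" using simple_root_pos[of i] by simp
    then have "a = 0" using pos_lattice_antisym monomial by blast
    then show False using \<open>?r = - a\<close> simple_root_ne_0[of i] by simp
  qed
  then show ?case by (simp add: e psi_linear psi_word)
qed

lemma psi_mult_K:
  assumes "X \<in> half_part smul E" "Y \<in> half_part smul F"
  shows "psi (X * K (simple_root i) * Y) = 0"
proof -
  let ?r = "simple_root i"
  let ?X = "K (- ?r) * X * K ?r"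
  have "K ?r * (?X * Y) = (K ?r * K (- ?r)) * X * K ?r * Y" by (simp only: mult.assoc)
  then have "X * K ?r * Y = K ?r * (?X * Y)" by (simp add: K_inverse)
  moreover have "?X \<in> half_part smul E" using conj_K_plus[OF assms(1), of "- ?r"] by simp
  ultimately show ?thesis using psi_K_left[OF plus_minus_K_nonneg[OF _ assms(2)]] by simp
qed

text \<open>Straightening E_i Y yields three terms. \<open>psi\<close> kills the one ending in E_i
  and the one containing K, and absorbs the L of the third.\<close>

lemma psi_mult_E:
  assumes "X \<in> half_part smul E" "Y \<in> half_part smul F"
  shows "psi (X * E i * Y) = psi (X * M.derR i Y)"
proof -
  have "X * E i * Y = (X * Y) * E i - X * K (simple_root i) * M.derL i Y
      + (X * M.derR i Y) * L (simple_root i)"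
    unfolding mult.assoc[of X "E i" Y] M.E_mult_half[OF assms(2)] by (simp add: algebra_simps)
  then show ?thesis
    using psi_mult_K[OF assms(1) M.derives_der(1)[OF assms(2)]]
    by (simp add: psi_linear psi_E_right psi_L_right)
qed

text \<open>The mirror identity, through which the kernel of \<open>P.derL\<close> yields
  nondegeneracy on the side of U^+.\<close>

lemma psi_mult_F:
  assumes "X \<in> half_part smul E" "Y \<in> half_part smul F"
  shows "psi (X * F i * Y) = psi (P.derL i X * Y)"
proof -
  have XF: "X * F i = F i * X + L (simple_root i) * P.derL i X - P.derR i X * K (simple_root i)"
    using P.E_mult_half[OF assms(1), of i] by (simp add: algebra_simps)
  have "X * F i * Y = F i * (X * Y) + L (simple_root i) * (P.derL i X * Y)
      - P.derR i X * K (simple_root i) * Y"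
    unfolding XF by (simp add: algebra_simps)
  then show ?thesis
    using psi_mult_K[OF P.derives_der(2)[OF assms(1)] assms(2)]
    by (simp add: psi_linear psi_F_left psi_L_left)
qed

text \<open>Here X separates E_i from Y. The letters of X are stripped from the right as
  \<open>derR\<close>, which \<open>derL i\<close> commutes with. For X = 1 only degree alpha_i
  contributes, and there \<open>derL\<close> and \<open>derR\<close> agree.\<close>

lemma psi_E_mult:
  assumes "X \<in> half_part smul E" "Y \<in> M.part \<beta>"
  shows "psi (E i * X * Y) = psi (X * M.derL i Y)"
  using assms(1)
proof (induction rule: P.half_induct)
  case subspace
  show ?case
    by (rule subspaceI) (simp_all add: distrib_left distrib_right smul_mult_right smul_mult_left psi_linear)
next
  case (word w)
  show ?case using assms(2)
  proof (induction w arbitrary: Y \<beta> rule: rev_induct)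
    case Nil
    have Y: "Y \<in> half_part smul F" by (rule M.part_half[OF Nil])
    have "eps (M.derR i Y) = eps (M.derL i Y)"
    proof (cases "\<beta> = simple_root i")
      case True
      then show ?thesis using M.der_simple_root Nil by simp
    next
      case False
      then show ?thesis
        using eps_grade[OF M.part_grade[OF M.der_part(1)[OF Nil, of i]]]
          eps_grade[OF M.part_grade[OF M.der_part(2)[OF Nil, of i]]] by simp
    qed
    then show ?case
      using psi_mult_E[OF half_part_one Y, of i] M.derives_der(1,2)[OF Y, of i] by (simp add: psi_half)
  next
    case (snoc j w)
    have Y: "Y \<in> half_part smul F" by (rule M.part_half[OF snoc.prems])
    have "psi (E i * word E (w @ [j]) * Y) = psi ((E i * word E w) * E j * Y)"
      by (simp add: mult.assoc)
    also have "\<dots> = psi (E i * word E w * M.derR j Y)"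
      by (rule psi_mult_E[OF half_part_mult[OF half_part_gen half_part_word] Y])
    also have "\<dots> = psi (word E w * M.derL i (M.derR j Y))"
      by (rule snoc.IH[OF M.der_part(2)[OF snoc.prems]])
    also have "\<dots> = psi (word E w * M.derR j (M.derL i Y))"
      by (simp add: M.derL_derR_commute[OF Y])
    also have "\<dots> = psi (word E w * E j * M.derL i Y)"
      by (rule psi_mult_E[OF half_part_word M.derives_der(1)[OF Y], symmetric])
    finally show ?case by simp
  qed
qed

section \<open>Nondegeneracy of the pairing and dual bases\<close>

lemma P_part_E: "X \<in> P.part (\<beta> - simple_root i) \<Longrightarrow> X * E i \<in> P.part \<beta>"
  and P_E_part: "X \<in> P.part (\<beta> - simple_root i) \<Longrightarrow> E i * X \<in> P.part \<beta>"
  using P.part_mult[of X "\<beta> - simple_root i" "E i" "simple_root i"]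
    P.part_mult[of "E i" "simple_root i" X "\<beta> - simple_root i"] P.part_F[of i] by simp_all

lemma M_part_F: "Y \<in> M.part (\<beta> - simple_root i) \<Longrightarrow> F i * Y \<in> M.part \<beta>"
  using M.part_mult[of "F i" "simple_root i" Y "\<beta> - simple_root i"] M.part_F[of i] by simp

text \<open>By adjointness every \<open>derR i Y\<close> pairs to 0 with U^+, hence vanishes by
  induction on the height, and \<open>derR_kernel\<close> concludes.\<close>

lemma psi_nondegenerate_minus:
  assumes "Y \<in> M.part \<beta>" "\<And>X. X \<in> P.part \<beta> \<Longrightarrow> psi (X * Y) = 0"
  shows "Y = 0"
  using assms
proof (induction "height \<beta>" arbitrary: \<beta> Y rule: less_induct)
  case less
  note Y = M.part_half[OF less.prems(1)]
  show ?case
  proof (cases "\<beta> = 0")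
    case True
    then obtain c where c: "Y = smul c 1" using M.part_0 less.prems(1) by blast
    have "psi (1 * Y) = 0" using less.prems(2)[of 1] P.part_word[of "[]"] True by simp
    then show ?thesis using psi_half[OF Y] c by (simp add: eps_linear)
  next
    case False
    have "M.derR i Y = 0" for i
    proof (cases "\<beta> - simple_root i \<in> pos_lattice")
      case True
      show ?thesis
      proof (rule less.hyps[OF height_diff_simple_root[OF True] M.der_part(2)[OF less.prems(1)]])
        fix X assume X: "X \<in> P.part (\<beta> - simple_root i)"
        have "psi (X * M.derR i Y) = psi (X * E i * Y)"
          using psi_mult_E[OF P.part_half[OF X] Y] by simp
        then show "psi (X * M.derR i Y) = 0" using less.prems(2)[OF P_part_E[OF X]] by simp
      qed
    qed (use M.part_eq_0 M.der_part(2)[OF less.prems(1)] in blast)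
    then show ?thesis using M.derR_kernel[OF less.prems(1) False] by blast
  qed
qed

lemma psi_nondegenerate_plus:
  assumes "X \<in> P.part \<beta>" "\<And>Y. Y \<in> M.part \<beta> \<Longrightarrow> psi (X * Y) = 0"
  shows "X = 0"
  using assms
proof (induction "height \<beta>" arbitrary: \<beta> X rule: less_induct)
  case less
  note X = P.part_half[OF less.prems(1)]
  show ?case
  proof (cases "\<beta> = 0")
    case True
    then obtain c where c: "X = smul c 1" using P.part_0 less.prems(1) by blast
    have "psi (X * 1) = 0" using less.prems(2)[of 1] M.part_word[of "[]"] True by simp
    then show ?thesis using psi_half[OF half_part_one] c by (simp add: psi_linear)
  next
    case False
    have "P.derL i X = 0" for i
    proof (cases "\<beta> - simple_root i \<in> pos_lattice")
      case True
      show ?thesis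
      proof (rule less.hyps[OF height_diff_simple_root[OF True] P.der_part(1)[OF less.prems(1)]])
        fix Y assume Y: "Y \<in> M.part (\<beta> - simple_root i)"
        have "psi (P.derL i X * Y) = psi (X * (F i * Y))"
          using psi_mult_F[OF X M.part_half[OF Y], of i] by (simp add: mult.assoc)
        then show "psi (P.derL i X * Y) = 0" using less.prems(2)[OF M_part_F[OF Y]] by simp
      qed
    qed (use P.part_eq_0 P.der_part(1)[OF less.prems(1)] in blast)
    then show ?thesis using P.derL_kernel[OF less.prems(1) False] by blast
  qed
qed

lemma dual_bases_ex: "\<exists>d. \<forall>\<beta>. case d \<beta> of (n :: nat, x, y) \<Rightarrow>
    (\<forall>s<n. x s \<in> P.part \<beta> \<and> y s \<in> M.part \<beta>) \<and>
    (\<forall>X\<in>P.part \<beta>. X = (\<Sum>s<n. smul (psi (X * y s)) (x s))) \<and>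
    (\<forall>Y\<in>M.part \<beta>. Y = (\<Sum>s<n. smul (psi (x s * Y)) (y s)))"
proof (rule choice, rule allI)
  fix \<beta>
  obtain T where T: "finite T" "P.part \<beta> = span T" using P.part_finite_span by blast
  have 1: "functional smul (\<lambda>x. psi (x * y))" and 2: "functional smul (\<lambda>x. psi (y * x))" for y
    by (rule functionalI; simp add: distrib_right distrib_left smul_mult_left smul_mult_right psi_linear)+
  obtain n :: nat and x y where "\<And>s. s < n \<Longrightarrow> x s \<in> P.part \<beta>" "\<And>s. s < n \<Longrightarrow> y s \<in> M.part \<beta>"
    "\<And>X. X \<in> P.part \<beta> \<Longrightarrow> X = (\<Sum>s<n. smul (psi (X * y s)) (x s))"
    "\<And>Y. Y \<in> M.part \<beta> \<Longrightarrow> Y = (\<Sum>s<n. smul (psi (x s * Y)) (y s))"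
    by (rule dual_bases_exist[of "P.part \<beta>" "M.part \<beta>" T "\<lambda>x y. psi (x * y)",
        OF P.part_subspace M.part_subspace T(1) _ 1 2])
       (use T(2) psi_nondegenerate_plus psi_nondegenerate_minus in blast)+
  then show "\<exists>d. case d of (n :: nat, x, y) \<Rightarrow>
    (\<forall>s<n. x s \<in> P.part \<beta> \<and> y s \<in> M.part \<beta>) \<and>
    (\<forall>X\<in>P.part \<beta>. X = (\<Sum>s<n. smul (psi (X * y s)) (x s))) \<and>
    (\<forall>Y\<in>M.part \<beta>. Y = (\<Sum>s<n. smul (psi (x s * Y)) (y s)))"
    by (intro exI[of _ "(n, x, y)"]) simp
qed

definition dual_bases :: "int ^ 'i \<Rightarrow> nat \<times> (nat \<Rightarrow> 'u) \<times> (nat \<Rightarrow> 'u)" where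
  "dual_bases = (SOME d. \<forall>\<beta>. case d \<beta> of (n :: nat, x, y) \<Rightarrow>
    (\<forall>s<n. x s \<in> P.part \<beta> \<and> y s \<in> M.part \<beta>) \<and>
    (\<forall>X\<in>P.part \<beta>. X = (\<Sum>s<n. smul (psi (X * y s)) (x s))) \<and>
    (\<forall>Y\<in>M.part \<beta>. Y = (\<Sum>s<n. smul (psi (x s * Y)) (y s))))"

definition dual_dim :: "int ^ 'i \<Rightarrow> nat" where "dual_dim \<beta> = fst (dual_bases \<beta>)"
definition dual_x :: "int ^ 'i \<Rightarrow> nat \<Rightarrow> 'u" where "dual_x \<beta> = fst (snd (dual_bases \<beta>))"
definition dual_y :: "int ^ 'i \<Rightarrow> nat \<Rightarrow> 'u" where "dual_y \<beta> = snd (snd (dual_bases \<beta>))"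

lemma
  shows dual_x_part: "s < dual_dim \<beta> \<Longrightarrow> dual_x \<beta> s \<in> P.part \<beta>"
    and dual_y_part: "s < dual_dim \<beta> \<Longrightarrow> dual_y \<beta> s \<in> M.part \<beta>"
    and dual_x_expand: "X \<in> P.part \<beta> \<Longrightarrow> (\<Sum>s<dual_dim \<beta>. smul (psi (X * dual_y \<beta> s)) (dual_x \<beta> s)) = X"
    and dual_y_expand: "Y \<in> M.part \<beta> \<Longrightarrow> (\<Sum>s<dual_dim \<beta>. smul (psi (dual_x \<beta> s * Y)) (dual_y \<beta> s)) = Y"
proof -
  have "case dual_bases \<beta> of (n :: nat, x, y) \<Rightarrow>
    (\<forall>s<n. x s \<in> P.part \<beta> \<and> y s \<in> M.part \<beta>) \<and>
    (\<forall>X\<in>P.part \<beta>. X = (\<Sum>s<n. smul (psi (X * y s)) (x s))) \<and>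
    (\<forall>Y\<in>M.part \<beta>. Y = (\<Sum>s<n. smul (psi (x s * Y)) (y s)))"
    using someI_ex[OF dual_bases_ex] unfolding dual_bases_def[symmetric] by (rule spec)
  then have *: "(\<forall>s<dual_dim \<beta>. dual_x \<beta> s \<in> P.part \<beta> \<and> dual_y \<beta> s \<in> M.part \<beta>) \<and>
    (\<forall>X\<in>P.part \<beta>. X = (\<Sum>s<dual_dim \<beta>. smul (psi (X * dual_y \<beta> s)) (dual_x \<beta> s))) \<and>
    (\<forall>Y\<in>M.part \<beta>. Y = (\<Sum>s<dual_dim \<beta>. smul (psi (dual_x \<beta> s * Y)) (dual_y \<beta> s)))"
    by (simp add: dual_dim_def dual_x_def dual_y_def case_prod_beta)
  show "s < dual_dim \<beta> \<Longrightarrow> dual_x \<beta> s \<in> P.part \<beta>" "s < dual_dim \<beta> \<Longrightarrow> dual_y \<beta> s \<in> M.part \<beta>"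
    "X \<in> P.part \<beta> \<Longrightarrow> (\<Sum>s<dual_dim \<beta>. smul (psi (X * dual_y \<beta> s)) (dual_x \<beta> s)) = X"
    "Y \<in> M.part \<beta> \<Longrightarrow> (\<Sum>s<dual_dim \<beta>. smul (psi (dual_x \<beta> s * Y)) (dual_y \<beta> s)) = Y"
    using * by (blast, blast) (rule *[THEN conjunct2, THEN conjunct1, THEN bspec, symmetric]
      *[THEN conjunct2, THEN conjunct2, THEN bspec, symmetric], assumption)+
qed

text \<open>The adjoint of the multiplication by \<open>E i\<close> on the left (right) is \<open>derL i\<close> (\<open>derR i\<close>);
  the transfer lemmas express this on the canonical elements \<open>\<Sum>\<^sub>s dual_y \<beta> s \<otimes> dual_x \<beta> s\<close>.\<close>

lemma transfer:
  assumes G1: "\<And>u. Vector_Spaces.linear smul smul (\<lambda>a. G a u)"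
    and G2: "\<And>u. Vector_Spaces.linear smul smul (G u)"
    and d: "\<And>Y. Y \<in> M.part \<beta> \<Longrightarrow> d Y \<in> M.part \<gamma>"
    and m: "\<And>X. X \<in> P.part \<gamma> \<Longrightarrow> m X \<in> P.part \<beta>"
    and adj: "\<And>X Y. X \<in> P.part \<gamma> \<Longrightarrow> Y \<in> M.part \<beta> \<Longrightarrow> psi (m X * Y) = psi (X * d Y)"
  shows "(\<Sum>s<dual_dim \<beta>. G (d (dual_y \<beta> s)) (dual_x \<beta> s)) = (\<Sum>t<dual_dim \<gamma>. G (dual_y \<gamma> t) (m (dual_x \<gamma> t)))"
proof -
  have "(\<Sum>s<dual_dim \<beta>. G (d (dual_y \<beta> s)) (dual_x \<beta> s)) =
      (\<Sum>s<dual_dim \<beta>. \<Sum>t<dual_dim \<gamma>. smul (psi (m (dual_x \<gamma> t) * dual_y \<beta> s)) (G (dual_y \<gamma> t) (dual_x \<beta> s)))"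
  proof (rule sum.cong[OF refl])
    fix s assume s: "s \<in> {..<dual_dim \<beta>}"
    have "G (d (dual_y \<beta> s)) (dual_x \<beta> s) =
        G (\<Sum>t<dual_dim \<gamma>. smul (psi (dual_x \<gamma> t * d (dual_y \<beta> s))) (dual_y \<gamma> t)) (dual_x \<beta> s)"
      using dual_y_expand[OF d[OF dual_y_part]] s by simp
    also have "\<dots> = (\<Sum>t<dual_dim \<gamma>. smul (psi (dual_x \<gamma> t * d (dual_y \<beta> s))) (G (dual_y \<gamma> t) (dual_x \<beta> s)))"
      by (simp add: linear_sum[OF G1] linear_scale[OF G1])
    also have "\<dots> = (\<Sum>t<dual_dim \<gamma>. smul (psi (m (dual_x \<gamma> t) * dual_y \<beta> s)) (G (dual_y \<gamma> t) (dual_x \<beta> s)))"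
      using adj[OF dual_x_part dual_y_part] s by (intro sum.cong) auto
    finally show "G (d (dual_y \<beta> s)) (dual_x \<beta> s) = \<dots>" .
  qed
  also have "\<dots> = (\<Sum>t<dual_dim \<gamma>. \<Sum>s<dual_dim \<beta>. smul (psi (m (dual_x \<gamma> t) * dual_y \<beta> s)) (G (dual_y \<gamma> t) (dual_x \<beta> s)))"
    by (rule sum.swap)
  also have "\<dots> = (\<Sum>t<dual_dim \<gamma>. G (dual_y \<gamma> t) (m (dual_x \<gamma> t)))"
  proof (rule sum.cong[OF refl])
    fix t assume t: "t \<in> {..<dual_dim \<gamma>}"
    have "(\<Sum>s<dual_dim \<beta>. smul (psi (m (dual_x \<gamma> t) * dual_y \<beta> s)) (G (dual_y \<gamma> t) (dual_x \<beta> s)))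
      = G (dual_y \<gamma> t) (\<Sum>s<dual_dim \<beta>. smul (psi (m (dual_x \<gamma> t) * dual_y \<beta> s)) (dual_x \<beta> s))"
      by (simp add: linear_sum[OF G2] linear_scale[OF G2])
    then show "(\<Sum>s<dual_dim \<beta>. smul (psi (m (dual_x \<gamma> t) * dual_y \<beta> s)) (G (dual_y \<gamma> t) (dual_x \<beta> s)))
      = G (dual_y \<gamma> t) (m (dual_x \<gamma> t))"
      using dual_x_expand[OF m[OF dual_x_part]] t by simp
  qed
  finally show ?thesis .
qed

text \<open>G stands for the tensor product. Commuting E_i past y_s produces skew derivatives in the
  first slot; adjointness turns them into multiplications by E_i in the second, with the degree
  lowered by alpha_i.\<close>

lemma transfer_commutator:
  assumes G1: "\<And>u. Vector_Spaces.linear smul smul (\<lambda>a. G a u)"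
    and G2: "\<And>u. Vector_Spaces.linear smul smul (G u)"
  shows "(\<Sum>s<dual_dim \<beta>. G (E i * dual_y \<beta> s) (dual_x \<beta> s)) = (\<Sum>s<dual_dim \<beta>. G (dual_y \<beta> s * E i) (dual_x \<beta> s))
    - (\<Sum>t<dual_dim (\<beta> - simple_root i). G (K (simple_root i) * dual_y (\<beta> - simple_root i) t) (E i * dual_x (\<beta> - simple_root i) t))
    + (\<Sum>t<dual_dim (\<beta> - simple_root i). G (dual_y (\<beta> - simple_root i) t * L (simple_root i)) (dual_x (\<beta> - simple_root i) t * E i))"
proof -
  let ?r = "simple_root i"
  have l: "Vector_Spaces.linear smul smul (\<lambda>a. G (K ?r * a) u)" "Vector_Spaces.linear smul smul (\<lambda>a. G (a * L ?r) u)" for u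
    by (rule linear_selfI; simp add: distrib_left distrib_right smul_mult_left smul_mult_right
        linear_add[OF G1] linear_scale[OF G1])+
  have "(\<Sum>s<dual_dim \<beta>. G (E i * dual_y \<beta> s) (dual_x \<beta> s)) = (\<Sum>s<dual_dim \<beta>. G (dual_y \<beta> s * E i) (dual_x \<beta> s)
      - G (K ?r * M.derL i (dual_y \<beta> s)) (dual_x \<beta> s) + G (M.derR i (dual_y \<beta> s) * L ?r) (dual_x \<beta> s))"
    by (rule sum.cong) (simp_all add: M.E_mult_half[OF M.part_half[OF dual_y_part]] linear_add[OF G1] linear_diff[OF G1])
  also have "\<dots> = (\<Sum>s<dual_dim \<beta>. G (dual_y \<beta> s * E i) (dual_x \<beta> s))
      - (\<Sum>s<dual_dim \<beta>. G (K ?r * M.derL i (dual_y \<beta> s)) (dual_x \<beta> s)) + (\<Sum>s<dual_dim \<beta>. G (M.derR i (dual_y \<beta> s) * L ?r) (dual_x \<beta> s))"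
    by (simp add: sum.distrib sum_subtractf)
  also have "(\<Sum>s<dual_dim \<beta>. G (K ?r * M.derL i (dual_y \<beta> s)) (dual_x \<beta> s)) =
      (\<Sum>t<dual_dim (\<beta> - ?r). G (K ?r * dual_y (\<beta> - ?r) t) (E i * dual_x (\<beta> - ?r) t))"
    by (rule transfer[where G = "\<lambda>a. G (K ?r * a)" and d = "M.derL i" and m = "\<lambda>X. E i * X"])
      (use l G2 M.der_part P_E_part psi_E_mult P.part_half in auto)
  also have "(\<Sum>s<dual_dim \<beta>. G (M.derR i (dual_y \<beta> s) * L ?r) (dual_x \<beta> s)) =
      (\<Sum>t<dual_dim (\<beta> - ?r). G (dual_y (\<beta> - ?r) t * L ?r) (dual_x (\<beta> - ?r) t * E i))"
    by (rule transfer[where G = "\<lambda>a. G (a * L ?r)" and d = "M.derR i" and m = "\<lambda>X. X * E i"])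
      (use l G2 M.der_part P_part_E psi_mult_E P.part_half M.part_half in auto)
  finally show ?thesis .
qed

end

subsection \<open>Elements skew-commuting with all \<open>E i\<close>\<close>

context quantum_group
begin

text \<open>The U^+ factor is tested by functionals instead of a basis, since precomposition with
  multiplication by E_i stays in this class and lowers gamma by alpha_i.\<close>

definition supported :: "('u \<Rightarrow> 'k) \<Rightarrow> int ^ 'i \<Rightarrow> bool" where
  "supported f \<gamma> \<longleftrightarrow> functional smul f \<and> (\<forall>\<kappa> u. u \<in> Ugr \<kappa> \<longrightarrow> \<kappa> \<noteq> \<gamma> \<longrightarrow> f u = 0)"

definition coef :: "int ^ 'i \<Rightarrow> int ^ 'i \<Rightarrow> ('u \<Rightarrow> 'k) \<Rightarrow> 'u \<Rightarrow> 'u" where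
  "coef a b f = proj_minus (cartan_functional (\<lambda>a' b'. if a' = a \<and> b' = b then 1 else 0)) f"

lemma coef_linear: "functional smul f \<Longrightarrow> Vector_Spaces.linear smul smul (coef a b f)"
  unfolding coef_def by (rule proj_minus_linear[OF cartan_functional])

lemma coef_apply:
  assumes "functional smul f" "y \<in> half_part smul F" "x \<in> half_part smul E"
  shows "coef a b f (y * cartan a' b' * x) = (if a' = a \<and> b' = b then smul (f x) y else 0)"
  unfolding coef_def proj_minus_apply[OF cartan_functional assms]
  by (simp add: cartan_functional_cartan)

text \<open>On monomials only a U^+ factor of weight gamma survives f, and homogeneity then fixes
  the weight of the U^- factor.\<close>

lemma coef_mem:
  assumes f: "supported f \<gamma>" and u: "u \<in> Ugr \<kappa>"
  shows "coef a b f u \<in> M.part (\<gamma> - \<kappa>)"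
  using u
proof (induction rule: grade_induct)
  case subspace
  show ?case by (rule linear_subspace_vimage[OF coef_linear M.part_subspace]) (use f in \<open>simp add: supported_def\<close>)
next
  case (monomial w a' b' w')
  have f': "functional smul f" "weight w' \<noteq> \<gamma> \<Longrightarrow> f (word E w') = 0"
    using f E_word_grade[of w'] unfolding supported_def by blast+
  have "weight w' = \<gamma> \<Longrightarrow> weight w = \<gamma> - \<kappa>" using monomial by (simp add: algebra_simps)
  then show ?case
    using f'(2) M.part_word[of w] subspace_0[OF M.part_subspace]
    by (cases "weight w' = \<gamma>")
      (auto simp: coef_apply[OF f'(1)] half_part_word intro: subspace_scale[OF M.part_subspace])
qed

lemma coef_half: "supported f \<gamma> \<Longrightarrow> u \<in> Ugr \<kappa> \<Longrightarrow> coef a b f u \<in> half_part smul F"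
  using coef_mem M.part_half by blast

lemma supported_mult_left: "supported f \<gamma> \<Longrightarrow> supported (\<lambda>u. f (E i * u)) (\<gamma> - simple_root i)"
  unfolding supported_def
proof (intro conjI allI impI)
  assume f: "functional smul f \<and> (\<forall>\<kappa> u. u \<in> Ugr \<kappa> \<longrightarrow> \<kappa> \<noteq> \<gamma> \<longrightarrow> f u = 0)"
  then show "functional smul (\<lambda>u. f (E i * u))"
    by (intro functionalI) (simp_all add: distrib_left smul_mult_right functional_add[of smul f] functional_scale[of smul f])
  fix \<kappa> u assume "u \<in> Ugr \<kappa>" "\<kappa> \<noteq> \<gamma> - simple_root i"
  then have "E i * u \<in> Ugr (simple_root i + \<kappa>)" "simple_root i + \<kappa> \<noteq> \<gamma>"
    using U4_mult[OF U4_E] by auto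
  then show "f (E i * u) = 0" using f by blast
qed

lemma supported_mult_right: "supported f \<gamma> \<Longrightarrow> supported (\<lambda>u. f (u * E i)) (\<gamma> - simple_root i)"
  unfolding supported_def
proof (intro conjI allI impI)
  assume f: "functional smul f \<and> (\<forall>\<kappa> u. u \<in> Ugr \<kappa> \<longrightarrow> \<kappa> \<noteq> \<gamma> \<longrightarrow> f u = 0)"
  then show "functional smul (\<lambda>u. f (u * E i))"
    by (intro functionalI) (simp_all add: distrib_right smul_mult_left functional_add[of smul f] functional_scale[of smul f])
  fix \<kappa> u assume "u \<in> Ugr \<kappa>" "\<kappa> \<noteq> \<gamma> - simple_root i"
  then have "u * E i \<in> Ugr (\<kappa> + simple_root i)" "\<kappa> + simple_root i \<noteq> \<gamma>"
    using U4_mult[OF _ U4_E] by auto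
  then show "f (u * E i) = 0" using f by blast
qed

lemma coef_mult_E:
  assumes f: "supported f \<gamma>"
  shows "coef a b f (u * E i) = coef a b (\<lambda>x. f (x * E i)) u"
proof (induction u rule: all_induct)
  have f': "functional smul f" "functional smul (\<lambda>x. f (x * E i))"
    using f supported_mult_right[OF f] unfolding supported_def by blast+
  {
    case subspace
    show ?case by (rule subspaceI)
      (simp_all add: distrib_right smul_mult_left linear_add[OF coef_linear[OF f'(1)]] linear_scale[OF coef_linear[OF f'(1)]]
        linear_add[OF coef_linear[OF f'(2)]] linear_scale[OF coef_linear[OF f'(2)]]
        linear_zero[OF coef_linear[OF f'(1)]] linear_zero[OF coef_linear[OF f'(2)]])
  next
    case (monomial w a' b' w')
    show ?case
      using half_part_mult[OF half_part_word[of E w'] half_part_gen[of E i]]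
      by (simp add: mult.assoc[of _ "word E w'" "E i"] coef_apply[OF f'(1)] coef_apply[OF f'(2)] half_part_word)
  }
qed

text \<open>E_i either reaches the U^+ factor, at the cost of a scalar, or its commutator with the
  U^- factor contributes K(alpha_i) or L(alpha_i). The indices a - alpha_i and b - alpha_i are those
  that the new factor raises to a and b.\<close>

lemma coef_E_mult:
  assumes f: "supported f \<gamma>" and u: "u \<in> Ugr \<kappa>"
  shows "coef a b f (E i * u) =
    smul (inverse (chi a (simple_root i)) * chi (simple_root i) b) (coef a b (\<lambda>x. f (E i * x)) u)
    - smul (chi (simple_root i) (- (\<gamma> - \<kappa> - simple_root i))) (M.derL i (coef (a - simple_root i) b f u))
    + M.derR i (coef a (b - simple_root i) f u)"
proof -
  let ?r = "simple_root i"
  let ?Q = "\<lambda>u. coef a b f (E i * u) =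
    smul (inverse (chi a ?r) * chi ?r b) (coef a b (\<lambda>x. f (E i * x)) u)
    - smul (chi ?r (- (\<gamma> - \<kappa> - ?r))) (M.derL i (coef (a - ?r) b f u))
    + M.derR i (coef a (b - ?r) f u)"
  have f': "functional smul f" "functional smul (\<lambda>x. f (E i * x))"
    using f supported_mult_left[OF f] unfolding supported_def by blast+
  note lin = linear_add[OF coef_linear[OF f'(1)]] linear_scale[OF coef_linear[OF f'(1)]]
        linear_add[OF coef_linear[OF f'(2)]] linear_scale[OF coef_linear[OF f'(2)]]
        linear_zero[OF coef_linear[OF f'(1)]] linear_zero[OF coef_linear[OF f'(2)]]
  note h = coef_half[OF f]
  have "u \<in> Ugr \<kappa> \<and> ?Q u"
    using u
  proof (induction rule: grade_induct)
    case subspace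
    show ?case
      by (rule subspaceI)
        (auto simp: lin distrib_left smul_mult_right M.derL_zero M.derR_zero M.derL_add[OF h h] M.derR_add[OF h h]
          M.derL_scale[OF h] M.derR_scale[OF h] scale_right_distrib scale_right_diff_distrib scale_left_commute
          subspace_0[OF grade_subspace] subspace_add[OF grade_subspace] subspace_scale[OF grade_subspace] mult.commute)
  next
    case (monomial w a' b' w')
    let ?D = "M.derL i (word F w)"
    let ?D' = "M.derR i (word F w)"
    have "E i * (word F w * cartan a' b' * word E w') =
        word F w * (E i * cartan a' b') * word E w' - K ?r * ?D * cartan a' b' * word E w'
        + ?D' * (L ?r * cartan a' b') * word E w'"
    proof -
      have "E i * (word F w * cartan a' b' * word E w') = (E i * word F w) * cartan a' b' * word E w'"
        by (simp only: mult.assoc)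
      then show ?thesis
        unfolding M.E_mult_half[OF half_part_word] by (simp add: algebra_simps)
    qed
    also have "K ?r * ?D * cartan a' b' = smul (chi ?r (- (weight w - ?r))) (?D * K ?r) * cartan a' b'"
      by (simp only: M.K_part[OF M.der_part(1)[OF M.part_word]])
    also have "\<dots> = smul (chi ?r (- (weight w - ?r))) (?D * cartan (?r + a') b')"
      by (simp only: K_eq_cartan smul_mult_left mult.assoc cartan_mult add_0_left)
    also have "L ?r * cartan a' b' = cartan a' (?r + b')" by (simp add: L_eq_cartan cartan_mult)
    finally have e: "E i * (word F w * cartan a' b' * word E w') =
        smul (inverse (chi a' ?r) * chi ?r b') (word F w * cartan a' b' * (E i * word E w'))
        - smul (chi ?r (- (weight w - ?r))) (?D * cartan (?r + a') b' * word E w')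
        + ?D' * cartan a' (?r + b') * word E w'"
      unfolding E_cartan by (simp only: smul_mult_left smul_mult_right mult.assoc)
    have lin': "coef a b f (x - y + z) = coef a b f x - coef a b f y + coef a b f z"
      "coef a b f (smul c x) = smul c (coef a b f x)" for x y z c
      by (simp_all add: lin linear_diff[OF coef_linear[OF f'(1)]])
    \<comment> \<open>The scalar in the claim is written with gamma - kappa; this equals the weight
      of w whenever f does not annihilate the term.\<close>
    have w: "weight w = \<gamma> - \<kappa>" if "f (word E w') \<noteq> 0"
    proof -
      have "weight w' = \<gamma>" using that f E_word_grade[of w'] unfolding supported_def by blast
      then show ?thesis using monomial by (simp add: algebra_simps)
    qed
    note hw = half_part_word[of F w] half_part_word[of E w'] M.derives_der(1,2)[OF half_part_word, of i w]
      half_part_mult[OF half_part_gen[of E i] half_part_word[of E w']]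
    have s: "(a' = a - ?r) = (?r + a' = a)" "(b' = b - ?r) = (?r + b' = b)" by (auto simp: algebra_simps)
    have "?Q (word F w * cartan a' b' * word E w')"
      unfolding e lin'
      by (cases "f (word E w') = 0")
        (auto simp: coef_apply[OF f'(1)] coef_apply[OF f'(2)] hw w s M.derL_zero M.derR_zero M.derL_scale M.derR_scale
          scale_left_commute mult.commute)
    then show ?case using monomial_grade[of "(w, a', b', w')"] monomial
      by (simp add: monomial_def mono_degree_def)
  qed
  then show ?thesis by blast
qed

text \<open>Finitely many monomials make up W. The bound is uniform in b and f, as the induction on
  the exponent of K demands.\<close>

lemma coef_vanish:
  fixes W :: 'u
  shows "\<exists>m :: int. \<forall>a b f. functional smul f \<longrightarrow> (\<Sum>j\<in>UNIV. a $ j) < m \<longrightarrow> coef a b f W = 0"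
proof (induction W rule: all_induct)
  case subspace
  show ?case
  proof (rule subspaceI, unfold mem_Collect_eq)
    show "\<exists>m :: int. \<forall>a b f. functional smul f \<longrightarrow> (\<Sum>j\<in>UNIV. a $ j) < m \<longrightarrow> coef a b f 0 = 0"
      using linear_zero[OF coef_linear] by blast
  next
    fix x y :: 'u
    assume "\<exists>m :: int. \<forall>a b f. functional smul f \<longrightarrow> (\<Sum>j\<in>UNIV. a $ j) < m \<longrightarrow> coef a b f x = 0"
      "\<exists>m :: int. \<forall>a b f. functional smul f \<longrightarrow> (\<Sum>j\<in>UNIV. a $ j) < m \<longrightarrow> coef a b f y = 0"
    then obtain m m' :: int
      where "\<forall>a b f. functional smul f \<longrightarrow> (\<Sum>j\<in>UNIV. a $ j) < m \<longrightarrow> coef a b f x = 0"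
      "\<forall>a b f. functional smul f \<longrightarrow> (\<Sum>j\<in>UNIV. a $ j) < m' \<longrightarrow> coef a b f y = 0"
      by (elim exE) (rule that)
    then show "\<exists>m :: int. \<forall>a b f. functional smul f \<longrightarrow> (\<Sum>j\<in>UNIV. a $ j) < m \<longrightarrow> coef a b f (x + y) = 0"
      by (intro exI[of _ "min m m'"]) (simp add: linear_add[OF coef_linear])
  next
    fix c and x :: 'u
    assume "\<exists>m :: int. \<forall>a b f. functional smul f \<longrightarrow> (\<Sum>j\<in>UNIV. a $ j) < m \<longrightarrow> coef a b f x = 0"
    then obtain m :: int
      where "\<forall>a b f. functional smul f \<longrightarrow> (\<Sum>j\<in>UNIV. a $ j) < m \<longrightarrow> coef a b f x = 0"
      by (elim exE) (rule that)
    then show "\<exists>m :: int. \<forall>a b f. functional smul f \<longrightarrow> (\<Sum>j\<in>UNIV. a $ j) < m \<longrightarrow> coef a b f (smul c x) = 0"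
      by (intro exI[of _ m]) (simp add: linear_scale[OF coef_linear])
  qed
next
  case (monomial w a' b' w')
  show ?case
    by (intro exI[of _ "\<Sum>j\<in>UNIV. a' $ j"]) (auto simp: coef_apply half_part_word)
qed

text \<open>W is rebuilt from its coefficients: the functionals \<open>p \<gamma> s\<close> pair the
  degree gamma component with the dual basis, and \<open>dual_x_expand\<close> recovers the U^+
  factor.\<close>

lemma eq_0_if_coef_0:
  assumes "\<And>a b f \<gamma>. supported f \<gamma> \<Longrightarrow> coef a b f W = 0"
  shows "W = 0"
proof -
  define p where "p \<gamma> s u = psi (comps u \<gamma> * dual_y \<gamma> s)" for \<gamma> s u
  have fp: "functional smul (p \<gamma> s)" for \<gamma> s
    unfolding p_def by (rule functionalI)
      (simp_all add: comps_add comps_scale distrib_right smul_mult_left psi_linear)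
  have sp: "supported (p \<gamma> s) \<gamma>" for \<gamma> s
    unfolding supported_def using fp comps_homogeneous[OF UNIV_I] by (auto simp: p_def psi_linear)
  define R where "R u m = (case m of (a, b, \<gamma>) \<Rightarrow>
      (\<Sum>s<dual_dim \<gamma>. coef a b (p \<gamma> s) u * cartan a b * dual_x \<gamma> s))" for u m
  have lin: "Vector_Spaces.linear smul smul (\<lambda>u. R u m)" for m
    by (rule linear_selfI; cases m)
      (simp_all add: R_def linear_add[OF coef_linear[OF fp]] linear_scale[OF coef_linear[OF fp]] distrib_right
        smul_mult_left sum.distrib scale_sum_right)
  \<comment> \<open>Allowing every finite superset of A makes the claim stable under sums.\<close>
  have "\<exists>A. finite A \<and> (\<forall>B. finite B \<longrightarrow> A \<subseteq> B \<longrightarrow> W = (\<Sum>m\<in>B. R W m))"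
  proof (induction W rule: all_induct)
    case subspace
    show ?case
    proof (rule subspaceI, unfold mem_Collect_eq)
      show "\<exists>A. finite A \<and> (\<forall>B. finite B \<longrightarrow> A \<subseteq> B \<longrightarrow> 0 = (\<Sum>m\<in>B. R 0 m))"
        by (intro exI[of _ "{}"]) (simp add: linear_zero[OF lin])
    next
      fix x y
      assume "\<exists>A. finite A \<and> (\<forall>B. finite B \<longrightarrow> A \<subseteq> B \<longrightarrow> x = (\<Sum>m\<in>B. R x m))"
        "\<exists>A. finite A \<and> (\<forall>B. finite B \<longrightarrow> A \<subseteq> B \<longrightarrow> y = (\<Sum>m\<in>B. R y m))"
      then obtain A A' where "finite A" "\<forall>B. finite B \<longrightarrow> A \<subseteq> B \<longrightarrow> x = (\<Sum>m\<in>B. R x m)"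
        "finite A'" "\<forall>B. finite B \<longrightarrow> A' \<subseteq> B \<longrightarrow> y = (\<Sum>m\<in>B. R y m)"
        by (elim exE conjE) (rule that)
      then show "\<exists>A. finite A \<and> (\<forall>B. finite B \<longrightarrow> A \<subseteq> B \<longrightarrow> x + y = (\<Sum>m\<in>B. R (x + y) m))"
        by (intro exI[of _ "A \<union> A'"]) (simp add: linear_add[OF lin] sum.distrib)
    next
      fix c x
      assume "\<exists>A. finite A \<and> (\<forall>B. finite B \<longrightarrow> A \<subseteq> B \<longrightarrow> x = (\<Sum>m\<in>B. R x m))"
      then obtain A where "finite A" "\<forall>B. finite B \<longrightarrow> A \<subseteq> B \<longrightarrow> x = (\<Sum>m\<in>B. R x m)"
        by (elim exE conjE) (rule that)
      then show "\<exists>A. finite A \<and> (\<forall>B. finite B \<longrightarrow> A \<subseteq> B \<longrightarrow> smul c x = (\<Sum>m\<in>B. R (smul c x) m))"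
        by (intro exI[of _ A]) (simp add: linear_scale[OF lin] flip: scale_sum_right)
    qed
  next
    case (monomial w a b w')
    let ?u = "word F w * cartan a b * word E w'"
    have "R ?u m = (if m = (a, b, weight w') then ?u else 0)" for m
    proof -
      obtain a' b' \<gamma> where m: "m = (a', b', \<gamma>)" by (cases m) auto
      have c: "comps (word E w') \<gamma> = (if \<gamma> = weight w' then word E w' else 0)"
        by (rule comps_homogeneous[OF UNIV_I E_word_grade])
      have "word E w' \<in> P.part (weight w')" by (rule P.part_word)
      from dual_x_expand[OF this] have x: "(\<Sum>s<dual_dim (weight w'). smul (psi (word E w' * dual_y (weight w') s)) (dual_x (weight w') s)) = word E w'" .
      have "R ?u (a, b, weight w') = word F w * cartan a b *
          (\<Sum>s<dual_dim (weight w'). smul (psi (word E w' * dual_y (weight w') s)) (dual_x (weight w') s))"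
        by (simp add: R_def coef_apply[OF fp half_part_word half_part_word] p_def
            comps_homogeneous[OF UNIV_I E_word_grade] smul_mult_left smul_mult_right sum_distrib_left)
      then have 1: "R ?u (a, b, weight w') = ?u" unfolding x .
      show ?thesis
      proof (cases "m = (a, b, weight w')")
        case False
        then have "R ?u m = 0"
          by (auto simp: m R_def coef_apply[OF fp half_part_word half_part_word] p_def c psi_linear intro!: sum.neutral)
        then show ?thesis using False by simp
      qed (use 1 in simp)
    qed
    then show ?case by (intro exI[of _ "{(a, b, weight w')}"]) simp
  qed
  moreover have "R W m = 0" for m
    using assms[OF sp] by (cases m) (simp add: R_def)
  ultimately show ?thesis by auto
qed

lemma supported_not_pos:
  assumes f: "supported f \<gamma>" and \<gamma>: "\<gamma> \<notin> pos_lattice" shows "coef a b f u = 0"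
proof (induction u rule: all_induct)
  have f': "functional smul f" using f by (simp add: supported_def)
  {
    case subspace
    show ?case using linear_subspace_vimage[OF coef_linear[OF f'] subspace_single_0] by simp
  next
    case (monomial w a' b' w')
    have "f (word E w') = 0" using f E_word_grade[of w'] weight_pos[of w'] \<gamma> unfolding supported_def by metis
    then show ?case by (simp add: coef_apply[OF f'] half_part_word)
  }
qed

text \<open>The coefficients of \<open>W\<close> in \<open>U\<^sup>-\<close> vanish by induction on the degree of the \<open>U\<^sup>+\<close> part and
  then on the exponent of \<open>K\<close>, which is bounded below.\<close>

lemma E_skew_commuting_eq_0:
  assumes W: "W \<in> Ugr (- \<delta>)" and \<delta>: "\<delta> \<in> pos_lattice" "\<delta> \<noteq> 0"
    and comm: "\<And>i. E i * W = smul (c i) (W * E i)"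
  shows "W = 0"
proof (rule eq_0_if_coef_0)
  obtain m :: int where m: "\<And>a b f. functional smul f \<Longrightarrow> (\<Sum>j\<in>UNIV. a $ j) < m \<Longrightarrow> coef a b f W = 0"
    using coef_vanish[of W] by blast
  show "coef a b f W = 0" if "supported f \<gamma>" for a b f \<gamma>
    using that
  proof (induction "height \<gamma>" arbitrary: a b f \<gamma> rule: less_induct)
    case less
    note f = less.prems
    show ?case
    proof (cases "\<gamma> \<in> pos_lattice")
      case True
      \<comment> \<open>Functionals precomposed with E_i have smaller degree, so their coefficients
        vanish by the outer induction, or trivially once the degree leaves the positive
        cone.\<close>
      have lower: "coef a b g W = 0" if g: "supported g (\<gamma> - simple_root i)" for a b g i
      proof (cases "\<gamma> - simple_root i \<in> pos_lattice")
        case True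
        show ?thesis by (rule less.hyps[OF height_diff_simple_root[OF True] g])
      qed (rule supported_not_pos[OF g])
      \<comment> \<open>The coefficients of the hypothesis on W are compared at L exponent b +
        alpha_i, so that the L term is \<open>derR\<close> of the coefficient at (a, b). The terms
        in which E_i reached the U^+ factor vanish by \<open>lower\<close>.\<close>
      have rec: "M.derR i (coef a b f W) = smul (chi (simple_root i) (- (\<gamma> + \<delta> - simple_root i)))
          (M.derL i (coef (a - simple_root i) (b + simple_root i) f W))" for i a b
      proof -
        have "functional smul f" using f by (simp add: supported_def)
        then have "coef a (b + simple_root i) f (E i * W) = smul (c i) (coef a (b + simple_root i) f (W * E i))"
          unfolding comm by (rule linear_scale[OF coef_linear])
        then have "coef a (b + simple_root i) f (E i * W) = 0"
          by (simp add: coef_mult_E[OF f] lower[OF supported_mult_right[OF f]])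
        then show ?thesis
          by (simp add: coef_E_mult[OF f W] lower[OF supported_mult_left[OF f]])
      qed
      \<comment> \<open>The coefficients have degree gamma + delta. Positivity of delta keeps them
        out of degree 0, where all skew derivations vanish.\<close>
      have ne: "\<gamma> + \<delta> \<noteq> 0"
      proof
        assume "\<gamma> + \<delta> = 0"
        then have "\<gamma> = - \<delta>" by (simp add: eq_neg_iff_add_eq_0)
        then show False using pos_lattice_antisym[OF \<delta>(1)] True \<delta>(2) by simp
      qed
      have "coef a b f W = 0" for a b
      \<comment> \<open>Passing from a to a - alpha_i lowers the sum of the entries by 1; below m
        the coefficients are 0.\<close>
      proof (induction "nat ((\<Sum>j\<in>UNIV. a $ j) - m + 1)" arbitrary: a b rule: less_induct)
        case (less a b)
        show ?case
        proof (cases "(\<Sum>j\<in>UNIV. a $ j) < m")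
          case True
          then show ?thesis using m f unfolding supported_def by blast
        next
          case False
          have "coef (a - simple_root i) (b + simple_root i) f W = 0" for i
            by (rule less) (use False sum_simple_root[of i] in \<open>simp add: sum_subtractf\<close>)
          then have "M.derR i (coef a b f W) = 0" for i by (simp add: rec M.derL_zero)
          then show ?thesis using M.derR_kernel[OF coef_mem[OF f W, of a b]] ne by simp
        qed
      qed
      then show ?thesis .
    qed (rule supported_not_pos[OF f])
  qed
qed

end

subsection \<open>The skew central element of a family of traces\<close>

lemma mult_character_zero: "mult_character \<omega> \<Longrightarrow> \<omega> 0 = 1"
  unfolding mult_character_def by (metis add_0 mult_cancel_right1)

lemma mult_character_minus: "mult_character \<omega> \<Longrightarrow> \<omega> (- x) = inverse (\<omega> x)"
  using mult_character_zero[of \<omega>] unfolding mult_character_def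
  by (metis add.right_inverse inverse_unique)

text \<open>Both the support and its translate lie in B, so the shift has no boundary terms.\<close>

lemma sum_shift:
  fixes f :: "'a::ab_group_add \<Rightarrow> 'b::comm_monoid_add"
  assumes "finite B" "\<And>b. f b \<noteq> 0 \<Longrightarrow> b \<in> B \<and> b + r \<in> B"
  shows "(\<Sum>b\<in>B. f (b - r)) = (\<Sum>b\<in>B. f b)"
proof (rule sum.reindex_bij_witness_not_neutral[of "B - {b \<in> B. f (b - r) \<noteq> 0}" "B - {b \<in> B. f b \<noteq> 0}"
      B "\<lambda>b. b + r" "\<lambda>b. b - r" B])
  show "b - r \<in> B - (B - {b \<in> B. f b \<noteq> 0})" if "b \<in> B - (B - {b \<in> B. f (b - r) \<noteq> 0})" for b
    using assms(2)[of "b - r"] that by auto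
qed (use assms in auto)

text \<open>\<open>\<tau> \<nu>\<close> stands for the trace on the weight space of weight \<open>-\<nu>\<close> relative to the highest weight.\<close>

locale trace_family = quantum_group smul chi K L E F Ugr
  for smul :: "'k::field \<Rightarrow> 'u::ring_1 \<Rightarrow> 'u"
    and chi :: "int ^ 'i::finite \<Rightarrow> int ^ 'i \<Rightarrow> 'k"
    and K L :: "int ^ 'i \<Rightarrow> 'u"
    and E F :: "'i \<Rightarrow> 'u"
    and Ugr :: "int ^ 'i \<Rightarrow> 'u set" +
  fixes \<omega> \<rho> :: "int ^ 'i \<Rightarrow> 'k"
    and lam mu :: "int ^ 'i"
    and \<tau> :: "int ^ 'i \<Rightarrow> 'u \<Rightarrow> 'k"
    and S :: "(int ^ 'i) set"
  assumes omega: "mult_character \<omega>"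
    and rho: "mult_character \<rho>"
    and rho_simple_root: "\<rho> (simple_root i) = chi (simple_root i) (simple_root i)"
    and finite_S: "finite S"
    and tau_functional: "functional smul (\<tau> \<nu>)"
    and tau_outside: "\<nu> \<notin> S \<Longrightarrow> \<tau> \<nu> u = 0"
    and tau_swap: "x \<in> Ugr \<beta> \<Longrightarrow> y \<in> Ugr (- \<beta>) \<Longrightarrow> \<tau> \<nu> (x * y) = \<tau> (\<nu> + \<beta>) (y * x)"
    and tau_K: "\<tau> \<nu> (u * K c) = chi c (mu - \<nu>) * \<omega> c * \<tau> \<nu> u"
    and tau_L: "\<tau> \<nu> (u * L c) = chi (lam + \<nu>) c * \<tau> \<nu> u"
begin

lemmas tau_linear = functional_add[OF tau_functional] functional_scale[OF tau_functional]

lemma omega_nonzero: "\<omega> x \<noteq> 0" and omega_add: "\<omega> (x + y) = \<omega> x * \<omega> y"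
  using omega unfolding mult_character_def by blast+

lemma rho_nonzero: "\<rho> x \<noteq> 0" and rho_add: "\<rho> (x + y) = \<rho> x * \<rho> y"
  using rho unfolding mult_character_def by blast+

text \<open>For any other b an element of degree -b leads out of every weight in S, and the traces
  vanish by \<open>tau_eq_0\<close>.\<close>

definition shifts :: "(int ^ 'i) set" where
  "shifts = (\<lambda>(\<nu>, \<nu>'). \<nu>' - \<nu>) ` (S \<times> S)"

text \<open>Enlarged by one simple root step so that \<open>sum_shift\<close> applies to shifts of
  b.\<close>

definition range_B :: "(int ^ 'i) set" where
  "range_B = shifts \<union> (\<Union>i. (\<lambda>b. b + simple_root i) ` shifts)"

lemma finite_range_B: "finite range_B"
  by (simp add: range_B_def shifts_def finite_S)

lemma range_B_shift: "b \<in> shifts \<Longrightarrow> b \<in> range_B \<and> b + simple_root i \<in> range_B"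
  by (auto simp: range_B_def)

lemma tau_eq_0:
  assumes "x \<in> P.part b" "y \<in> M.part b" "b \<notin> shifts" shows "\<tau> \<nu> (x * y) = 0"
proof (cases "\<nu> \<in> S")
  case True
  have "\<nu> + b \<notin> S"
  proof
    assume "\<nu> + b \<in> S"
    then have "b \<in> shifts" unfolding shifts_def using True by (auto intro!: image_eqI[of _ _ "(\<nu>, \<nu> + b)"])
    then show False using assms(3) by blast
  qed
  then show ?thesis
    using tau_swap[OF P_part_grade[OF assms(1)] M.part_grade[OF assms(2)], of \<nu>] tau_outside by simp
qed (rule tau_outside)

text \<open>The exponents are such that L(alpha_i) \<open>cf \<nu> b\<close> is
  \<open>cf \<nu>\<close> at b - alpha_i, and coincides with K(alpha_i) times \<open>cf\<close> at
  nu - alpha_i and b. These are the two shifts used in the cancellation.\<close>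

definition cf :: "int ^ 'i \<Rightarrow> int ^ 'i \<Rightarrow> 'u" where
  "cf \<nu> b = cartan (lam + \<nu>) (mu - \<nu> - b)"

text \<open>The factor \<open>chi (lam + \<nu>) b\<close> is the scalar by which L b enters the
  trace in \<open>tau_L\<close>.\<close>

definition e :: "int ^ 'i \<Rightarrow> int ^ 'i \<Rightarrow> 'k" where
  "e \<nu> b = \<rho> \<nu> / (\<omega> b * chi (lam + \<nu>) b)"

definition Zterm :: "int ^ 'i \<Rightarrow> int ^ 'i \<Rightarrow> 'u" where
  "Zterm \<nu> b = (\<Sum>s<dual_dim b. \<Sum>t<dual_dim b. smul (\<tau> \<nu> (dual_x b s * dual_y b t)) (dual_y b s * cf \<nu> b * dual_x b t))"

definition Z :: 'u where
  "Z = (\<Sum>\<nu>\<in>S. \<Sum>b\<in>range_B. smul (e \<nu> b) (Zterm \<nu> b))"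

text \<open>\<open>E i * Zterm \<nu> b\<close> splits into the following five sums, one for each way in which \<open>E i\<close> can leave
  the factors \<open>y\<^sub>s\<close> and \<open>y\<^sub>t\<close>.  The weights \<open>e \<nu> b\<close> are chosen such that \<open>R4\<close> cancels \<open>Q1\<close> after
  shifting \<open>b\<close>, and \<open>R3\<close> cancels \<open>R2\<close> after shifting \<open>\<nu>\<close>.\<close>

definition Q1 :: "'i \<Rightarrow> int ^ 'i \<Rightarrow> int ^ 'i \<Rightarrow> 'u" where
  "Q1 i \<nu> b = (\<Sum>s<dual_dim b. \<Sum>t<dual_dim b. smul (\<tau> \<nu> (dual_x b s * dual_y b t)) (dual_y b s * E i * cf \<nu> b * dual_x b t))"

definition R2 :: "'i \<Rightarrow> int ^ 'i \<Rightarrow> int ^ 'i \<Rightarrow> 'u" where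
  "R2 i \<nu> b = (\<Sum>s<dual_dim (b - simple_root i). \<Sum>t<dual_dim b.
     smul (\<tau> \<nu> (E i * dual_x (b - simple_root i) s * dual_y b t))
       (K (simple_root i) * dual_y (b - simple_root i) s * cf \<nu> b * dual_x b t))"

definition R3 :: "'i \<Rightarrow> int ^ 'i \<Rightarrow> int ^ 'i \<Rightarrow> 'u" where
  "R3 i \<nu> b = (\<Sum>s<dual_dim (b - simple_root i). \<Sum>t<dual_dim b.
     smul (\<tau> \<nu> (dual_x (b - simple_root i) s * (dual_y b t * E i)))
       (dual_y (b - simple_root i) s * L (simple_root i) * cf \<nu> b * dual_x b t))"

definition R4 :: "'i \<Rightarrow> int ^ 'i \<Rightarrow> int ^ 'i \<Rightarrow> 'u" where
  "R4 i \<nu> b = (\<Sum>s<dual_dim (b - simple_root i). \<Sum>t<dual_dim (b - simple_root i).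
     smul (\<tau> \<nu> (dual_x (b - simple_root i) s * (K (simple_root i) * dual_y (b - simple_root i) t)))
       (dual_y (b - simple_root i) s * L (simple_root i) * cf \<nu> b * (E i * dual_x (b - simple_root i) t)))"

definition R5 :: "'i \<Rightarrow> int ^ 'i \<Rightarrow> int ^ 'i \<Rightarrow> 'u" where
  "R5 i \<nu> b = (\<Sum>s<dual_dim (b - simple_root i). \<Sum>t<dual_dim (b - simple_root i).
     smul (\<tau> \<nu> (dual_x (b - simple_root i) s * (dual_y (b - simple_root i) t * L (simple_root i))))
       (dual_y (b - simple_root i) s * L (simple_root i) * cf \<nu> b * (dual_x (b - simple_root i) t * E i)))"

text \<open>E_i first meets y_s. The resulting term with x_s E_i puts E_i between x_s and y_t inside
  the trace, where the commutator formula is applied a second time, now to the sum over t.\<close>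

lemma E_Zterm: "E i * Zterm \<nu> b = Q1 i \<nu> b - R2 i \<nu> b + R3 i \<nu> b - R4 i \<nu> b + R5 i \<nu> b"
proof -
  let ?r = "simple_root i"
  let ?b = "b - ?r"
  define G where "G a x = (\<Sum>t<dual_dim b. smul (\<tau> \<nu> (x * dual_y b t)) (a * cf \<nu> b * dual_x b t))" for a x
  have G1: "Vector_Spaces.linear smul smul (\<lambda>a. G a u)" and G2: "Vector_Spaces.linear smul smul (G u)" for u
    unfolding G_def
    by (rule linear_selfI; simp add: distrib_left distrib_right smul_mult_left smul_mult_right tau_linear
        scale_right_distrib scale_left_distrib sum.distrib scale_sum_right mult.commute)+
  have "E i * Zterm \<nu> b = (\<Sum>s<dual_dim b. G (E i * dual_y b s) (dual_x b s))"
    by (simp add: Zterm_def G_def sum_distrib_left smul_mult_right mult.assoc)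
  also have "\<dots> = (\<Sum>s<dual_dim b. G (dual_y b s * E i) (dual_x b s)) - (\<Sum>s<dual_dim ?b. G (K ?r * dual_y ?b s) (E i * dual_x ?b s))
      + (\<Sum>s<dual_dim ?b. G (dual_y ?b s * L ?r) (dual_x ?b s * E i))"
    by (rule transfer_commutator[OF G1 G2])
  also have "(\<Sum>s<dual_dim b. G (dual_y b s * E i) (dual_x b s)) = Q1 i \<nu> b"
    by (simp add: G_def Q1_def)
  also have "(\<Sum>s<dual_dim ?b. G (K ?r * dual_y ?b s) (E i * dual_x ?b s)) = R2 i \<nu> b"
    by (simp add: G_def R2_def)
  also have "(\<Sum>s<dual_dim ?b. G (dual_y ?b s * L ?r) (dual_x ?b s * E i)) = (\<Sum>s<dual_dim ?b. 
      (\<Sum>t<dual_dim b. smul (\<tau> \<nu> (dual_x ?b s * (dual_y b t * E i))) (dual_y ?b s * L ?r * cf \<nu> b * dual_x b t))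
      - (\<Sum>t<dual_dim ?b. smul (\<tau> \<nu> (dual_x ?b s * (K ?r * dual_y ?b t))) (dual_y ?b s * L ?r * cf \<nu> b * (E i * dual_x ?b t)))
      + (\<Sum>t<dual_dim ?b. smul (\<tau> \<nu> (dual_x ?b s * (dual_y ?b t * L ?r))) (dual_y ?b s * L ?r * cf \<nu> b * (dual_x ?b t * E i))))"
  proof (rule sum.cong[OF refl])
    fix s
    define H where "H a x = smul (\<tau> \<nu> (dual_x ?b s * a)) (dual_y ?b s * L ?r * cf \<nu> b * x)" for a x
    have H1: "Vector_Spaces.linear smul smul (\<lambda>a. H a u)" and H2: "Vector_Spaces.linear smul smul (H u)" for u
      unfolding H_def
      by (rule linear_selfI; simp add: distrib_left smul_mult_right tau_linear
          scale_right_distrib scale_left_distrib mult.commute)+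
    have "G (dual_y ?b s * L ?r) (dual_x ?b s * E i) = (\<Sum>t<dual_dim b. H (E i * dual_y b t) (dual_x b t))"
      by (simp add: G_def H_def mult.assoc)
    also have "\<dots> = (\<Sum>t<dual_dim b. H (dual_y b t * E i) (dual_x b t)) - (\<Sum>t<dual_dim ?b. H (K ?r * dual_y ?b t) (E i * dual_x ?b t))
      + (\<Sum>t<dual_dim ?b. H (dual_y ?b t * L ?r) (dual_x ?b t * E i))"
      by (rule transfer_commutator[OF H1 H2])
    finally show "G (dual_y ?b s * L ?r) (dual_x ?b s * E i) =
      (\<Sum>t<dual_dim b. smul (\<tau> \<nu> (dual_x ?b s * (dual_y b t * E i))) (dual_y ?b s * L ?r * cf \<nu> b * dual_x b t))
      - (\<Sum>t<dual_dim ?b. smul (\<tau> \<nu> (dual_x ?b s * (K ?r * dual_y ?b t))) (dual_y ?b s * L ?r * cf \<nu> b * (E i * dual_x ?b t)))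
      + (\<Sum>t<dual_dim ?b. smul (\<tau> \<nu> (dual_x ?b s * (dual_y ?b t * L ?r))) (dual_y ?b s * L ?r * cf \<nu> b * (dual_x ?b t * E i)))"
      by (simp only: H_def)
  qed
  also have "\<dots> = R3 i \<nu> b - R4 i \<nu> b + R5 i \<nu> b"
    by (simp only: sum.distrib sum_subtractf R3_def R4_def R5_def)
  finally show ?thesis by (simp add: algebra_simps)
qed

section \<open>Cancellation between the five sums\<close>

lemma L_cf: "L (simple_root i) * cf \<nu> b = cf \<nu> (b - simple_root i)"
  by (simp add: L_eq_cartan cf_def cartan_mult algebra_simps)

text \<open>K is pulled through y_t and evaluated by \<open>tau_K\<close>, while in
  \<open>Q1\<close> E_i crosses the Cartan factor. The two scalars differ exactly by the step of
  \<open>e\<close> in b.\<close>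

lemma R4_eq: "smul (e \<nu> b) (R4 i \<nu> b) = smul (e \<nu> (b - simple_root i)) (Q1 i \<nu> (b - simple_root i))"
proof -
  let ?r = "simple_root i"
  let ?b = "b - ?r"
  have c: "chi ?r (- ?b) * (chi ?r (mu - \<nu>) * \<omega> ?r) * e \<nu> b =
      e \<nu> ?b * (inverse (chi (lam + \<nu>) ?r) * chi ?r (mu - \<nu> - ?b))"
    using omega_add[of ?b ?r] omega_nonzero[of ?r] omega_nonzero[of ?b]
    by (simp add: e_def chi_simps field_simps)
  have "smul (e \<nu> b) (smul (\<tau> \<nu> (dual_x ?b s * (K ?r * dual_y ?b t)))
       (dual_y ?b s * L ?r * cf \<nu> b * (E i * dual_x ?b t))) =
     smul (e \<nu> ?b) (smul (\<tau> \<nu> (dual_x ?b s * dual_y ?b t)) (dual_y ?b s * E i * cf \<nu> ?b * dual_x ?b t))"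
    if "s < dual_dim ?b" "t < dual_dim ?b" for s t
  proof -
    have "dual_x ?b s * (K ?r * dual_y ?b t) = smul (chi ?r (- ?b)) (dual_x ?b s * dual_y ?b t * K ?r)"
      by (simp only: M.K_part[OF dual_y_part[OF that(2)]] smul_mult_right mult.assoc)
    then have 1: "\<tau> \<nu> (dual_x ?b s * (K ?r * dual_y ?b t)) =
        chi ?r (- ?b) * (chi ?r (mu - \<nu>) * \<omega> ?r * \<tau> \<nu> (dual_x ?b s * dual_y ?b t))"
      by (simp only: tau_linear tau_K)
    have 2: "dual_y ?b s * L ?r * cf \<nu> b * (E i * dual_x ?b t) = dual_y ?b s * cf \<nu> ?b * E i * dual_x ?b t"
      using L_cf[of i \<nu> b] by (simp add: mult.assoc flip: mult.assoc[of "L ?r"])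
    have 3: "dual_y ?b s * E i * cf \<nu> ?b * dual_x ?b t =
        smul (inverse (chi (lam + \<nu>) ?r) * chi ?r (mu - \<nu> - ?b)) (dual_y ?b s * cf \<nu> ?b * E i * dual_x ?b t)"
      unfolding mult.assoc[of "dual_y ?b s" "E i"] cf_def E_cartan
      by (simp only: smul_mult_left smul_mult_right mult.assoc)
    have "e \<nu> b * (chi ?r (- ?b) * (chi ?r (mu - \<nu>) * \<omega> ?r * \<tau> \<nu> (dual_x ?b s * dual_y ?b t))) =
       (chi ?r (- ?b) * (chi ?r (mu - \<nu>) * \<omega> ?r) * e \<nu> b) * \<tau> \<nu> (dual_x ?b s * dual_y ?b t)"
      by (simp only: ac_simps)
    then show ?thesis unfolding 1 2 3 scale_scale c by (simp only: ac_simps)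
  qed
  then show ?thesis unfolding R4_def Q1_def scale_sum_right by (intro sum.cong) simp_all
qed

text \<open>Here E_i has reached the right end. The step of \<open>e\<close> in b absorbs the scalar
  of \<open>tau_L\<close> and leaves the inverse of omega(alpha_i).\<close>

lemma R5_eq: "smul (e \<nu> b) (R5 i \<nu> b) =
  smul (e \<nu> (b - simple_root i)) (smul (inverse (\<omega> (simple_root i))) (Zterm \<nu> (b - simple_root i) * E i))"
proof -
  let ?r = "simple_root i"
  let ?b = "b - ?r"
  have c: "e \<nu> b * chi (lam + \<nu>) ?r = e \<nu> ?b * inverse (\<omega> ?r)"
    using omega_add[of ?b ?r] omega_nonzero[of ?r] omega_nonzero[of ?b]
    by (simp add: e_def chi_simps field_simps)
  have "smul (e \<nu> b) (smul (\<tau> \<nu> (dual_x ?b s * (dual_y ?b t * L ?r)))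
       (dual_y ?b s * L ?r * cf \<nu> b * (dual_x ?b t * E i))) =
     smul (e \<nu> ?b) (smul (inverse (\<omega> ?r)) (smul (\<tau> \<nu> (dual_x ?b s * dual_y ?b t)) (dual_y ?b s * cf \<nu> ?b * dual_x ?b t) * E i))"
    for s t
  proof -
    have 1: "\<tau> \<nu> (dual_x ?b s * (dual_y ?b t * L ?r)) = chi (lam + \<nu>) ?r * \<tau> \<nu> (dual_x ?b s * dual_y ?b t)"
      by (simp only: tau_L flip: mult.assoc)
    have 2: "dual_y ?b s * L ?r * cf \<nu> b * (dual_x ?b t * E i) = dual_y ?b s * cf \<nu> ?b * dual_x ?b t * E i"
      using L_cf[of i \<nu> b] by (simp add: mult.assoc flip: mult.assoc[of "L ?r"])
    show ?thesis
      unfolding 1 2 scale_scale smul_mult_left mult.assoc[symmetric, where 'a = 'k] c ..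
  qed
  then show ?thesis
    unfolding R5_def Zterm_def scale_sum_right sum_distrib_right by (intro sum.cong) simp_all
qed

text \<open>Cyclicity of the trace: x_s y_t has degree -alpha_i, so moving E_i from its right to its
  left replaces nu by nu - alpha_i.\<close>

lemma R3_eq: "smul (e \<nu> b) (R3 i \<nu> b) = smul (e (\<nu> - simple_root i) b) (R2 i (\<nu> - simple_root i) b)"
proof -
  let ?r = "simple_root i"
  let ?b = "b - ?r"
  let ?n = "\<nu> - ?r"
  \<comment> \<open>After the values of chi involving b cancel, this is the equation
    \<open>rho_simple_root\<close>.\<close>
  have c: "e ?n b * chi ?r (- ?b) = e \<nu> b"
    using rho_add[of ?n ?r] rho_nonzero[of ?r] rho_simple_root[of i] omega_nonzero[of b]
    by (simp add: e_def chi_simps field_simps)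
  have "smul (e \<nu> b) (smul (\<tau> \<nu> (dual_x ?b s * (dual_y b t * E i))) (dual_y ?b s * L ?r * cf \<nu> b * dual_x b t)) =
     smul (e ?n b) (smul (\<tau> ?n (E i * dual_x ?b s * dual_y b t)) (K ?r * dual_y ?b s * cf ?n b * dual_x b t))"
    if "s < dual_dim ?b" "t < dual_dim b" for s t
  proof -
    have "dual_x ?b s * dual_y b t \<in> Ugr (?b + - b)"
      by (rule U4_mult[OF P_part_grade[OF dual_x_part[OF that(1)]] M.part_grade[OF dual_y_part[OF that(2)]]])
    then have "dual_x ?b s * dual_y b t \<in> Ugr (- ?r)" by simp
    from tau_swap[OF U4_E this, of ?n]
    have 1: "\<tau> ?n (E i * dual_x ?b s * dual_y b t) = \<tau> \<nu> (dual_x ?b s * (dual_y b t * E i))" by (simp add: mult.assoc)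
    have "K ?r * cf ?n b = L ?r * cf \<nu> b"
      by (simp add: K_eq_cartan L_eq_cartan cf_def cartan_mult algebra_simps)
    then have 2: "K ?r * dual_y ?b s * cf ?n b * dual_x b t = smul (chi ?r (- ?b)) (dual_y ?b s * L ?r * cf \<nu> b * dual_x b t)"
      unfolding M.K_part[OF dual_y_part[OF that(1)]]
      by (simp only: smul_mult_left mult.assoc flip: mult.assoc[of "K ?r"])
    have "e ?n b * (\<tau> \<nu> (dual_x ?b s * (dual_y b t * E i)) * chi ?r (- ?b)) =
       (e ?n b * chi ?r (- ?b)) * \<tau> \<nu> (dual_x ?b s * (dual_y b t * E i))" by (simp only: ac_simps)
    then show ?thesis unfolding 1 2 scale_scale c by (simp only:)
  qed
  then show ?thesis unfolding R3_def R2_def scale_sum_right by (intro sum.cong) simp_all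
qed

lemma Zterm_eq_0: "b \<notin> shifts \<Longrightarrow> Zterm \<nu> b = 0" and Q1_eq_0: "b \<notin> shifts \<Longrightarrow> Q1 i \<nu> b = 0"
  unfolding Zterm_def Q1_def by (auto intro!: sum.neutral simp: tau_eq_0[OF dual_x_part dual_y_part])

lemma R2_outside: "\<nu> \<notin> S \<Longrightarrow> R2 i \<nu> b = 0" and R3_outside: "\<nu> \<notin> S \<Longrightarrow> R3 i \<nu> b = 0"
  by (simp_all add: R2_def R3_def tau_outside)

lemma E_Z: "E i * Z = smul (inverse (\<omega> (simple_root i))) (Z * E i)"
proof -
  let ?r = "simple_root i"
  have s4: "(\<Sum>b\<in>range_B. smul (e \<nu> b) (R4 i \<nu> b)) = (\<Sum>b\<in>range_B. smul (e \<nu> b) (Q1 i \<nu> b))" for \<nu>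
  proof -
    have "(\<Sum>b\<in>range_B. smul (e \<nu> (b - ?r)) (Q1 i \<nu> (b - ?r))) = (\<Sum>b\<in>range_B. smul (e \<nu> b) (Q1 i \<nu> b))"
      by (rule sum_shift[OF finite_range_B range_B_shift]) (use Q1_eq_0 in fastforce)
    then show ?thesis by (simp only: R4_eq)
  qed
  have s5: "(\<Sum>b\<in>range_B. smul (e \<nu> b) (R5 i \<nu> b)) =
      (\<Sum>b\<in>range_B. smul (e \<nu> b) (smul (inverse (\<omega> ?r)) (Zterm \<nu> b * E i)))" for \<nu>
  proof -
    have "(\<Sum>b\<in>range_B. smul (e \<nu> (b - ?r)) (smul (inverse (\<omega> ?r)) (Zterm \<nu> (b - ?r) * E i))) =
        (\<Sum>b\<in>range_B. smul (e \<nu> b) (smul (inverse (\<omega> ?r)) (Zterm \<nu> b * E i)))"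
      by (rule sum_shift[OF finite_range_B range_B_shift]) (use Zterm_eq_0 in fastforce)
    then show ?thesis by (simp only: R5_eq)
  qed
  have s3: "(\<Sum>\<nu>\<in>S. smul (e \<nu> b) (R3 i \<nu> b)) = (\<Sum>\<nu>\<in>S. smul (e \<nu> b) (R2 i \<nu> b))" for b
  proof -
    have "(\<Sum>\<nu>\<in>S. smul (e (\<nu> - ?r) b) (R2 i (\<nu> - ?r) b)) = (\<Sum>\<nu>\<in>S. smul (e \<nu> b) (R2 i \<nu> b))"
    \<comment> \<open>A nonzero \<open>R2\<close> term at nu equals, by \<open>R3_eq\<close>, a
      nonzero \<open>R3\<close> term at nu + alpha_i; this forces both indices into S.\<close>
    proof (rule sum_shift[OF finite_S])
      fix \<nu> assume ne: "smul (e \<nu> b) (R2 i \<nu> b) \<noteq> 0"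
      have "smul (e (\<nu> + ?r) b) (R3 i (\<nu> + ?r) b) \<noteq> 0" using ne R3_eq[of "\<nu> + ?r" b i] by simp
      then show "\<nu> \<in> S \<and> \<nu> + ?r \<in> S" using ne R2_outside R3_outside by (metis scale_zero_right)
    qed
    then show ?thesis by (simp only: R3_eq)
  qed
  have s3': "(\<Sum>\<nu>\<in>S. \<Sum>b\<in>range_B. smul (e \<nu> b) (R3 i \<nu> b)) = (\<Sum>\<nu>\<in>S. \<Sum>b\<in>range_B. smul (e \<nu> b) (R2 i \<nu> b))"
    unfolding sum.swap[of _ range_B S] s3 ..
  have "E i * Z = (\<Sum>\<nu>\<in>S. \<Sum>b\<in>range_B. smul (e \<nu> b) (Q1 i \<nu> b - R2 i \<nu> b + R3 i \<nu> b - R4 i \<nu> b + R5 i \<nu> b))"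
    by (simp only: Z_def sum_distrib_left smul_mult_right E_Zterm)
  also have "\<dots> = (\<Sum>\<nu>\<in>S. \<Sum>b\<in>range_B. smul (e \<nu> b) (R5 i \<nu> b))"
    by (simp only: scale_right_distrib scale_right_diff_distrib sum.distrib sum_subtractf s4 s3') simp
  also have "\<dots> = smul (inverse (\<omega> ?r)) (Z * E i)"
    by (simp only: s5 Z_def sum_distrib_right scale_sum_right smul_mult_left scale_left_commute)
  finally show ?thesis .
qed

section \<open>Skew centrality and the image under the projection\<close>

lemma Z_grade: "Z \<in> Ugr 0"
proof -
  have "dual_y b s * cf \<nu> b * dual_x b t \<in> Ugr 0" if "s < dual_dim b" "t < dual_dim b" for s t \<nu> b
    using U4_mult[OF U4_mult[OF M.part_grade[OF dual_y_part[OF that(1)]] cartan_grade] P_part_grade[OF dual_x_part[OF that(2)]]]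
    by (simp add: cf_def)
  then show ?thesis
    unfolding Z_def Zterm_def
    by (intro subspace_sum[OF grade_subspace] subspace_scale[OF grade_subspace]) auto
qed

lemma Z_F: "Z * F i = smul (\<omega> (- simple_root i)) (F i * Z)"
proof -
  let ?r = "simple_root i"
  let ?W = "Z * F i - smul (\<omega> (- ?r)) (F i * Z)"
  have "?W = 0"
  proof (rule E_skew_commuting_eq_0[of ?W ?r "\<lambda>j. inverse (\<omega> (simple_root j))"])
    show "?W \<in> Ugr (- ?r)"
      using U4_mult[OF Z_grade U4_F[of i]] U4_mult[OF U4_F[of i] Z_grade]
      by (auto intro!: subspace_diff[OF grade_subspace] subspace_scale[OF grade_subspace])
    fix j
    let ?h = "if j = i then - K (simple_root j) + L (simple_root j) else 0"
    have EF: "E j * F i = F i * E j + ?h" using U2_EF[of j i] by (simp add: algebra_simps)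
    have h: "Z * ?h = ?h * Z"
      by (simp add: K_grade[OF Z_grade] L_grade[OF Z_grade] chi_simps left_diff_distrib right_diff_distrib)
    \<comment> \<open>For j = i the two scalars agree; for j different from i both sides are
      0.\<close>
    have om: "smul (\<omega> (- ?r)) (?h * Z) = smul (inverse (\<omega> (simple_root j))) (?h * Z)"
      by (simp add: mult_character_minus[OF omega])
    have "E j * ?W = (E j * Z) * F i - smul (\<omega> (- ?r)) ((E j * F i) * Z)"
      by (simp only: right_diff_distrib smul_mult_right mult.assoc)
    also have "\<dots> = smul (inverse (\<omega> (simple_root j))) (Z * (E j * F i)) - smul (\<omega> (- ?r)) ((E j * F i) * Z)"
      by (simp only: E_Z smul_mult_left mult.assoc)
    also have "\<dots> = smul (inverse (\<omega> (simple_root j))) (Z * (F i * E j)) - smul (\<omega> (- ?r)) (F i * (E j * Z))"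
      by (simp only: EF distrib_left distrib_right scale_right_distrib h om mult.assoc) simp
    also have "\<dots> = smul (inverse (\<omega> (simple_root j))) (?W * E j)"
      by (simp only: E_Z left_diff_distrib smul_mult_left smul_mult_right scale_right_diff_distrib mult.assoc
          scale_left_commute)
    finally show "E j * ?W = smul (inverse (\<omega> (simple_root j))) (?W * E j)" .
  qed simp_all
  then show ?thesis by simp
qed

lemma Z_skew_center: "Z \<in> skew_center smul Ugr \<omega>"
proof (rule skew_centerI[OF omega Z_grade _ Z_F])
  show "Z * E i = smul (\<omega> (simple_root i)) (E i * Z)" for i
    by (simp add: E_Z omega_nonzero)
qed

text \<open>For nonzero b the counit kills y_s. In degree 0 the dual bases consist of scalars, and
  expanding 1 in them shows that the products of the counits of y_s and x_s sum to 1; the double sum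
  contains this sum as a factor twice.\<close>

lemma Sh_Zterm: "Sh smul K L E F (Zterm \<nu> b) = (if b = 0 then smul (\<tau> \<nu> 1) (cf \<nu> 0) else 0)"
proof -
  have eq: "Sh smul K L E F (Zterm \<nu> b) = (\<Sum>s<dual_dim b. \<Sum>t<dual_dim b.
      smul (\<tau> \<nu> (dual_x b s * dual_y b t) * (eps (dual_y b s) * eps (dual_x b t))) (cf \<nu> b))"
    unfolding Zterm_def linear_sum[OF Sh_linear] linear_scale[OF Sh_linear] cf_def
    by (intro sum.cong) (simp_all add: Sh_apply M.part_half[OF dual_y_part] P.part_half[OF dual_x_part])
  show ?thesis
  proof (cases "b = 0")
    case False
    then have "eps (dual_y b s) = 0" if "s < dual_dim b" for s
      using eps_grade[OF M.part_grade[OF dual_y_part[OF that]]] by simp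
    then show ?thesis using False eq by simp
  next
    case True
    have scalar: "dual_x 0 s = smul (eps (dual_x 0 s)) 1" "dual_y 0 s = smul (eps (dual_y 0 s)) 1" if "s < dual_dim 0" for s
      using P.part_0[OF dual_x_part[OF that]] M.part_0[OF dual_y_part[OF that]] by (auto simp: eps_linear)
    have "(\<Sum>s<dual_dim 0. smul (psi (1 * dual_y 0 s)) (dual_x 0 s)) = 1"
      using dual_x_expand[of 1 0] P.part_word[of "[]"] by simp
    then have "eps (\<Sum>s<dual_dim 0. smul (psi (1 * dual_y 0 s)) (dual_x 0 s)) = 1" by simp
    then have one: "(\<Sum>s<dual_dim 0. eps (dual_y 0 s) * eps (dual_x 0 s)) = 1"
      by (simp add: functional_sum[OF eps_functional] eps_linear psi_half[OF M.part_half[OF dual_y_part]])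
    have "(\<Sum>s<dual_dim 0. \<Sum>t<dual_dim 0. \<tau> \<nu> (dual_x 0 s * dual_y 0 t) * (eps (dual_y 0 s) * eps (dual_x 0 t))) =
        (\<Sum>s<dual_dim 0. \<Sum>t<dual_dim 0. \<tau> \<nu> 1 * ((eps (dual_y 0 s) * eps (dual_x 0 s)) * (eps (dual_y 0 t) * eps (dual_x 0 t))))"
    proof (intro sum.cong refl)
      fix s t assume st: "s \<in> {..<dual_dim 0}" "t \<in> {..<dual_dim 0}"
      have "dual_x 0 s * dual_y 0 t = smul (eps (dual_x 0 s)) 1 * smul (eps (dual_y 0 t)) 1"
        using scalar st by simp
      then have "dual_x 0 s * dual_y 0 t = smul (eps (dual_x 0 s) * eps (dual_y 0 t)) 1"
        by (simp add: smul_mult_left smul_mult_right)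
      then show "\<tau> \<nu> (dual_x 0 s * dual_y 0 t) * (eps (dual_y 0 s) * eps (dual_x 0 t)) =
          \<tau> \<nu> 1 * ((eps (dual_y 0 s) * eps (dual_x 0 s)) * (eps (dual_y 0 t) * eps (dual_x 0 t)))"
        by (simp add: tau_linear)
    qed
    also have "\<dots> = \<tau> \<nu> 1" by (simp only: sum_distrib_left[symmetric] one mult_1_right)
    finally show ?thesis using True eq by (simp flip: scale_sum_left)
  qed
qed

lemma Sh_Z: "Sh smul K L E F Z = (\<Sum>\<nu>\<in>S. smul (\<rho> \<nu> * \<tau> \<nu> 1) (K (lam + \<nu>) * L (mu - \<nu>)))"
proof -
  \<comment> \<open>0 is the difference of any weight with itself; if S is empty, both outer sums
    are empty.\<close>
  have z: "S \<noteq> {} \<Longrightarrow> 0 \<in> range_B" by (force simp: range_B_def shifts_def)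
  have "Sh smul K L E F Z = (\<Sum>\<nu>\<in>S. \<Sum>b\<in>range_B. if b = 0 then smul (e \<nu> 0) (smul (\<tau> \<nu> 1) (cf \<nu> 0)) else 0)"
    unfolding Z_def linear_sum[OF Sh_linear] linear_scale[OF Sh_linear] Sh_Zterm
    by (intro sum.cong) auto
  also have "\<dots> = (\<Sum>\<nu>\<in>S. smul (e \<nu> 0) (smul (\<tau> \<nu> 1) (cf \<nu> 0)))"
    using z finite_range_B by (intro sum.cong) auto
  also have "\<dots> = (\<Sum>\<nu>\<in>S. smul (\<rho> \<nu> * \<tau> \<nu> 1) (K (lam + \<nu>) * L (mu - \<nu>)))"
    by (simp add: e_def cf_def cartan_def mult_character_zero[OF omega] chi_simps)
  finally show ?thesis .
qed

end

subsection \<open>The character \<open>rho_hat\<close>\<close>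

lemma mult_character_eqI:
  fixes r r' :: "int ^ 'i::finite \<Rightarrow> 'k::field"
  assumes r: "mult_character r" and r': "mult_character r'"
    and eq: "\<And>i. r (simple_root i) = r' (simple_root i)"
  shows "r = r'"
proof
  fix \<nu> :: "int ^ 'i"
  have add: "r (x + y) = r x * r y" "r' (x + y) = r' x * r' y" for x y
    using r r' unfolding mult_character_def by blast+
  have zero: "r 0 = 1" "r' 0 = 1" using r r' by (simp_all add: mult_character_zero)
  have axis: "r (axis i n) = r' (axis i n)" for i n
  proof (induction n rule: int_induct[where k = 0])
    case base
    show ?case using zero by (simp add: axis_def flip: zero_vec_def)
  next
    case (step1 n)
    have "axis i (n + 1) = axis i n + simple_root i" by (simp add: simple_root_def axis_def vec_eq_iff)
    then show ?case using step1 eq by (simp add: add)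
  next
    case (step2 n)
    have "axis i (n - 1) = axis i n + - simple_root i" by (simp add: simple_root_def axis_def vec_eq_iff)
    then show ?case using step2 eq
      by (simp add: add mult_character_minus[OF r] mult_character_minus[OF r'] del: add_uminus_conv_diff)
  qed
  have sums: "r (\<Sum>i\<in>A. axis i (\<nu> $ i)) = r' (\<Sum>i\<in>A. axis i (\<nu> $ i))" for A :: "'i set"
    by (induction A rule: infinite_finite_induct) (simp_all add: add zero axis)
  have "(\<Sum>i\<in>UNIV. axis i (\<nu> $ i)) = \<nu>"
    by (simp add: vec_eq_iff axis_def)
  then show "r \<nu> = r' \<nu>" using sums[of UNIV] by simp
qed

text \<open>Products of integer powers give existence and \<open>mult_character_eqI\<close> gives
  uniqueness, which resolves the definite description of \<open>rho_hat\<close>.\<close>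

lemma
  fixes chi :: "int ^ 'i::finite \<Rightarrow> int ^ 'i \<Rightarrow> 'k::field"
  assumes "bicharacter chi"
  shows rho_hat_character: "mult_character (rho_hat chi)"
    and rho_hat_simple_root: "rho_hat chi (simple_root j) = chi (simple_root j) (simple_root j)"
proof -
  let ?r = "\<lambda>\<nu>. \<Prod>i\<in>UNIV. chi (simple_root i) (simple_root i) powi (\<nu> $ i)"
  have nz: "chi x y \<noteq> 0" for x y by (rule bichar_nonzero[OF assms])
  have "mult_character ?r"
    unfolding mult_character_def by (simp add: nz power_int_add prod.distrib)
  moreover have "?r (simple_root j) = chi (simple_root j) (simple_root j)" for j
  proof -
    have "?r (simple_root j) = (\<Prod>i\<in>UNIV. if i = j then chi (simple_root j) (simple_root j) else 1)"
      by (rule prod.cong) (auto simp: simple_root_def axis_def)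
    then show ?thesis by simp
  qed
  ultimately have "\<exists>!r. mult_character r \<and> (\<forall>j. r (simple_root j) = chi (simple_root j) (simple_root j))"
    by (intro ex1I[of _ ?r]) (auto intro: mult_character_eqI)
  from theI'[OF this] show "mult_character (rho_hat chi)"
    "rho_hat chi (simple_root j) = chi (simple_root j) (simple_root j)"
    unfolding rho_hat_def by blast+
qed

subsection \<open>Traces on the weight spaces\<close>

locale highest_weight_module = quantum_group smul chi K L E F Ugr +
    simple_highest_weight_module smul K L E F Ugr \<Lambda> smulV act v
  for smul :: "'k::field \<Rightarrow> 'u::ring_1 \<Rightarrow> 'u"
    and chi :: "int ^ 'i::finite \<Rightarrow> int ^ 'i \<Rightarrow> 'k"
    and K L :: "int ^ 'i \<Rightarrow> 'u"
    and E F :: "'i \<Rightarrow> 'u"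
    and Ugr :: "int ^ 'i \<Rightarrow> 'u set"
    and \<Lambda> :: "'u \<Rightarrow> 'k"
    and smulV :: "'k \<Rightarrow> 'v::ab_group_add \<Rightarrow> 'v"
    and act :: "'u \<Rightarrow> 'v \<Rightarrow> 'v"
    and v :: 'v +
  fixes \<omega> :: "int ^ 'i \<Rightarrow> 'k"
    and lam mu :: "int ^ 'i"
  assumes omega: "mult_character \<omega>"
    and weight_value: "\<Lambda> (K lam' * L mu') = chi lam mu' * chi lam' mu * \<omega> lam'"
    and finite_dim: "finite_dimensional smulV"
begin

section \<open>Weight spaces of the module\<close>

definition wt :: "int ^ 'i \<Rightarrow> 'v set" where
  "wt \<nu> = weight_part smul F Ugr act v \<nu>"

lemma wt_eq: "wt \<nu> = (\<lambda>Y. act Y v) ` M.part \<nu>"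
  by (simp add: wt_def weight_part_def M.part_def)

sublocale Vg: graded_space smulV pos_lattice wt
proof unfold_locales
  have "wt = weight_part smul F Ugr act v" by (rule ext) (rule wt_def)
  then show "internal_direct_sum smulV pos_lattice wt" using weight_decomposition by simp
qed

lemma act_zero_left: "act 0 w = 0" and act_zero_right: "act u 0 = 0"
  using act_add_left[of 0 0 w] act_add_right[of u 0 0] by simp_all

lemma act_sum_right: "act u (sum g A) = (\<Sum>a\<in>A. act u (g a))"
  by (induction A rule: infinite_finite_induct) (simp_all add: act_zero_right act_add_right)

lemma wt_subspace: "V.subspace (wt \<nu>)"
  unfolding wt_eq
proof (rule V.subspaceI)
  show "0 \<in> (\<lambda>Y. act Y v) ` M.part \<nu>"
    using act_zero_left subspace_0[OF M.part_subspace] by (metis imageI)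
qed (auto simp: act_add_left[symmetric] act_smul_left[symmetric] intro!: imageI
    subspace_add[OF M.part_subspace] subspace_scale[OF M.part_subspace])

lemma wt_not_pos: "\<nu> \<notin> pos_lattice \<Longrightarrow> x \<in> wt \<nu> \<Longrightarrow> x = 0"
  unfolding wt_eq using M.part_eq_0[of \<nu>] act_zero_left by blast

lemma E_word_annihilates: "w \<noteq> [] \<Longrightarrow> act (word E w) v = 0"
  by (cases w rule: rev_cases) (simp_all add: act_mult E_annihilates act_zero_right)

text \<open>A nonempty E word kills v and the Cartan factor acts on v by a scalar, so only the F
  word of a monomial moves v.\<close>

lemma act_v: "u \<in> Ugr \<kappa> \<Longrightarrow> act u v \<in> wt (- \<kappa>)"
proof (induction rule: grade_induct)
  case subspace
  show ?case
    by (rule subspaceI) (simp_all add: act_zero_left act_add_left act_smul_left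
      V.subspace_0[OF wt_subspace] V.subspace_add[OF wt_subspace] V.subspace_scale[OF wt_subspace])
next
  case (monomial w a b w')
  show ?case
  proof (cases "w' = []")
    case True
    have "act (word F w * cartan a b) v = smulV (\<Lambda> (cartan a b)) (act (word F w) v)"
      by (simp add: act_mult highest_weight[OF cartan_mem] act_smul_right)
    moreover have "act (word F w) v \<in> wt (- \<kappa>)"
      using monomial True M.part_word[of w] unfolding wt_eq by auto
    ultimately show ?thesis using True V.subspace_scale[OF wt_subspace] by simp
  next
    case False
    then show ?thesis
      using V.subspace_0[OF wt_subspace] by (simp add: act_mult E_word_annihilates act_zero_right)
  qed
qed

lemma act_wt:
  assumes "u \<in> Ugr \<kappa>" "x \<in> wt \<nu>" shows "act u x \<in> wt (\<nu> - \<kappa>)"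
proof -
  obtain Y where Y: "Y \<in> M.part \<nu>" "x = act Y v" using assms(2) unfolding wt_eq by blast
  have "act (u * Y) v \<in> wt (- (\<kappa> + - \<nu>))"
    by (rule act_v[OF U4_mult[OF assms(1) M.part_grade[OF Y(1)]]])
  then show ?thesis using Y(2) by (simp add: act_mult)
qed

lemma act_K:
  assumes "x \<in> wt \<nu>" shows "act (K c) x = smulV (chi c (mu - \<nu>) * \<omega> c) x"
proof -
  obtain Y where Y: "Y \<in> M.part \<nu>" "x = act Y v" using assms unfolding wt_eq by blast
  have "act (K c) v = smulV (chi c mu * \<omega> c) v"
    using highest_weight[OF cartan_mem, of c 0] weight_value[of c 0] by (simp add: cartan_def U2_L_zero chi_simps)
  then have "act (K c * Y) v = smulV (chi c (mu - \<nu>) * \<omega> c) (act Y v)"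
    by (simp add: M.K_part[OF Y(1)] act_smul_left act_mult act_smul_right chi_simps ac_simps)
  then show ?thesis using Y(2) by (simp add: act_mult)
qed

lemma act_L:
  assumes "x \<in> wt \<nu>" shows "act (L c) x = smulV (chi (lam + \<nu>) c) x"
proof -
  obtain Y where Y: "Y \<in> M.part \<nu>" "x = act Y v" using assms unfolding wt_eq by blast
  have "act (L c) v = smulV (chi lam c) v"
    using highest_weight[OF cartan_mem, of 0 c] weight_value[of 0 c]
    by (simp add: cartan_def U2_K_zero chi_simps mult_character_zero[OF omega])
  then have "act (L c * Y) v = smulV (chi (lam + \<nu>) c) (act Y v)"
    by (simp add: M.L_part[OF Y(1)] act_smul_left act_mult act_smul_right chi_simps ac_simps)
  then show ?thesis using Y(2) by (simp add: act_mult)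
qed

definition wbasis :: "int ^ 'i \<Rightarrow> 'v set" where
  "wbasis \<nu> = (SOME B. B \<subseteq> wt \<nu> \<and> V.independent B \<and> wt \<nu> \<subseteq> V.span B \<and> card B = V.dim (wt \<nu>))"

lemma wbasis: "wbasis \<nu> \<subseteq> wt \<nu>" "V.independent (wbasis \<nu>)" "wt \<nu> \<subseteq> V.span (wbasis \<nu>)"
  "card (wbasis \<nu>) = V.dim (wt \<nu>)"
proof -
  have "\<exists>B. B \<subseteq> wt \<nu> \<and> V.independent B \<and> wt \<nu> \<subseteq> V.span B \<and> card B = V.dim (wt \<nu>)"
    using V.basis_exists[of "wt \<nu>"] by metis
  from someI_ex[OF this] show "wbasis \<nu> \<subseteq> wt \<nu>" "V.independent (wbasis \<nu>)" "wt \<nu> \<subseteq> V.span (wbasis \<nu>)"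
    "card (wbasis \<nu>) = V.dim (wt \<nu>)"
    unfolding wbasis_def[symmetric] by blast+
qed

lemma finite_wbasis: "finite (wbasis \<nu>)"
proof -
  obtain B where "finite_dimensional_vector_space smulV B" using finite_dim unfolding finite_dimensional_def by blast
  then interpret fd: finite_dimensional_vector_space smulV B .
  show ?thesis by (rule fd.finiteI_independent[OF wbasis(2)])
qed

text \<open>The projection to the component of nu is built in, which makes \<open>coord\<close> a
  functional on the whole module. Hence \<open>tau \<nu> u\<close> is the trace of the compression
  of u to the weight space, for u of any degree.\<close>

definition coord :: "int ^ 'i \<Rightarrow> 'v \<Rightarrow> 'v \<Rightarrow> 'k" where
  "coord \<nu> b w = V.representation (wbasis \<nu>) (Vg.comps w \<nu>) b"

lemma comps_span: "Vg.comps w \<nu> \<in> V.span (wbasis \<nu>)"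
  using Vg.comps_mem[where j = \<nu> and x = w] Vg.comps_outside[where j = \<nu> and x = w] wbasis(3)[of \<nu>] V.span_zero
  by (cases "\<nu> \<in> pos_lattice") auto

lemma coord_functional: "functional smulV (coord \<nu> b)"
  by (rule functionalI)
    (simp_all add: coord_def Vg.comps_add Vg.comps_scale V.representation_add[OF wbasis(2) comps_span comps_span]
      V.representation_scale[OF wbasis(2) comps_span])

lemma coord_expand:
  assumes "w \<in> wt \<nu>" shows "(\<Sum>b\<in>wbasis \<nu>. smulV (coord \<nu> b w) b) = w"
proof (cases "\<nu> \<in> pos_lattice")
  case True
  have "Vg.comps w \<nu> = w" using Vg.comps_homogeneous[OF True assms, of \<nu>] by simp
  then show ?thesis
    using V.sum_representation_eq[OF wbasis(2) comps_span[of w \<nu>] finite_wbasis order_refl] by (simp add: coord_def)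
next
  case False
  then have "w = 0" using wt_not_pos assms by blast
  then show ?thesis by (simp add: functional_zero[OF coord_functional])
qed

definition tau :: "int ^ 'i \<Rightarrow> 'u \<Rightarrow> 'k" where
  "tau \<nu> u = (\<Sum>b\<in>wbasis \<nu>. coord \<nu> b (act u b))"

definition weights :: "(int ^ 'i) set" where
  "weights = {\<nu>. \<nu> \<in> pos_lattice \<and> weight_mult smul F Ugr smulV act v \<nu> \<noteq> 0}"

lemma card_wbasis: "card (wbasis \<nu>) = weight_mult smul F Ugr smulV act v \<nu>"
  by (simp add: wbasis(4) weight_mult_def wt_def)

lemma wbasis_empty: "\<nu> \<notin> weights \<Longrightarrow> wbasis \<nu> = {}"
proof (cases "\<nu> \<in> pos_lattice")
  case True
  assume "\<nu> \<notin> weights"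
  then have "card (wbasis \<nu>) = 0" using True card_wbasis by (simp add: weights_def)
  then show ?thesis using finite_wbasis by simp
next
  case False
  then have "wbasis \<nu> \<subseteq> {0}" using wt_not_pos wbasis(1) by blast
  then show ?thesis using wbasis(2)[of \<nu>] V.dependent_zero by blast
qed

text \<open>Each of the finitely many basis vectors has finitely many nonzero components, and a
  weight space in which all of these components vanish is 0.\<close>

lemma finite_weights: "finite weights"
proof -
  obtain B where "finite_dimensional_vector_space smulV B" using finite_dim unfolding finite_dimensional_def by blast
  then interpret fd: finite_dimensional_vector_space smulV B .
  have "weights \<subseteq> (\<Union>b\<in>B. {j. Vg.comps b j \<noteq> 0})"
  proof
    fix \<nu> assume \<nu>: "\<nu> \<in> weights"
    show "\<nu> \<in> (\<Union>b\<in>B. {j. Vg.comps b j \<noteq> 0})"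
    proof (rule ccontr)
      assume "\<not> ?thesis"
      then have "Vg.comps b \<nu> \<in> {0}" if "b \<in> B" for b using that by auto
      then have "Vg.comps x \<nu> \<in> {0}" for x
        by (rule V.linear_span_mem[OF Vg.comps_linear V.subspace_single_0]) (auto simp: fd.span_Basis)
      then have "x = 0" if "x \<in> wt \<nu>" for x
        using Vg.comps_homogeneous[of \<nu> x \<nu>] that \<nu> by (simp add: weights_def)
      then have "wbasis \<nu> \<subseteq> {0}" using wbasis(1) by blast
      then have "wbasis \<nu> = {}" using wbasis(2)[of \<nu>] V.dependent_zero by blast
      then show False using card_wbasis[of \<nu>] \<nu> by (simp add: weights_def)
    qed
  qed
  moreover have "finite (\<Union>b\<in>B. {j. Vg.comps b j \<noteq> 0})"
    using fd.finite_Basis Vg.comps_finite by blast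
  ultimately show ?thesis by (rule finite_subset)
qed

text \<open>A product of matrices: y maps the weight space at nu to that at nu + beta, and a basis
  is inserted there. In this form \<open>tau_swap\<close> is an exchange of two finite sums.\<close>

lemma tau_product:
  assumes "x \<in> Ugr \<beta>" "y \<in> Ugr (- \<beta>)"
  shows "tau \<nu> (x * y) = (\<Sum>b\<in>wbasis \<nu>. \<Sum>c\<in>wbasis (\<nu> + \<beta>). coord (\<nu> + \<beta>) c (act y b) * coord \<nu> b (act x c))"
  unfolding tau_def
proof (rule sum.cong[OF refl])
  fix b assume "b \<in> wbasis \<nu>"
  then have "b \<in> wt \<nu>" using wbasis(1) by blast
  then have dual_y: "act y b \<in> wt (\<nu> + \<beta>)" using act_wt[OF assms(2), of b \<nu>] by simp
  have "act (x * y) b = act x (\<Sum>c\<in>wbasis (\<nu> + \<beta>). smulV (coord (\<nu> + \<beta>) c (act y b)) c)"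
    by (simp add: act_mult coord_expand[OF dual_y])
  then show "coord \<nu> b (act (x * y) b) =
      (\<Sum>c\<in>wbasis (\<nu> + \<beta>). coord (\<nu> + \<beta>) c (act y b) * coord \<nu> b (act x c))"
    by (simp add: act_sum_right act_smul_right functional_sum[OF coord_functional] functional_scale[OF coord_functional])
qed

lemma tau_one: "\<nu> \<in> pos_lattice \<Longrightarrow> tau \<nu> 1 = of_nat (weight_mult smul F Ugr smulV act v \<nu>)"
proof -
  assume \<nu>: "\<nu> \<in> pos_lattice"
  have "coord \<nu> b b = 1" if "b \<in> wbasis \<nu>" for b
    using that wbasis(1)[of \<nu>] Vg.comps_homogeneous[OF \<nu>, of b \<nu>] V.representation_basis[OF wbasis(2) that]
    by (auto simp: coord_def)
  then show ?thesis by (simp add: tau_def act_one card_wbasis[symmetric])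
qed

sublocale T: trace_family smul chi K L E F Ugr \<omega> "rho_hat chi" lam mu tau weights
proof
  show "mult_character \<omega>" by (rule omega)
  show "mult_character (rho_hat chi)" by (rule rho_hat_character[OF bicharacter])
  show "rho_hat chi (simple_root i) = chi (simple_root i) (simple_root i)" for i
    by (rule rho_hat_simple_root[OF bicharacter])
  show "finite weights" by (rule finite_weights)
  show "functional smul (tau \<nu>)" for \<nu>
    by (rule functionalI)
      (simp_all add: tau_def act_add_left act_smul_left functional_add[OF coord_functional]
        functional_scale[OF coord_functional] sum.distrib sum_distrib_left)
  show "tau \<nu> u = 0" if "\<nu> \<notin> weights" for \<nu> u
    by (simp add: tau_def wbasis_empty[OF that])
  show "tau \<nu> (x * y) = tau (\<nu> + \<beta>) (y * x)" if "x \<in> Ugr \<beta>" "y \<in> Ugr (- \<beta>)" for x y \<beta> \<nu>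
  proof -
    have x: "x \<in> Ugr (- (- \<beta>))" using that(1) by simp
    show ?thesis
      unfolding tau_product[OF that] tau_product[OF that(2) x]
      by (subst sum.swap) (simp add: mult.commute)
  qed
  show "tau \<nu> (u * K c) = chi c (mu - \<nu>) * \<omega> c * tau \<nu> u" for \<nu> u c
    unfolding tau_def sum_distrib_left
  proof (rule sum.cong[OF refl])
    fix b assume "b \<in> wbasis \<nu>"
    then have "b \<in> wt \<nu>" using wbasis(1) by blast
    then show "coord \<nu> b (act (u * K c) b) = chi c (mu - \<nu>) * \<omega> c * coord \<nu> b (act u b)"
      by (simp add: act_mult act_K act_smul_right functional_scale[OF coord_functional])
  qed
  show "tau \<nu> (u * L c) = chi (lam + \<nu>) c * tau \<nu> u" for \<nu> u c
    unfolding tau_def sum_distrib_left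
  proof (rule sum.cong[OF refl])
    fix b assume "b \<in> wbasis \<nu>"
    then have "b \<in> wt \<nu>" using wbasis(1) by blast
    then show "coord \<nu> b (act (u * L c) b) = chi (lam + \<nu>) c * coord \<nu> b (act u b)"
      by (simp add: act_mult act_L act_smul_right functional_scale[OF coord_functional])
  qed
qed

lemma skew_central_element:
  "\<exists>Z \<in> skew_center smul Ugr \<omega>.
    HC smul K L E F Ugr \<omega> Z =
      (\<Sum>\<nu> | \<nu> \<in> pos_lattice \<and> weight_mult smul F Ugr smulV act v \<nu> \<noteq> 0.
         smul (rho_hat chi \<nu> * of_nat (weight_mult smul F Ugr smulV act v \<nu>))
               (K (lam + \<nu>) * L (mu - \<nu>)))"
proof (rule bexI[OF _ T.Z_skew_center])
  show "HC smul K L E F Ugr \<omega> T.Z = (\<Sum>\<nu> | \<nu> \<in> pos_lattice \<and> weight_mult smul F Ugr smulV act v \<nu> \<noteq> 0.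
         smul (rho_hat chi \<nu> * of_nat (weight_mult smul F Ugr smulV act v \<nu>))
               (K (lam + \<nu>) * L (mu - \<nu>)))"
    unfolding HC_def restrict_apply'[OF T.Z_skew_center] T.Sh_Z
    by (rule sum.cong) (simp_all add: tau_one weights_def)
qed

end

theorem theorem3p7:
  fixes smul :: "'k::field \<Rightarrow> 'u::ring_1 \<Rightarrow> 'u"
    and chi :: "int ^ 'i::finite \<Rightarrow> int ^ 'i \<Rightarrow> 'k"
    and K L :: "int ^ 'i \<Rightarrow> 'u"
    and E F :: "'i \<Rightarrow> 'u"
    and Ugr :: "int ^ 'i \<Rightarrow> 'u set"
    and \<omega> :: "int ^ 'i \<Rightarrow> 'k"
    and lam mu :: "int ^ 'i"
    and \<Lambda> :: "'u \<Rightarrow> 'k"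
    and smulV :: "'k \<Rightarrow> 'v::ab_group_add \<Rightarrow> 'v"
    and act :: "'u \<Rightarrow> 'v \<Rightarrow> 'v"
    and v :: 'v
  assumes "bicharacter chi"
    and "mult_character \<omega>"
    and "generalized_quantum_group smul chi K L E F Ugr"
    and "alg_hom_on smul (cartan_part smul K L) \<Lambda>"
    and "\<And>lam' mu'. \<Lambda> (K lam' * L mu') = chi lam mu' * chi lam' mu * \<omega> lam'"
    and "simple_highest_weight_module smul K L E F Ugr \<Lambda> smulV act v"
    and "finite_dimensional smulV"
  shows "\<exists>Z \<in> skew_center smul Ugr \<omega>.
    HC smul K L E F Ugr \<omega> Z =
      (\<Sum>\<nu> | \<nu> \<in> pos_lattice \<and> weight_mult smul F Ugr smulV act v \<nu> \<noteq> 0.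
         smul (rho_hat chi \<nu> * of_nat (weight_mult smul F Ugr smulV act v \<nu>))
               (K (lam + \<nu>) * L (mu - \<nu>)))"
proof -
  interpret highest_weight_module smul chi K L E F Ugr \<Lambda> smulV act v \<omega> lam mu
    using assms
    by (intro highest_weight_module.intro quantum_group.intro quantum_group_axioms.intro
        highest_weight_module_axioms.intro)
  show ?thesis by (rule skew_central_element)
qed

end
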